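(* Let $\rho_{min}:\mathbb{Z}\to\mathbb{Z}$ be the function $$\rho_{min}(z)=\sum_{i=0}^{r-k}\binom{z+\alpha_i}{1}+\sum_{j=1}^k\binom{z-\beta_j}{1}-(r+1)\binom z1$$ with $(\alpha_0,\dots,\alpha_{r-k})=\alpha_{min}$ and $(\beta_1,\dots,\beta_k)=\beta_{min}$. Then the Rao function of every $(n-k)$-rope $C\subset\mathbb{P}^n$ of genus $g$ satisfies $$\rho_C(z)\ge\rho_{min}(z)\qquad\text{for all } z\in\mathbb{Z}.$$
   Context: $r:=n-2$, $1\le k\le n-2$. A curve is a closed locally Cohen-Macaulay projective subscheme of pure dimension one. A rope is a curve $C\subset\mathbb{P}^n$ supported on a line $L$ with $I_L^2\subset I_C$; an $(n-k)$-rope is a rope of degree $n-k$. Genus means arithmetic genus (so $g\le0$ for ropes). The Rao function of $C$ is $\rho_C(z)=h^1(\mathbb{P}^n,\mathcal{I}_C(z))$. Convention: $\binom ab=0$ for integers $a<b$ (so $\binom a1=\max(a,0)$). The sequences $\alpha_{min},\beta_{min}$ depend on $g,n,k$: write $-g=p_1(r+1-k)+s_1$ with $0\le s_1\le r-k$ and set $\alpha_{min}=(p_1,\dots,p_1,p_1+1,\dots,p_1+1)$, where $p_1+1$ occurs $s_1$ times and $p_1$ occurs $r+1-k-s_1$ times. Write $-g=p_2k+s_2$ with $0\le s_2<k$ and set $\beta_{min}=(p_2,\dots,p_2,p_2+1,\dots,p_2+1)$, where $p_2+1$ occurs $s_2$ times and $p_2$ occurs $k-s_2$ times. *)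

theory Defs
  imports
    Complex_Main
    "HOL-Library.Poly_Mapping"
    "HOL-Library.Function_Algebras"
    "HOL-Library.Extended_Real"
    "HOL-Computational_Algebra.Polynomial"
    "HOL-Computational_Algebra.Fraction_Field"
    "HOL-Algebra.QuotRing"
    "HOL-Algebra.Ideal_Product"
    "HOL-Algebra.Ring_Divisibility"
begin

text \<open>Supremum of the lengths of finite chains of sets, a chain with m + 1 members having length m.\<close>

definition chain_dim :: "'b set set \<Rightarrow> enat" where
  "chain_dim X =
     (SUP c \<in> {c. finite c \<and> c \<noteq> {} \<and> c \<subseteq> X \<and> (\<forall>A\<in>c. \<forall>B\<in>c. A \<subseteq> B \<or> B \<subseteq> A)}. enat (card c - 1))"

definition krull_dim :: "('b, 'm) ring_scheme \<Rightarrow> enat" where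
  "krull_dim R = chain_dim {P. primeideal P R}"

definition local_ring :: "('b, 'm) ring_scheme \<Rightarrow> bool" where
  "local_ring R \<longleftrightarrow> cring R \<and> (\<exists>!M. maximalideal M R)"

definition regular_sequence :: "('b, 'm) ring_scheme \<Rightarrow> 'b list \<Rightarrow> bool" where
  "regular_sequence R xs \<longleftrightarrow>
     set xs \<subseteq> carrier R \<and> Idl\<^bsub>R\<^esub> (set xs) \<noteq> carrier R \<and>
     (\<forall>i<length xs. \<forall>r\<in>carrier R.
        (xs ! i) \<otimes>\<^bsub>R\<^esub> r \<in> Idl\<^bsub>R\<^esub> (set (take i xs)) \<longrightarrow> r \<in> Idl\<^bsub>R\<^esub> (set (take i xs)))"

text \<open>Only used for local rings: there a regular sequence automatically lies in the maximal ideal,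
  because it generates a proper ideal.\<close>

definition local_depth :: "('b, 'm) ring_scheme \<Rightarrow> enat" where
  "local_depth R = (SUP xs \<in> {xs. regular_sequence R xs}. enat (length xs))"

definition cohen_macaulay_local :: "('b, 'm) ring_scheme \<Rightarrow> bool" where
  "cohen_macaulay_local R \<longleftrightarrow>
     local_ring R \<and> noetherian_ring R \<and> local_depth R = krull_dim R"

text \<open>Dimension of the quotient space V/W, where W is a subspace of V and V a subspace of an ambient
  space with scalar multiplication sc: the supremum of the sizes of the finite subsets of V that are
  linearly independent modulo W. The value is infinite exactly if V/W is infinite-dimensional.\<close>

definition independent_mod ::
    "('a::field \<Rightarrow> 'v \<Rightarrow> 'v::ab_group_add) \<Rightarrow> 'v set \<Rightarrow> 'v set \<Rightarrow> bool" where
  "independent_mod sc W T \<longleftrightarrow>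
     finite T \<and> (\<forall>c. (\<Sum>v\<in>T. sc (c v) v) \<in> W \<longrightarrow> (\<forall>v\<in>T. c v = 0))"

definition quot_dim ::
    "('a::field \<Rightarrow> 'v \<Rightarrow> 'v::ab_group_add) \<Rightarrow> 'v set \<Rightarrow> 'v set \<Rightarrow> enat" where
  "quot_dim sc V W = (SUP T \<in> {T. T \<subseteq> V \<and> independent_mod sc W T}. enat (card T))"

type_synonym 'a mpoly = "(nat \<Rightarrow>\<^sub>0 nat) \<Rightarrow>\<^sub>0 'a"

definition poly_ring :: "nat \<Rightarrow> 'a::field mpoly ring" where
  "poly_ring n =
     \<lparr>carrier = {p. \<forall>m\<in>Poly_Mapping.keys p. Poly_Mapping.keys m \<subseteq> {..n}},
      mult = (*), one = 1, zero = 0, add = (+)\<rparr>"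

definition var :: "nat \<Rightarrow> 'a::field mpoly" where
  "var i = Poly_Mapping.single (Poly_Mapping.single i 1) 1"

definition const :: "'a::field \<Rightarrow> 'a mpoly" where
  "const c = Poly_Mapping.single 0 c"

definition mon_degree :: "(nat \<Rightarrow>\<^sub>0 nat) \<Rightarrow> nat" where
  "mon_degree m = (\<Sum>i\<in>Poly_Mapping.keys m. Poly_Mapping.lookup m i)"

text \<open>The zero polynomial is a form of every degree.\<close>

definition forms :: "nat \<Rightarrow> nat \<Rightarrow> 'a::field mpoly set" where
  "forms n d = {p \<in> carrier (poly_ring n). \<forall>m\<in>Poly_Mapping.keys p. mon_degree m = d}"

definition homogeneous_ideal :: "nat \<Rightarrow> 'a::field mpoly set \<Rightarrow> bool" where
  "homogeneous_ideal n I \<longleftrightarrow>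
     ideal I (poly_ring n) \<and> I = Idl\<^bsub>poly_ring n\<^esub> (I \<inter> (\<Union>d. forms n d))"

text \<open>Saturation is (I : m) = I for the irrelevant ideal m.\<close>

definition saturated :: "nat \<Rightarrow> 'a::field mpoly set \<Rightarrow> bool" where
  "saturated n I \<longleftrightarrow>
     (\<forall>f\<in>carrier (poly_ring n). (\<forall>i\<le>n. var i * f \<in> I) \<longrightarrow> f \<in> I)"

text \<open>A closed subscheme of projective n-space over the field 'a is represented by its saturated
  homogeneous ideal; this correspondence is bijective. The points of the scheme are the homogeneous
  primes that contain this ideal but not the irrelevant ideal.\<close>

definition closed_subscheme :: "nat \<Rightarrow> 'a::field mpoly set \<Rightarrow> bool" where
  "closed_subscheme n I \<longleftrightarrow> homogeneous_ideal n I \<and> saturated n I"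

definition points :: "nat \<Rightarrow> 'a::field mpoly set \<Rightarrow> 'a mpoly set set" where
  "points n I =
     {P. primeideal P (poly_ring n) \<and> homogeneous_ideal n P \<and> (\<exists>i\<le>n. var i \<notin> P) \<and> I \<subseteq> P}"

text \<open>The irreducible components are the closures of the minimal points P, and the irreducible
  closed subsets of such a closure correspond to the elements of points n P.\<close>

definition pure_dimensional :: "nat \<Rightarrow> nat \<Rightarrow> 'a::field mpoly set \<Rightarrow> bool" where
  "pure_dimensional n d I \<longleftrightarrow>
     (\<forall>P\<in>points n I. (\<forall>Q\<in>points n I. Q \<subseteq> P \<longrightarrow> Q = P) \<longrightarrow> chain_dim (points n P) = enat d)"

text \<open>Homogeneous localization at P of the polynomial ring and of the ideal I, inside the fraction
  field; their quotient is the local ring at P of the scheme defined by I.\<close>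

definition hom_localization :: "nat \<Rightarrow> 'a::field mpoly set \<Rightarrow> 'a mpoly fract ring" where
  "hom_localization n P =
     \<lparr>carrier = {Fract f g | f g d. f \<in> forms n d \<and> g \<in> forms n d \<and> g \<notin> P},
      mult = (*), one = 1, zero = 0, add = (+)\<rparr>"

definition hom_localization_ideal ::
    "nat \<Rightarrow> 'a::field mpoly set \<Rightarrow> 'a mpoly set \<Rightarrow> 'a mpoly fract set" where
  "hom_localization_ideal n P I =
     {Fract f g | f g d. f \<in> I \<inter> forms n d \<and> g \<in> forms n d \<and> g \<notin> P}"

definition stalk :: "nat \<Rightarrow> 'a::field mpoly set \<Rightarrow> 'a mpoly set \<Rightarrow> 'a mpoly fract set ring" where
  "stalk n I P = hom_localization n P Quot hom_localization_ideal n P I"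

definition locally_cohen_macaulay :: "nat \<Rightarrow> 'a::field mpoly set \<Rightarrow> bool" where
  "locally_cohen_macaulay n I \<longleftrightarrow> (\<forall>P\<in>points n I. cohen_macaulay_local (stalk n I P))"

definition curve :: "nat \<Rightarrow> 'a::field mpoly set \<Rightarrow> bool" where
  "curve n C \<longleftrightarrow> closed_subscheme n C \<and> locally_cohen_macaulay n C \<and> pure_dimensional n 1 C"

definition mpoly_scale :: "'a::field \<Rightarrow> 'a mpoly \<Rightarrow> 'a mpoly" where
  "mpoly_scale c f = const c * f"

definition hilbert_function :: "nat \<Rightarrow> 'a::field mpoly set \<Rightarrow> nat \<Rightarrow> enat" where
  "hilbert_function n I t = quot_dim mpoly_scale (forms n t) (I \<inter> forms n t)"

definition hilbert_polynomial :: "nat \<Rightarrow> 'a::field mpoly set \<Rightarrow> real poly" where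
  "hilbert_polynomial n I =
     (THE p. \<forall>\<^sub>F t in sequentially.
        ereal_of_enat (hilbert_function n I t) = ereal (poly p (real t)))"

text \<open>The degree of the Hilbert polynomial is the dimension of the (nonempty) scheme.\<close>

definition scheme_degree :: "nat \<Rightarrow> 'a::field mpoly set \<Rightarrow> real" where
  "scheme_degree n I =
     fact (degree (hilbert_polynomial n I)) * lead_coeff (hilbert_polynomial n I)"

definition arithmetic_genus :: "nat \<Rightarrow> 'a::field mpoly set \<Rightarrow> real" where
  "arithmetic_genus n I =
     (- 1) ^ degree (hilbert_polynomial n I) * (poly (hilbert_polynomial n I) 0 - 1)"

definition line :: "nat \<Rightarrow> 'a::field mpoly set \<Rightarrow> bool" where
  "line n L \<longleftrightarrow>
     (\<exists>B. B \<subseteq> forms n 1 \<and> independent_mod mpoly_scale {0} B \<and> card B + 1 = n \<and>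
          L = Idl\<^bsub>poly_ring n\<^esub> B)"

definition rope :: "nat \<Rightarrow> 'a::field mpoly set \<Rightarrow> bool" where
  "rope n C \<longleftrightarrow>
     curve n C \<and>
     (\<exists>L. line n L \<and> points n C = points n L \<and> ideal_prod (poly_ring n) L L \<subseteq> C)"

text \<open>First cohomology of the twisted ideal sheaf of I, computed by the ordered Cech complex of the
  standard affine cover of projective space. The sections of the z-th twist over the locus where a
  monomial h of degree e does not vanish are the elements of degree z of the localization of I at h,
  i.e. the fractions f / h^m with f in I homogeneous of degree z + m * e.\<close>

definition sections :: "nat \<Rightarrow> 'a::field mpoly set \<Rightarrow> int \<Rightarrow> nat \<Rightarrow> 'a mpoly \<Rightarrow> 'a mpoly fract set" where
  "sections n I z e h =
     {Fract f (h ^ m) | f m d. f \<in> I \<inter> forms n d \<and> int d = z + int (m * e)}"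

text \<open>Cochains are extended by 0 outside the index pairs i < j \<le> n.\<close>

definition cech_cocycles1 ::
    "nat \<Rightarrow> 'a::field mpoly set \<Rightarrow> int \<Rightarrow> (nat \<Rightarrow> nat \<Rightarrow> 'a mpoly fract) set" where
  "cech_cocycles1 n I z =
     {s. (\<forall>i j. if i < j \<and> j \<le> n then s i j \<in> sections n I z 2 (var i * var j) else s i j = 0) \<and>
         (\<forall>i j l. i < j \<and> j < l \<and> l \<le> n \<longrightarrow> s j l - s i l + s i j = 0)}"

definition cech_coboundaries1 ::
    "nat \<Rightarrow> 'a::field mpoly set \<Rightarrow> int \<Rightarrow> (nat \<Rightarrow> nat \<Rightarrow> 'a mpoly fract) set" where
  "cech_coboundaries1 n I z =
     {(\<lambda>i j. if i < j \<and> j \<le> n then s j - s i else 0) | s. \<forall>i\<le>n. s i \<in> sections n I z 1 (var i)}"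

definition cochain_scale ::
    "'a::field \<Rightarrow> (nat \<Rightarrow> nat \<Rightarrow> 'a mpoly fract) \<Rightarrow> (nat \<Rightarrow> nat \<Rightarrow> 'a mpoly fract)" where
  "cochain_scale c s = (\<lambda>i j. Fract (const c) 1 * s i j)"

text \<open>The dimension of the first cohomology group is kept as an extended natural number, so that no
  junk value arises from an infinite-dimensional space.\<close>

definition rao_function :: "nat \<Rightarrow> 'a::field mpoly set \<Rightarrow> int \<Rightarrow> enat" where
  "rao_function n C z = quot_dim cochain_scale (cech_cocycles1 n C z) (cech_coboundaries1 n C z)"

definition int_binom :: "int \<Rightarrow> nat \<Rightarrow> int" where
  "int_binom a b = (if a < int b then 0 else int (nat a choose b))"

definition alpha_min :: "nat \<Rightarrow> nat \<Rightarrow> int \<Rightarrow> int list" where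
  "alpha_min n k g =
     (let N = (n - 2) + 1 - k; p = (- g) div int N; s = nat ((- g) mod int N)
      in replicate (N - s) p @ replicate s (p + 1))"

definition beta_min :: "nat \<Rightarrow> int \<Rightarrow> int list" where
  "beta_min k g =
     (let p = (- g) div int k; s = nat ((- g) mod int k)
      in replicate (k - s) p @ replicate s (p + 1))"

text \<open>List positions start at 0, hence the shift in the index of beta_min.\<close>

definition rho_min :: "nat \<Rightarrow> nat \<Rightarrow> int \<Rightarrow> int \<Rightarrow> int" where
  "rho_min n k g z =
     (let r = n - 2 in
        (\<Sum>i = 0..r - k. int_binom (z + alpha_min n k g ! i) 1)
      + (\<Sum>j = 1..k. int_binom (z - beta_min k g ! (j - 1)) 1)
      - int (r + 1) * int_binom z 1)"

end

theory Submission
  imports Defs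
begin

text \<open>Let \<open>L\<close> be the ideal of the line, \<open>R = K[s,t]\<close> its homogeneous coordinate ring. Because
\<open>L\<^sup>2 \<subseteq> C \<subseteq> L\<close>, the rope is encoded in the graded \<open>R\<close>-module \<open>Q = L/C\<close>, which is generated by \<open>n - 1\<close>
elements of degree 1. Write \<open>q d\<close> for the dimension of \<open>Q\<close> in degree \<open>d\<close> and \<open>N = n - 1 - k\<close>.

The sequences \<open>alpha_min\<close> and \<open>beta_min\<close> are balanced: the summands \<open>z + \<alpha>\<^sub>i\<close> never have strictly
opposite signs, and neither do the \<open>z - \<beta>\<^sub>j\<close>. A sum of positive parts is therefore the positive part
of the sum, and (\<open>rho_min_eq\<close>)
\<open>rho_min z = max (N z - g) 0 + max (k z + g) 0 - (n - 1) max z 0\<close>.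
So only Riemann-Roch type inequalities for the sheaf of \<open>Q\<close> have to be proved.

The first ingredient is that a locally Cohen-Macaulay curve has no embedded points, in the form that
the coordinate \<open>s\<close> of the line is a nonzerodivisor on \<open>Q\<close> (\<open>s_regular\<close>). Otherwise some form \<open>f\<close>
outside \<open>C\<close> is killed by \<open>s\<close> modulo \<open>C\<close>; its annihilator is then the ideal \<open>P = L + (s)\<close> of a point, whereas the
local ring of the curve at this point, having positive dimension and hence positive depth, contains a
nonunit that kills no nonzero element.

The second ingredient is the behaviour of \<open>q\<close> (\<open>conormal_dims\<close>). The increment \<open>q (d + 1) - q d\<close> is
the dimension of \<open>Q/sQ\<close> in degree \<open>d + 1\<close>. It cannot grow with \<open>d\<close>, since multiplication by \<open>t\<close> maps
\<open>Q/sQ\<close> onto itself from degree 1 on. Hence \<open>q d\<close> is eventually a linear function of \<open>d\<close>, and this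
linear function bounds \<open>q\<close> from above everywhere. The Hilbert polynomial of the rope, that is its
degree and genus, identifies the linear function as \<open>N d - g\<close> (\<open>degree_genus\<close>). Moreover
\<open>q d \<le> (n - 1) d\<close>, and \<open>q 0 = 0\<close> gives \<open>g \<le> 0\<close>.

The third ingredient is cohomological (\<open>rao_lower_bound\<close>). The sections in degree \<open>z\<close> of the sheaf of
\<open>Q\<close> are the fractions \<open>f/s\<^sup>m\<close> with \<open>t\<^sup>m f \<in> s\<^sup>m Q\<close>; for large \<open>m\<close> linear algebra shows that they form a
space of dimension at least \<open>2 q (z + m) - q (z + 2m) = N z - g\<close>. The connecting homomorphism of
\<open>0 \<rightarrow> C \<rightarrow> L \<rightarrow> Q \<rightarrow> 0\<close> sends them to the first cohomology of the ideal sheaf of the rope, and its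
kernel consists of the sections that come from forms of degree \<open>z\<close> in \<open>L\<close>. So the Rao function at \<open>z\<close>
is at least \<open>N z - g - q z\<close>, where \<open>q z = 0\<close> for negative \<open>z\<close>. Together with the upper bounds for
\<open>q z\<close> this is the assertion.\<close>

section \<open>Dimensions of quotient spaces\<close>

context vector_space
begin

text \<open>Enlarging \<open>W\<close> by one vector \<open>g\<close> costs at most one vector of an independent set: a dependency modulo
the enlarged space involves \<open>g\<close>, and any vector occurring in it can be dropped. Induction over a
spanning set then bounds the size of independent sets.\<close>

lemma exchange_independent_mod:
  assumes W: "subspace W" and T: "independent_mod scale W T"
  shows "\<exists>T'\<subseteq>T. card T \<le> Suc (card T') \<and> independent_mod scale {w + scale k g | w k. w \<in> W} T'"
proof (cases "independent_mod scale {w + scale k g | w k. w \<in> W} T")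
  case True
  then show ?thesis by (intro exI[of _ T]) auto
next
  case False
  have fin: "finite T" using T by (simp add: independent_mod_def)
  with False obtain c w k t0 where c: "(\<Sum>v\<in>T. scale (c v) v) = w + scale k g" "w \<in> W"
    and t0: "t0 \<in> T" "c t0 \<noteq> 0"
    unfolding independent_mod_def by blast
  have k: "k \<noteq> 0"
  proof
    assume "k = 0"
    then have "(\<Sum>v\<in>T. scale (c v) v) \<in> W" using c by simp
    then show False using T t0 unfolding independent_mod_def by blast
  qed
  have "independent_mod scale {w + scale k g | w k. w \<in> W} (T - {t0})"
    unfolding independent_mod_def
  proof (intro conjI allI impI)
    fix d assume "(\<Sum>v\<in>T - {t0}. scale (d v) v) \<in> {w + scale k g | w k. w \<in> W}"
    then obtain w' k' where d: "(\<Sum>v\<in>T - {t0}. scale (d v) v) = w' + scale k' g" "w' \<in> W" by blast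
    \<comment> \<open>The multiple of the dependency that is subtracted is the one that cancels \<open>g\<close>.\<close>
    define e where "e v = (if v = t0 then 0 else d v) - k' / k * c v" for v
    have "(\<Sum>v\<in>T. scale (e v) v) =
       (\<Sum>v\<in>T. scale (if v = t0 then 0 else d v) v) - scale (k' / k) (\<Sum>v\<in>T. scale (c v) v)"
      by (simp add: e_def scale_left_diff_distrib sum_subtractf scale_sum_right)
    also have "(\<Sum>v\<in>T. scale (if v = t0 then 0 else d v) v) = (\<Sum>v\<in>T - {t0}. scale (d v) v)"
      using fin t0 by (subst sum.remove[of T t0]) (auto intro!: sum.cong)
    also have "(\<Sum>v\<in>T - {t0}. scale (d v) v) - scale (k' / k) (\<Sum>v\<in>T. scale (c v) v)
        = w' - scale (k' / k) w"
      using k by (simp add: c d scale_right_distrib)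
    also have "\<dots> \<in> W" using W c d by (simp add: subspace_diff subspace_scale)
    finally have e0: "\<forall>v\<in>T. e v = 0" using T unfolding independent_mod_def by blast
    with t0 have "k' / k * c t0 = 0" by (force simp: e_def)
    with t0 k have "k' = 0" by simp
    with e0 show "\<forall>v\<in>T - {t0}. d v = 0" by (auto simp: e_def split: if_splits)
  qed (use fin in auto)
  moreover have "card T \<le> Suc (card (T - {t0}))" using fin t0 by (simp add: card_Suc_Diff1)
  ultimately show ?thesis by blast
qed

lemma independent_mod_mono:
  assumes "independent_mod scale W T" "U \<subseteq> W" "T' \<subseteq> T"
  shows "independent_mod scale U T'"
proof -
  have fin: "finite T" using assms by (simp add: independent_mod_def)
  show ?thesis
    unfolding independent_mod_def
  proof (intro conjI allI impI)
    fix c assume "(\<Sum>v\<in>T'. scale (c v) v) \<in> U"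
    moreover have "(\<Sum>v\<in>T. scale (if v \<in> T' then c v else 0) v) = (\<Sum>v\<in>T'. scale (c v) v)"
      using fin assms(3) by (intro sum.mono_neutral_cong_right) auto
    ultimately have "(\<Sum>v\<in>T. scale (if v \<in> T' then c v else 0) v) \<in> W" using assms(2) by auto
    then have "\<forall>v\<in>T. (if v \<in> T' then c v else 0) = 0"
      using assms(1) unfolding independent_mod_def
      by (elim conjE) (erule allE[of _ "\<lambda>v. if v \<in> T' then c v else 0"], blast)
    then show "\<forall>v\<in>T'. c v = 0" using assms(3) by (metis subsetD)
  qed (use fin assms(3) finite_subset in blast)
qed

lemma card_independent_mod_le:
  assumes "finite G" "subspace W" "independent_mod scale W T"
    and "\<And>t. t \<in> T \<Longrightarrow> \<exists>c. t - (\<Sum>x\<in>G. scale (c x) x) \<in> W"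
  shows "card T \<le> card G"
  using assms
proof (induction G arbitrary: W T rule: finite_induct)
  case empty
  have "t \<notin> T" for t
  proof
    assume t: "t \<in> T"
    have fin: "finite T" using empty by (simp add: independent_mod_def)
    have "(\<Sum>v\<in>T. scale (if v = t then 1 else 0) v) = t"
      using t fin by (simp add: if_distrib[of "\<lambda>c. scale c _"] sum.delta cong: if_cong)
    also have "t \<in> W" using empty(3)[OF t] by simp
    finally have "\<forall>v\<in>T. (if v = t then 1 else 0) = (0::'a)"
      using empty(2) unfolding independent_mod_def
      by (elim conjE) (erule allE[of _ "\<lambda>v. if v = t then 1 else 0"], blast)
    then show False using t by auto
  qed
  then have "T = {}" by blast
  then show ?case by simp
next
  case (insert g G)
  let ?W = "{w + scale k g | w k. w \<in> W}"
  obtain T' where T': "T' \<subseteq> T" "card T \<le> Suc (card T')" "independent_mod scale ?W T'"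
    using exchange_independent_mod[OF insert.prems(1,2)] by blast
  have sub: "subspace ?W"
  proof (rule subspaceI)
    show "0 \<in> ?W" using subspace_0[OF insert.prems(1)] by (auto intro!: exI[of _ 0])
  next
    fix x y assume "x \<in> ?W" "y \<in> ?W"
    then obtain w k w' k' where "x = w + scale k g" "w \<in> W" "y = w' + scale k' g" "w' \<in> W" by auto
    then show "x + y \<in> ?W"
      using subspace_add[OF insert.prems(1), of w w']
      by (auto intro!: exI[of _ "w + w'"] exI[of _ "k + k'"] simp: scale_left_distrib)
  next
    fix c x assume "x \<in> ?W"
    then obtain w k where "x = w + scale k g" "w \<in> W" by auto
    then show "scale c x \<in> ?W"
      using subspace_scale[OF insert.prems(1), of w c]
      by (auto intro!: exI[of _ "scale c w"] exI[of _ "c * k"] simp: scale_right_distrib)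
  qed
  have "card T' \<le> card G"
  proof (rule insert.IH[OF sub T'(3)])
    fix t assume "t \<in> T'"
    then obtain c where c: "t - (\<Sum>x\<in>insert g G. scale (c x) x) \<in> W"
      using insert.prems(3) T'(1) by blast
    have "t - (\<Sum>x\<in>G. scale (c x) x) = (t - (\<Sum>x\<in>insert g G. scale (c x) x)) + scale (c g) g"
      using insert.hyps by simp
    with c show "\<exists>c. t - (\<Sum>x\<in>G. scale (c x) x) \<in> ?W" by blast
  qed
  then show ?case using T'(2) insert.hyps by simp
qed

lemma quot_dim_le_card:
  assumes "finite G" "subspace W" "\<And>v. v \<in> V \<Longrightarrow> \<exists>c. v - (\<Sum>x\<in>G. scale (c x) x) \<in> W"
  shows "quot_dim scale V W \<le> enat (card G)"
  unfolding quot_dim_def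
  by (rule SUP_least) (use card_independent_mod_le[OF assms(1,2)] assms(3) in auto)

lemma card_le_quot_dim:
  assumes "T \<subseteq> V" "independent_mod scale W T"
  shows "enat (card T) \<le> quot_dim scale V W"
  unfolding quot_dim_def by (rule SUP_upper) (use assms in auto)

text \<open>A supremum of finitely many sizes is attained; adjoining a vector to an independent set of maximal size
produces a dependency, which can be solved for that vector.\<close>

lemma quot_dim_basis:
  assumes W: "subspace W" and m: "quot_dim scale V W = enat m"
  obtains T where "T \<subseteq> V" "independent_mod scale W T" "card T = m"
    "\<And>v. v \<in> V \<Longrightarrow> \<exists>c. v - (\<Sum>x\<in>T. scale (c x) x) \<in> W"
proof -
  have le: "card T \<le> m" if "T \<subseteq> V" "independent_mod scale W T" for T
    using card_le_quot_dim[OF that] m by simp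
  have "\<exists>T\<subseteq>V. independent_mod scale W T \<and> card T = m"
  proof (cases m)
    case 0
    then show ?thesis by (intro exI[of _ "{}"]) (auto simp: independent_mod_def)
  next
    case (Suc l)
    then have "enat l < quot_dim scale V W" using m by simp
    then obtain T where "T \<subseteq> V" "independent_mod scale W T" "l < card T"
      unfolding quot_dim_def less_SUP_iff by auto
    then show ?thesis using le[of T] Suc by (intro exI[of _ T]) auto
  qed
  then obtain T where T: "T \<subseteq> V" "independent_mod scale W T" "card T = m" by blast
  have fin: "finite T" using T by (simp add: independent_mod_def)
  have "\<exists>c. v - (\<Sum>x\<in>T. scale (c x) x) \<in> W" if v: "v \<in> V" for v
  proof (cases "v \<in> T")
    case True
    then have "(\<Sum>x\<in>T. scale (if x = v then 1 else 0) x) = v"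
      using fin by (simp add: if_distrib[of "\<lambda>c. scale c _"] sum.delta cong: if_cong)
    then show ?thesis using subspace_0[OF W] by (intro exI[of _ "\<lambda>x. if x = v then 1 else 0"]) simp
  next
    case False
    have "\<not> independent_mod scale W (insert v T)"
      using le[of "insert v T"] T v False fin by auto
    then obtain c u where c: "(\<Sum>x\<in>insert v T. scale (c x) x) \<in> W" "u \<in> insert v T" "c u \<noteq> 0"
      using fin unfolding independent_mod_def by auto
    have s: "scale (c v) v + (\<Sum>x\<in>T. scale (c x) x) \<in> W" using c(1) False fin by simp
    have nz: "c v \<noteq> 0"
    proof
      assume "c v = 0"
      then have "(\<Sum>x\<in>T. scale (c x) x) \<in> W" "u \<in> T" using s c by auto
      then show False using T(2) c(3) unfolding independent_mod_def by blast
    qed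
    have "v - (\<Sum>x\<in>T. scale (- c x / c v) x)
        = scale (1 / c v) (scale (c v) v + (\<Sum>x\<in>T. scale (c x) x))"
      using nz by (simp add: scale_right_distrib scale_sum_right sum_negf)
    then show ?thesis using subspace_scale[OF W s] by (metis)
  qed
  with T that show thesis by blast
qed

lemma quot_dim_add:
  assumes "subspace W" "subspace U" "W \<subseteq> U" "U \<subseteq> V"
  shows "quot_dim scale V W = quot_dim scale V U + quot_dim scale U W"
proof (rule antisym)
  show "quot_dim scale V W \<le> quot_dim scale V U + quot_dim scale U W"
  proof (cases "quot_dim scale V U = \<infinity> \<or> quot_dim scale U W = \<infinity>")
    case False
    then obtain a b where ab: "quot_dim scale V U = enat a" "quot_dim scale U W = enat b" by auto
    obtain A where A: "A \<subseteq> V" "independent_mod scale U A" "card A = a"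
      "\<And>v. v \<in> V \<Longrightarrow> \<exists>c. v - (\<Sum>x\<in>A. scale (c x) x) \<in> U"
      using quot_dim_basis[OF assms(2) ab(1)] by blast
    obtain B where B: "B \<subseteq> U" "independent_mod scale W B" "card B = b"
      "\<And>v. v \<in> U \<Longrightarrow> \<exists>c. v - (\<Sum>x\<in>B. scale (c x) x) \<in> W"
      using quot_dim_basis[OF assms(1) ab(2)] by blast
    have fin: "finite A" "finite B" using A B by (auto simp: independent_mod_def)
    have "quot_dim scale V W \<le> enat (card (A \<union> B))"
    proof (rule quot_dim_le_card[OF _ assms(1)])
      fix v assume "v \<in> V"
      then obtain c where c: "v - (\<Sum>x\<in>A. scale (c x) x) \<in> U" using A by blast
      then obtain d where d: "v - (\<Sum>x\<in>A. scale (c x) x) - (\<Sum>x\<in>B. scale (d x) x) \<in> W"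
        using B by blast
      define e where "e x = (if x \<in> A then c x else 0) + (if x \<in> B then d x else 0)" for x
      have "(\<Sum>x\<in>A \<union> B. scale (e x) x) =
          (\<Sum>x\<in>A \<union> B. scale (if x \<in> A then c x else 0) x) + (\<Sum>x\<in>A \<union> B. scale (if x \<in> B then d x else 0) x)"
        by (simp add: e_def scale_left_distrib sum.distrib)
      also have "(\<Sum>x\<in>A \<union> B. scale (if x \<in> A then c x else 0) x) = (\<Sum>x\<in>A. scale (c x) x)"
        using fin by (intro sum.mono_neutral_cong_right) auto
      also have "(\<Sum>x\<in>A \<union> B. scale (if x \<in> B then d x else 0) x) = (\<Sum>x\<in>B. scale (d x) x)"
        using fin by (intro sum.mono_neutral_cong_right) auto
      finally show "\<exists>c. v - (\<Sum>x\<in>A \<union> B. scale (c x) x) \<in> W"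
        using d by (metis diff_diff_eq)
    qed (use fin in auto)
    also have "\<dots> \<le> enat (card A + card B)" by (simp add: card_Un_le)
    finally show ?thesis using A B ab by simp
  qed auto
next
  have fine: "enat a + enat b \<le> quot_dim scale V W"
    if a: "A \<subseteq> V" "independent_mod scale U A" "card A = a"
      and b: "B \<subseteq> U" "independent_mod scale W B" "card B = b" for a b A B
  proof -
    have fin: "finite A" "finite B" using a b by (auto simp: independent_mod_def)
    have indU: "\<forall>v\<in>A. c v = 0" if "(\<Sum>v\<in>A. scale (c v) v) \<in> U" for c
      using a(2) that unfolding independent_mod_def by blast
    have disj: "A \<inter> B = {}"
    proof (rule ccontr)
      assume "A \<inter> B \<noteq> {}"
      then obtain v where v: "v \<in> A" "v \<in> B" by blast
      have "(\<Sum>x\<in>A. scale (if x = v then 1 else 0) x) = v"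
        using v fin by (simp add: if_distrib[of "\<lambda>c. scale c _"] sum.delta cong: if_cong)
      then have "(\<Sum>x\<in>A. scale (if x = v then 1 else 0) x) \<in> U" using v b(1) by auto
      from indU[OF this] show False using v(1) by auto
    qed
    have "independent_mod scale W (A \<union> B)"
      unfolding independent_mod_def
    proof (intro conjI allI impI)
      fix c assume "(\<Sum>v\<in>A \<union> B. scale (c v) v) \<in> W"
      then have s: "(\<Sum>v\<in>A. scale (c v) v) + (\<Sum>v\<in>B. scale (c v) v) \<in> W"
        using fin disj by (simp add: sum.union_disjoint)
      have "(\<Sum>v\<in>B. scale (c v) v) \<in> U"
        by (rule subspace_sum[OF assms(2)]) (use b(1) assms(2) subspace_scale in blast)
      from subspace_diff[OF assms(2) subsetD[OF assms(3) s] this]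
      have "(\<Sum>v\<in>A. scale (c v) v) \<in> U" by simp
      from indU[OF this] have cA: "\<forall>v\<in>A. c v = 0" .
      then have "(\<Sum>v\<in>B. scale (c v) v) \<in> W" using s by (simp add: sum.neutral)
      then have "\<forall>v\<in>B. c v = 0" using b(2) unfolding independent_mod_def by blast
      with cA show "\<forall>v\<in>A \<union> B. c v = 0" by blast
    qed (use fin in auto)
    then have "enat (card (A \<union> B)) \<le> quot_dim scale V W"
      by (intro card_le_quot_dim) (use a b assms in auto)
    then show ?thesis using fin disj a b by (simp add: card_Un_disjoint)
  qed
  show "quot_dim scale V U + quot_dim scale U W \<le> quot_dim scale V W"
  proof (cases "quot_dim scale V W")
    case (enat m)
    have "quot_dim scale V U \<le> enat m"
      unfolding enat[symmetric] unfolding quot_dim_def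
      by (rule SUP_subset_mono) (use independent_mod_mono assms in auto)
    moreover have "quot_dim scale U W \<le> enat m"
      unfolding enat[symmetric] unfolding quot_dim_def
      by (rule SUP_subset_mono) (use assms in auto)
    ultimately obtain a b where ab: "quot_dim scale V U = enat a" "quot_dim scale U W = enat b"
      by (meson enat_ile)
    show ?thesis
      unfolding ab
      by (rule quot_dim_basis[OF assms(2) ab(1)], rule quot_dim_basis[OF assms(1) ab(2)])
        (rule fine)
  qed auto
qed

end

lemma (in vector_space) quot_dim_le_card_span:
  assumes "finite G" "V \<subseteq> span G" "subspace W"
  shows "quot_dim scale V W \<le> enat (card G)"
proof (rule quot_dim_le_card[OF assms(1,3)])
  fix v assume "v \<in> V"
  then obtain c where "v = (\<Sum>x\<in>G. scale (c x) x)"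
    using assms(2) span_finite[OF assms(1)] by auto
  then show "\<exists>c. v - (\<Sum>x\<in>G. scale (c x) x) \<in> W"
    using subspace_0[OF assms(3)] by (intro exI[of _ c]) simp
qed

text \<open>Dimensions are compared along linear relations rather than linear maps, because the comparison maps
that occur below are defined only up to the subspaces divided out: a choice of lifts or of
decompositions gives a relation that is visibly linear, but no canonical function.\<close>

lemma quot_dim_relation_le:
  fixes sc :: "'a::field \<Rightarrow> 'v::ab_group_add \<Rightarrow> 'v" and sc' :: "'a \<Rightarrow> 'w::ab_group_add \<Rightarrow> 'w"
  assumes vs: "vector_space sc" "vector_space sc'"
    and r0: "r 0 0" and radd: "\<And>x y x' y'. r x y \<Longrightarrow> r x' y' \<Longrightarrow> r (x + x') (y + y')"
    and rsc: "\<And>c x y. r x y \<Longrightarrow> r (sc c x) (sc' c y)"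
    and total: "\<And>x. x \<in> V \<Longrightarrow> \<exists>y\<in>V'. r x y"
    and inj: "\<And>x y. r x y \<Longrightarrow> y \<in> W' \<Longrightarrow> x \<in> W" and W'0: "0 \<in> W'"
  shows "quot_dim sc V W \<le> quot_dim sc' V' W'"
  unfolding quot_dim_def[of sc]
proof (rule SUP_least)
  interpret A: vector_space sc by fact
  interpret B: vector_space sc' by fact
  fix T assume "T \<in> {T. T \<subseteq> V \<and> independent_mod sc W T}"
  then have T: "T \<subseteq> V" "independent_mod sc W T" by auto
  then have fin: "finite T" by (simp add: independent_mod_def)
  from total T have "\<forall>x\<in>T. \<exists>y. y \<in> V' \<and> r x y" by blast
  then obtain h where h: "\<And>x. x \<in> T \<Longrightarrow> h x \<in> V'" "\<And>x. x \<in> T \<Longrightarrow> r x (h x)" by metis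
  have rsum: "r (\<Sum>x\<in>S. sc (c x) x) (\<Sum>x\<in>S. sc' (c x) (h x))" if "S \<subseteq> T" for c S
    using finite_subset[OF that fin] that
    by (induction S rule: finite_induct) (auto simp: r0 intro!: radd rsc h)
  have key: "\<forall>x\<in>T. c x = 0" if "(\<Sum>x\<in>T. sc' (c x) (h x)) \<in> W'" for c
    using inj[OF rsum that] T(2) unfolding independent_mod_def by blast
  have injh: "inj_on h T"
  proof (rule inj_onI)
    fix x y assume xy: "x \<in> T" "y \<in> T" "h x = h y"
    show "x = y"
    proof (rule ccontr)
      assume ne: "x \<noteq> y"
      define c where "c z = (if z = x then 1 else if z = y then - 1 else (0::'a))" for z
      have "(\<Sum>z\<in>T. sc' (c z) (h z)) = (\<Sum>z\<in>{x, y}. sc' (c z) (h z))"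
        using xy fin by (intro sum.mono_neutral_right) (auto simp: c_def)
      also have "\<dots> = 0" using ne xy(3) by (simp add: c_def)
      finally have "\<forall>x\<in>T. c x = 0" using W'0 by (intro key) simp
      with xy(1) show False by (auto simp: c_def)
    qed
  qed
  have "independent_mod sc' W' (h ` T)"
    unfolding independent_mod_def
  proof (intro conjI allI impI)
    fix c assume "(\<Sum>v\<in>h ` T. sc' (c v) v) \<in> W'"
    then have "(\<Sum>x\<in>T. sc' (c (h x)) (h x)) \<in> W'" by (simp add: sum.reindex[OF injh])
    from key[OF this] show "\<forall>v\<in>h ` T. c v = 0" by blast
  qed (use fin in auto)
  then have "enat (card (h ` T)) \<le> quot_dim sc' V' W'"
    by (intro B.card_le_quot_dim) (use h in auto)
  then show "enat (card T) \<le> quot_dim sc' V' W'" by (simp add: card_image[OF injh])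
qed

section \<open>Forms and substitutions\<close>

lemma poly_ring_simps [simp]:
  "mult (poly_ring n) = (*)" "one (poly_ring n) = 1" "zero (poly_ring n) = 0" "add (poly_ring n) = (+)"
  by (simp_all add: poly_ring_def)

lemma in_poly_ring: "p \<in> carrier (poly_ring n) \<longleftrightarrow> (\<forall>m\<in>Poly_Mapping.keys p. Poly_Mapping.keys m \<subseteq> {..n})"
  by (simp add: poly_ring_def)

lemma keys_nat_add: "Poly_Mapping.keys (m + m' :: nat \<Rightarrow>\<^sub>0 nat) = Poly_Mapping.keys m \<union> Poly_Mapping.keys m'"
  by (auto simp: in_keys_iff lookup_add)

lemma const_simps [simp]:
  "const 0 = 0" "const 1 = 1"
  by (simp_all add: const_def)

lemma const_add: "const (x + y) = const x + const y"
  by (simp add: const_def single_add)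

lemma const_mult: "const (x * y) = const x * const y"
  by (simp add: const_def mult_single)

lemma const_uminus: "const (- x) = - const x"
  by (simp add: const_def single_uminus)

lemma const_eq_0_iff [simp]: "const x = 0 \<longleftrightarrow> x = 0"
  by (metis const_def lookup_single_eq lookup_zero const_simps(1))

lemma poly_ring_closed [simp, intro]:
  "0 \<in> carrier (poly_ring n)" "1 \<in> carrier (poly_ring n)"
  "p \<in> carrier (poly_ring n) \<Longrightarrow> q \<in> carrier (poly_ring n) \<Longrightarrow> p + q \<in> carrier (poly_ring n)"
  "p \<in> carrier (poly_ring n) \<Longrightarrow> q \<in> carrier (poly_ring n) \<Longrightarrow> p * q \<in> carrier (poly_ring n)"
  "p \<in> carrier (poly_ring n) \<Longrightarrow> - p \<in> carrier (poly_ring n)"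
  "const c \<in> carrier (poly_ring n)"
  "i \<le> n \<Longrightarrow> var i \<in> carrier (poly_ring n)"
proof -
  show "p * q \<in> carrier (poly_ring n)" if "p \<in> carrier (poly_ring n)" "q \<in> carrier (poly_ring n)"
    unfolding in_poly_ring
  proof
    fix m assume "m \<in> Poly_Mapping.keys (p * q)"
    then obtain a b where "m = a + b" "a \<in> Poly_Mapping.keys p" "b \<in> Poly_Mapping.keys q"
      using keys_mult[of p q] by auto
    then show "Poly_Mapping.keys m \<subseteq> {..n}" using that by (simp add: in_poly_ring keys_nat_add)
  qed
qed (use keys_add[of p q] in \<open>auto simp: in_poly_ring const_def var_def in_keys_iff[of _ "- p"]
    in_keys_iff[of _ p] split: if_splits\<close>)

lemma poly_ring_diff [simp, intro]:
  "p \<in> carrier (poly_ring n) \<Longrightarrow> q \<in> carrier (poly_ring n) \<Longrightarrow> p - q \<in> carrier (poly_ring n)"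
  using poly_ring_closed(3)[of p n "- q"] by simp

lemma poly_ring_power [simp, intro]:
  "p \<in> carrier (poly_ring n) \<Longrightarrow> p ^ k \<in> carrier (poly_ring n)"
  by (induction k) auto

lemma cring_poly_ring: "cring (poly_ring n :: 'a::field mpoly ring)"
proof (rule cringI)
  show "abelian_group (poly_ring n :: 'a mpoly ring)"
    by (rule abelian_groupI) (auto simp: algebra_simps intro: bexI[of _ "- _"])
  show "comm_monoid (poly_ring n :: 'a mpoly ring)"
    by unfold_locales (auto simp: algebra_simps)
qed (auto simp: algebra_simps)

lemma a_inv_poly_ring:
  assumes "p \<in> carrier (poly_ring n :: 'a::field mpoly ring)"
  shows "\<ominus>\<^bsub>poly_ring n\<^esub> p = - p"
proof -
  interpret cring "poly_ring n :: 'a mpoly ring" by (rule cring_poly_ring)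
  show ?thesis using minus_equality[of "- p" p] assms by auto
qed

lemma poly_idealD:
  assumes "ideal I (poly_ring n :: 'a::field mpoly ring)"
  shows "p \<in> I \<Longrightarrow> p \<in> carrier (poly_ring n)" "0 \<in> I"
    "p \<in> I \<Longrightarrow> q \<in> I \<Longrightarrow> p + q \<in> I" "p \<in> I \<Longrightarrow> q \<in> I \<Longrightarrow> p - q \<in> I" "p \<in> I \<Longrightarrow> - p \<in> I"
    "r \<in> carrier (poly_ring n) \<Longrightarrow> p \<in> I \<Longrightarrow> r * p \<in> I"
    "r \<in> carrier (poly_ring n) \<Longrightarrow> p \<in> I \<Longrightarrow> p * r \<in> I"
proof -
  interpret ideal I "poly_ring n :: 'a mpoly ring" by fact
  show A: "p \<in> carrier (poly_ring n)" if "p \<in> I" for p using that by (rule Icarr)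
  show "0 \<in> I" using additive_subgroup.zero_closed[OF is_additive_subgroup] by simp
  show B: "p + q \<in> I" if "p \<in> I" "q \<in> I" for p q using additive_subgroup.a_closed[OF is_additive_subgroup that] by simp
  show D: "r * p \<in> I" if "r \<in> carrier (poly_ring n)" "p \<in> I" for r p using I_l_closed[OF that(2,1)] by simp
  show "p * r \<in> I" if "r \<in> carrier (poly_ring n)" "p \<in> I" for r p using D[OF that] by (simp add: mult.commute)
  show E: "- p \<in> I" if "p \<in> I" for p using D[of "- 1" p] that by auto
  show "p - q \<in> I" if "p \<in> I" "q \<in> I" for p q using B[of p "- q"] E[of q] that by simp
qed

lemma mon_degree_superset:
  assumes "finite A" "Poly_Mapping.keys m \<subseteq> A"
  shows "mon_degree m = (\<Sum>i\<in>A. Poly_Mapping.lookup m i)"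
  unfolding mon_degree_def using assms by (intro sum.mono_neutral_left) (auto simp: in_keys_iff)

lemma mon_degree_add: "mon_degree (m + m') = mon_degree m + mon_degree m'"
  by (simp add: mon_degree_superset[of "Poly_Mapping.keys m \<union> Poly_Mapping.keys m'"]
      keys_nat_add lookup_add sum.distrib)

lemma mon_degree_single [simp]: "mon_degree (Poly_Mapping.single i k) = k"
  by (simp add: mon_degree_def)

lemma mon_degree_zero [simp]: "mon_degree 0 = 0"
  by (simp add: mon_degree_def)

lemma forms_iff: "p \<in> forms n d \<longleftrightarrow>
   (\<forall>m\<in>Poly_Mapping.keys p. Poly_Mapping.keys m \<subseteq> {..n} \<and> mon_degree m = d)"
  by (auto simp: forms_def in_poly_ring)

lemma forms_in_poly_ring: "p \<in> forms n d \<Longrightarrow> p \<in> carrier (poly_ring n)"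
  by (simp add: forms_def)

lemma forms_zero [simp, intro]: "0 \<in> forms n d"
  by (simp add: forms_def)

lemma forms_add [simp, intro]: "p \<in> forms n d \<Longrightarrow> q \<in> forms n d \<Longrightarrow> p + q \<in> forms n d"
  using keys_add[of p q] by (auto simp: forms_iff)

lemma forms_uminus [simp, intro]: "p \<in> forms n d \<Longrightarrow> - p \<in> forms n d"
  by (auto simp: forms_iff in_keys_iff)

lemma forms_diff [simp, intro]: "p \<in> forms n d \<Longrightarrow> q \<in> forms n d \<Longrightarrow> p - q \<in> forms n d"
  using forms_add[of p n d "- q"] by auto

lemma forms_mult [intro]: "p \<in> forms n d \<Longrightarrow> q \<in> forms n e \<Longrightarrow> p * q \<in> forms n (d + e)"
  unfolding forms_iff
proof
  fix m
  assume p: "\<forall>m\<in>Poly_Mapping.keys p. Poly_Mapping.keys m \<subseteq> {..n} \<and> mon_degree m = d"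
    and q: "\<forall>m\<in>Poly_Mapping.keys q. Poly_Mapping.keys m \<subseteq> {..n} \<and> mon_degree m = e"
    and "m \<in> Poly_Mapping.keys (p * q)"
  then obtain a b where "m = a + b" "a \<in> Poly_Mapping.keys p" "b \<in> Poly_Mapping.keys q"
    using keys_mult[of p q] by auto
  then show "Poly_Mapping.keys m \<subseteq> {..n} \<and> mon_degree m = d + e"
    using p q by (simp add: keys_nat_add mon_degree_add)
qed

lemma forms_const [simp, intro]: "const c \<in> forms n 0"
  by (auto simp: forms_iff const_def split: if_splits)

lemma forms_one [simp, intro]: "1 \<in> forms n 0"
  using forms_const[of 1 n] by simp

lemma forms_var [intro]: "i \<le> n \<Longrightarrow> var i \<in> forms n 1"
  by (auto simp: forms_iff var_def)

lemma forms_power [intro]: "p \<in> forms n d \<Longrightarrow> p ^ k \<in> forms n (k * d)"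
  by (induction k) (auto intro: forms_mult)

lemma forms_var_power [intro]: "i \<le> n \<Longrightarrow> var i ^ k \<in> forms n k"
  using forms_power[OF forms_var, of i n k] by simp

lemma forms_const_mult [intro]: "p \<in> forms n d \<Longrightarrow> const c * p \<in> forms n d"
  using forms_mult[OF forms_const[of c n], of p d] by simp

lemma forms_sum [intro]: "(\<And>x. x \<in> A \<Longrightarrow> f x \<in> forms n d) \<Longrightarrow> sum f A \<in> forms n d"
  by (induction A rule: infinite_finite_induct) auto

lemma forms_mult_var: "i \<le> n \<Longrightarrow> p \<in> forms n d \<Longrightarrow> var i * p \<in> forms n (Suc d)"
  using forms_mult[OF forms_var[of i n], of p d] by simp

lemma vector_space_mpoly_scale: "vector_space mpoly_scale"
  by unfold_locales (simp_all add: mpoly_scale_def algebra_simps const_add const_mult)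

interpretation mpoly: vector_space mpoly_scale
  by (rule vector_space_mpoly_scale)

lemma mpoly_subspace_iff:
  "mpoly.subspace W \<longleftrightarrow> 0 \<in> W \<and> (\<forall>x\<in>W. \<forall>y\<in>W. x + y \<in> W) \<and> (\<forall>c. \<forall>x\<in>W. const c * x \<in> W)"
  by (simp add: mpoly.subspace_def mpoly_scale_def)

lemma subspace_forms: "mpoly.subspace (forms n d)"
  by (auto simp: mpoly_subspace_iff)

lemma subspace_ideal: "ideal I (poly_ring n) \<Longrightarrow> mpoly.subspace I"
  by (auto simp: mpoly_subspace_iff intro: poly_idealD)

lemma subspace_ideal_forms: "ideal I (poly_ring n) \<Longrightarrow> mpoly.subspace (I \<inter> forms n d)"
  by (intro mpoly.subspace_inter subspace_ideal subspace_forms)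

lemma sum_monomials: "p = (\<Sum>m\<in>Poly_Mapping.keys p. Poly_Mapping.single m (Poly_Mapping.lookup p m))"
  by (rule poly_mapping_eqI) (auto simp: lookup_sum lookup_single when_def sum.delta in_keys_iff)

text \<open>The degree is a parameter of the predicate, because removing a variable from a form lowers it.\<close>

lemma forms_induct [consumes 1, case_names zero add const var]:
  fixes f :: "'a::field mpoly"
  assumes f: "f \<in> forms n d"
    and z: "\<And>d. P d 0"
    and a: "\<And>d f g. f \<in> forms n d \<Longrightarrow> g \<in> forms n d \<Longrightarrow> P d f \<Longrightarrow> P d g \<Longrightarrow> P d (f + g)"
    and c: "\<And>c. P 0 (const c)"
    and v: "\<And>i d f. i \<le> n \<Longrightarrow> f \<in> forms n d \<Longrightarrow> P d f \<Longrightarrow> P (Suc d) (var i * f)"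
  shows "P d f"
proof -
  have mono: "P d (Poly_Mapping.single m c)"
    if "Poly_Mapping.keys m \<subseteq> {..n}" "mon_degree m = d" for m d and c :: 'a
    using that
  proof (induction d arbitrary: m)
    case 0
    then have "m = 0"
      by (intro poly_mapping_eqI) (auto simp: mon_degree_def in_keys_iff)
    then show ?case using c[of c] by (simp add: const_def)
  next
    case (Suc d)
    then obtain i where i: "i \<in> Poly_Mapping.keys m"
      by (metis mon_degree_def sum.empty nat.distinct(1) ex_in_conv)
    let ?m = "m - Poly_Mapping.single i 1"
    have m: "m = Poly_Mapping.single i 1 + ?m"
      using i by (intro poly_mapping_eqI) (auto simp: lookup_add lookup_minus lookup_single when_def in_keys_iff)
    have d: "mon_degree ?m = d" using Suc.prems(2) mon_degree_add[of "Poly_Mapping.single i 1" ?m] m by simp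
    have k: "Poly_Mapping.keys ?m \<subseteq> {..n}" using Suc.prems(1) by (subst (asm) m) (auto simp: keys_nat_add)
    have "P (Suc d) (var i * Poly_Mapping.single ?m c)"
      using Suc.IH[OF k d] i Suc.prems(1) k d
      by (intro v) (auto simp: forms_iff split: if_splits)
    also have "var i * Poly_Mapping.single ?m c = Poly_Mapping.single m c"
      by (simp add: var_def mult_single m[symmetric] del: One_nat_def)
    finally show ?case .
  qed
  have form: "Poly_Mapping.single m (Poly_Mapping.lookup f m) \<in> forms n d"
    if "m \<in> Poly_Mapping.keys f" for m
    using f that by (auto simp: forms_iff)
  have "P d (\<Sum>m\<in>M. Poly_Mapping.single m (Poly_Mapping.lookup f m))" if "M \<subseteq> Poly_Mapping.keys f" for M
    using finite_subset[OF that finite_keys] that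
  proof (induction M rule: finite_induct)
    case (insert m M)
    then show ?case
      using f by (auto intro!: a z form forms_sum mono simp: forms_iff)
  qed (simp add: z)
  from this[of "Poly_Mapping.keys f"] show ?thesis using sum_monomials[of f] by simp
qed

lemma poly_ring_induct [consumes 1, case_names add const var]:
  fixes f :: "'a::field mpoly"
  assumes f: "f \<in> carrier (poly_ring n)"
    and a: "\<And>f g. f \<in> carrier (poly_ring n) \<Longrightarrow> g \<in> carrier (poly_ring n) \<Longrightarrow> P f \<Longrightarrow> P g \<Longrightarrow> P (f + g)"
    and c: "\<And>c. P (const c)"
    and v: "\<And>i f. i \<le> n \<Longrightarrow> f \<in> carrier (poly_ring n) \<Longrightarrow> P f \<Longrightarrow> P (var i * f)"
  shows "P f"
proof -
  have z: "P 0" using c[of 0] by simp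
  have form: "Poly_Mapping.single m (Poly_Mapping.lookup f m) \<in> forms n (mon_degree m)"
    if "m \<in> Poly_Mapping.keys f" for m
    using f that by (auto simp: forms_iff in_poly_ring)
  have P_form: "P g" if "g \<in> forms n d" for g d
    using that by (induction rule: forms_induct) (auto intro: z a c v forms_in_poly_ring)
  have "P (\<Sum>m\<in>M. Poly_Mapping.single m (Poly_Mapping.lookup f m)) \<and>
     (\<Sum>m\<in>M. Poly_Mapping.single m (Poly_Mapping.lookup f m)) \<in> carrier (poly_ring n)"
    if "M \<subseteq> Poly_Mapping.keys f" for M
    using finite_subset[OF that finite_keys] that
  proof (induction M rule: finite_induct)
    case (insert m M)
    then show ?case
      by (auto intro!: a P_form[OF form] forms_in_poly_ring[OF form])
  qed (simp add: z)
  from this[of "Poly_Mapping.keys f"] show ?thesis using sum_monomials[of f] by simp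
qed

text \<open>Substitution of polynomials for the variables, as an endomorphism of the polynomial ring. The ideals
of lines and points below are kernels of such endomorphisms; primality is then inherited from the
absence of zero divisors.\<close>

definition mon_subst :: "(nat \<Rightarrow> 'a::field mpoly) \<Rightarrow> (nat \<Rightarrow>\<^sub>0 nat) \<Rightarrow> 'a mpoly" where
  "mon_subst \<sigma> m = (\<Prod>i\<in>Poly_Mapping.keys m. \<sigma> i ^ Poly_Mapping.lookup m i)"

definition subst :: "(nat \<Rightarrow> 'a::field mpoly) \<Rightarrow> 'a mpoly \<Rightarrow> 'a mpoly" where
  "subst \<sigma> p = (\<Sum>m\<in>Poly_Mapping.keys p. const (Poly_Mapping.lookup p m) * mon_subst \<sigma> m)"

lemma mon_subst_superset:
  assumes "finite A" "Poly_Mapping.keys m \<subseteq> A"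
  shows "mon_subst \<sigma> m = (\<Prod>i\<in>A. \<sigma> i ^ Poly_Mapping.lookup m i)"
  unfolding mon_subst_def using assms by (intro prod.mono_neutral_left) (auto simp: in_keys_iff)

lemma mon_subst_add: "mon_subst \<sigma> (m + m') = mon_subst \<sigma> m * mon_subst \<sigma> m'"
  by (simp add: mon_subst_superset[of "Poly_Mapping.keys m \<union> Poly_Mapping.keys m'"]
      keys_nat_add lookup_add power_add prod.distrib)

lemma subst_superset:
  assumes "finite A" "Poly_Mapping.keys p \<subseteq> A"
  shows "subst \<sigma> p = (\<Sum>m\<in>A. const (Poly_Mapping.lookup p m) * mon_subst \<sigma> m)"
  unfolding subst_def using assms by (intro sum.mono_neutral_left) (auto simp: in_keys_iff)

lemma subst_add: "subst \<sigma> (p + q) = subst \<sigma> p + subst \<sigma> q"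
  using keys_add[of p q]
  by (simp add: subst_superset[of "Poly_Mapping.keys p \<union> Poly_Mapping.keys q"]
      lookup_add const_add algebra_simps sum.distrib)

lemma subst_single: "subst \<sigma> (Poly_Mapping.single m c) = const c * mon_subst \<sigma> m"
  by (simp add: subst_def)

lemma subst_zero [simp]: "subst \<sigma> 0 = 0"
  by (simp add: subst_def)

lemma subst_const [simp]: "subst \<sigma> (const c) = const c"
  by (subst (1) const_def) (simp add: subst_single mon_subst_def)

lemma subst_one [simp]: "subst \<sigma> 1 = 1"
  using subst_const[of \<sigma> 1] by simp

lemma subst_var [simp]: "subst \<sigma> (var i) = \<sigma> i"
  by (simp add: var_def subst_single mon_subst_def)

lemma subst_sum: "subst \<sigma> (sum f A) = (\<Sum>x\<in>A. subst \<sigma> (f x))"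
  by (induction A rule: infinite_finite_induct) (auto simp: subst_add)

lemma subst_mult: "subst \<sigma> (p * q) = subst \<sigma> p * subst \<sigma> q"
proof -
  let ?s = "\<lambda>p m. Poly_Mapping.single m (Poly_Mapping.lookup p m)"
  have "p * q = (\<Sum>m\<in>Poly_Mapping.keys p. ?s p m) * (\<Sum>m\<in>Poly_Mapping.keys q. ?s q m)"
    using sum_monomials[of p] sum_monomials[of q] by simp
  also have "subst \<sigma> \<dots> = (\<Sum>m\<in>Poly_Mapping.keys p. \<Sum>m'\<in>Poly_Mapping.keys q. subst \<sigma> (?s p m * ?s q m'))"
    by (simp add: sum_product subst_sum)
  also have "\<dots> = (\<Sum>m\<in>Poly_Mapping.keys p. \<Sum>m'\<in>Poly_Mapping.keys q. subst \<sigma> (?s p m) * subst \<sigma> (?s q m'))"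
    by (intro sum.cong refl) (simp add: mult_single subst_single mon_subst_add const_mult)
  also have "\<dots> = subst \<sigma> (\<Sum>m\<in>Poly_Mapping.keys p. ?s p m) * subst \<sigma> (\<Sum>m\<in>Poly_Mapping.keys q. ?s q m)"
    by (simp add: sum_product subst_sum)
  finally show ?thesis using sum_monomials[of p] sum_monomials[of q] by simp
qed

lemma subst_uminus: "subst \<sigma> (- p) = - subst \<sigma> p"
  using subst_add[of \<sigma> p "- p"] by (simp add: add_eq_0_iff)

lemma subst_diff: "subst \<sigma> (p - q) = subst \<sigma> p - subst \<sigma> q"
  using subst_add[of \<sigma> p "- q"] by (simp add: subst_uminus)

lemma subst_power: "subst \<sigma> (p ^ k) = subst \<sigma> p ^ k"
  by (induction k) (auto simp: subst_mult)

lemma subst_forms: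
  assumes "f \<in> forms n d" "\<And>i. i \<le> n \<Longrightarrow> \<sigma> i \<in> forms n 1"
  shows "subst \<sigma> f \<in> forms n d"
  using assms(1)
proof (induction rule: forms_induct)
  case (var i d f)
  then show ?case using forms_mult[OF assms(2)[OF var(1)] var(3)] by (simp add: subst_mult)
qed (auto simp: subst_add)

lemma subst_in_poly_ring:
  assumes "f \<in> carrier (poly_ring n)" "\<And>i. i \<le> n \<Longrightarrow> \<sigma> i \<in> carrier (poly_ring n)"
  shows "subst \<sigma> f \<in> carrier (poly_ring n)"
  using assms(1) by (induction rule: poly_ring_induct) (auto simp: subst_add subst_mult assms(2))

lemma subst_idem:
  assumes "f \<in> carrier (poly_ring n)" "\<And>i. i \<le> n \<Longrightarrow> subst \<sigma> (\<tau> i) = \<rho> i"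
  shows "subst \<sigma> (subst \<tau> f) = subst \<rho> f"
  using assms(1) by (induction rule: poly_ring_induct) (auto simp: subst_add subst_mult assms(2))

text \<open>Modulo an ideal containing all \<open>var i - \<sigma> i\<close>, substitution is the identity. This is how kernels of
substitutions are recognized as the ideals generated by linear forms.\<close>

lemma diff_subst_in_ideal:
  assumes "ideal I (poly_ring n)" "\<And>i. i \<le> n \<Longrightarrow> \<sigma> i \<in> carrier (poly_ring n)"
    "\<And>i. i \<le> n \<Longrightarrow> var i - \<sigma> i \<in> I" and f: "f \<in> carrier (poly_ring n)"
  shows "f - subst \<sigma> f \<in> I"
  using f
proof (induction rule: poly_ring_induct)
  case (add f g)
  then show ?case using poly_idealD(3)[OF assms(1) add(3,4)] by (simp add: subst_add algebra_simps)
next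
  case (const c)
  then show ?case by (simp add: poly_idealD[OF assms(1)])
next
  case (var i f)
  have "var i * f - subst \<sigma> (var i * f) = var i * (f - subst \<sigma> f) + subst \<sigma> f * (var i - \<sigma> i)"
    by (simp add: subst_mult algebra_simps)
  also have "\<dots> \<in> I"
    by (intro poly_idealD(3,6)[OF assms(1)] var assms poly_ring_closed(7) subst_in_poly_ring)
  finally show ?case .
qed

lemma ideal_kernel_subst:
  "primeideal {f \<in> carrier (poly_ring n :: 'a::field mpoly ring). subst \<sigma> f = 0} (poly_ring n)"
proof -
  interpret cring "poly_ring n :: 'a mpoly ring" by (rule cring_poly_ring)
  let ?I = "{f \<in> carrier (poly_ring n :: 'a mpoly ring). subst \<sigma> f = 0}"
  have "ideal ?I (poly_ring n)"
  proof (rule idealI)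
    show "subgroup ?I (add_monoid (poly_ring n))"
      by (rule group.subgroupI[OF a_group], unfold a_inv_def[symmetric])
        (auto simp: subst_add subst_uminus a_inv_poly_ring intro: exI[of _ 0])
  qed (auto simp: subst_mult ring_axioms)
  then show ?thesis
  proof (rule primeidealI)
    have "1 \<notin> ?I" by simp
    then show "carrier (poly_ring n) \<noteq> ?I" by blast
  qed (auto simp: subst_mult cring_poly_ring)
qed

lemma var_neq_zero [simp]: "var i \<noteq> 0"
  by (metis var_def lookup_single_eq lookup_zero zero_neq_one)

text \<open>Divisibility of forms by a variable, tested by setting this variable to zero.\<close>

lemma form_divisible_by_var:
  fixes f :: "'a::field mpoly"
  assumes a: "a \<le> n" and f: "f \<in> forms n d"
  shows "\<exists>g. f - subst (\<lambda>i. if i = a then 0 else var i) f = var a * g \<and> (d = 0 \<longrightarrow> g = 0) \<and> g \<in> forms n (d - 1)"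
  using f
proof (induction rule: forms_induct)
  case (add d f g)
  then obtain f' g' where "f - subst (\<lambda>i. if i = a then 0 else var i) f = var a * f'" "g - subst (\<lambda>i. if i = a then 0 else var i) g = var a * g'"
     "d = 0 \<longrightarrow> f' = 0" "d = 0 \<longrightarrow> g' = 0" "f' \<in> forms n (d - 1)" "g' \<in> forms n (d - 1)" by blast
  note h = this
  have "f + g - subst (\<lambda>i. if i = a then 0 else var i) (f + g) = (f - subst (\<lambda>i. if i = a then 0 else var i) f) + (g - subst (\<lambda>i. if i = a then 0 else var i) g)"
    by (simp add: subst_add)
  also have "\<dots> = var a * (f' + g')" by (simp only: h ring_distribs)
  finally show ?case using h by (intro exI[of _ "f' + g'"]) auto
next
  case (var i d f)
  then obtain g where g: "f - subst (\<lambda>i. if i = a then 0 else var i) f = var a * g" "d = 0 \<longrightarrow> g = 0" "g \<in> forms n (d - 1)"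
    by blast
  show ?case
  proof (cases "i = a")
    case True
    then show ?thesis using var by (intro exI[of _ f]) (auto simp: subst_mult)
  next
    case False
    have "var i * g \<in> forms n d"
      using forms_mult_var[OF var(1) g(3)] g(2) by (cases d) auto
    moreover have "var i * f - subst (\<lambda>i. if i = a then 0 else var i) (var i * f)
        = var i * (f - subst (\<lambda>i. if i = a then 0 else var i) f)"
      using False by (simp add: subst_mult right_diff_distrib)
    ultimately show ?thesis
      using g by (intro exI[of _ "var i * g"]) (auto simp: mult.left_commute)
  qed
qed (auto intro!: exI[of _ 0])

text \<open>The variables \<open>a\<close> and \<open>b\<close> are coprime: a fraction whose denominator may be chosen as a power of either
variable is a polynomial, and it vanishes if its degree is negative.\<close>

lemma form_power_dvd_form:
  fixes f :: "'a::field mpoly"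
  assumes "a \<le> n" "a \<noteq> b" "f \<in> forms n d" "var b ^ q * f = var a ^ p * h" "f \<noteq> 0"
  shows "p \<le> d \<and> (\<exists>w\<in>forms n (d - p). f = var a ^ p * w)"
  using assms(3-)
proof (induction p arbitrary: f d h)
  case (Suc p)
  let ?s = "subst (\<lambda>i. if i = a then 0 else var i)"
  obtain g where g: "f - ?s f = var a * g" "d = 0 \<longrightarrow> g = 0" "g \<in> forms n (d - 1)"
    using form_divisible_by_var[OF assms(1) Suc.prems(1)] by blast
  have "var b ^ q * ?s f = ?s (var b ^ q * f)" using assms(2) by (simp add: subst_mult subst_power)
  also have "\<dots> = 0" by (simp add: Suc.prems(2) subst_mult)
  finally have "?s f = 0" by simp
  with g have f: "f = var a * g" by simp
  with Suc.prems(3) g(2) have nz: "g \<noteq> 0" "d \<noteq> 0" by auto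
  have "var a * (var b ^ q * g) = var a * (var a ^ p * h)"
    using Suc.prems(2) f by (simp add: algebra_simps)
  then have "var b ^ q * g = var a ^ p * h" by simp
  from Suc.IH[OF g(3) this nz(1)] show ?case
    using f nz(2) by (auto simp: algebra_simps)
qed auto

section \<open>Coordinates adapted to a line\<close>

lemmas forms_var_Suc_0 [intro] = forms_var[unfolded One_nat_def]

lemma inj_var: "inj (var :: nat \<Rightarrow> 'a::field mpoly)"
proof (rule injI)
  fix i j assume "var i = (var j :: 'a mpoly)"
  then have "Poly_Mapping.keys (var i :: 'a mpoly) = Poly_Mapping.keys (var j :: 'a mpoly)" by simp
  then have "Poly_Mapping.single i (1::nat) = Poly_Mapping.single j 1" by (simp add: var_def)
  then have "Poly_Mapping.keys (Poly_Mapping.single i (1::nat)) = Poly_Mapping.keys (Poly_Mapping.single j (1::nat))"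
    by simp
  then show "i = j" by simp
qed

lemma linear_forms_span: "forms n 1 \<subseteq> mpoly.span (var ` {..n} :: 'a::field mpoly set)"
proof
  have *: "(d = 1 \<longrightarrow> f \<in> mpoly.span (var ` {..n})) \<and> (d = 0 \<longrightarrow> (\<exists>c. f = const c))"
    if "f \<in> forms n d" for d and f :: "'a mpoly"
    using that
  proof (induction rule: forms_induct)
    case (add d f g)
    then show ?case by (auto intro: mpoly.span_add simp flip: const_add)
  next
    case (var i d f)
    show ?case
    proof (cases "d = 0")
      case True
      then obtain c where "f = const c" using var(3) by auto
      then have "var i * f = mpoly_scale c (var i)" by (simp add: mpoly_scale_def mult.commute)
      moreover have "mpoly_scale c (var i) \<in> mpoly.span (var ` {..n})"
        using var(1) by (intro mpoly.span_scale mpoly.span_base) auto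
      ultimately show ?thesis using True by simp
    qed auto
  qed (auto intro: mpoly.span_zero exI[of _ 0])
  fix f :: "'a mpoly" assume "f \<in> forms n 1"
  from *[OF this] show "f \<in> mpoly.span (var ` {..n})" by blast
qed

lemma independent_vars:
  assumes "finite A"
  shows "mpoly.independent (var ` A :: 'a::field mpoly set)"
proof (rule mpoly.independent_if_scalars_zero)
  fix c :: "'a mpoly \<Rightarrow> 'a" and x :: "'a mpoly"
  assume s: "(\<Sum>x\<in>var ` A. mpoly_scale (c x) x) = 0" and "x \<in> var ` A"
  then obtain i where i: "i \<in> A" "x = var i" by blast
  let ?\<sigma> = "\<lambda>j. if j = i then var i else 0 :: 'a mpoly"
  have "0 = subst ?\<sigma> (\<Sum>j\<in>A. mpoly_scale (c (var j)) (var j))"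
    using s by (simp add: sum.reindex[OF inj_on_subset[OF inj_var]])
  also have "\<dots> = (\<Sum>j\<in>A. if j = i then const (c (var i)) * var i else 0)"
    by (auto simp: subst_sum mpoly_scale_def subst_mult intro!: sum.cong)
  also have "\<dots> = const (c (var i)) * var i"
    using assms i by (simp add: sum.delta)
  finally show "c x = 0" using i by simp
qed (use assms in auto)

lemma independent_mod_zero_imp_independent:
  assumes "independent_mod mpoly_scale {0} B"
  shows "mpoly.independent B" "finite B"
proof -
  show fin: "finite B" using assms by (simp add: independent_mod_def)
  show "mpoly.independent B"
    using assms fin unfolding independent_mod_def
    by (intro mpoly.independent_if_scalars_zero) auto
qed

text \<open>Two of the variables, \<open>s = var a\<close> and \<open>t = var b\<close>, serve as homogeneous coordinates on the line, and the
restriction of \<open>var i\<close> to the line is \<open>lam i s + mu i t\<close>. The coordinates of the ambient space are left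
as they are, since the Cech complex refers to them.\<close>

locale line_coordinates =
  fixes n a b :: nat and lam mu :: "nat \<Rightarrow> 'a::field" and L :: "'a mpoly set"
  assumes ab: "a \<le> n" "b \<le> n" "a \<noteq> b"
    and lam_mu: "lam a = 1" "mu a = 0" "lam b = 0" "mu b = 1"
    and L_kernel: "L = {f \<in> carrier (poly_ring n). subst (\<lambda>i. const (lam i) * var a + const (mu i) * var b) f = 0}"

text \<open>The linear forms vanishing on the line are completed to a basis of all linear forms by variables; a
dimension count leaves room for exactly two of them.\<close>

lemma line_coordinates_exist:
  assumes "line n L"
  shows "\<exists>a b lam mu. line_coordinates n a b lam mu L"
proof -
  interpret S: cring "poly_ring n :: 'a mpoly ring" by (rule cring_poly_ring)
  obtain B where B: "B \<subseteq> forms n 1" "independent_mod mpoly_scale {0} B" "card B + 1 = n"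
    and L: "L = Idl\<^bsub>poly_ring n\<^esub> B"
    using assms unfolding line_def by blast
  note ind = independent_mod_zero_imp_independent[OF B(2)]
  define X :: "'a mpoly set" where "X = var ` {..n}"
  have X: "finite X" "card X = n + 1" "mpoly.independent X"
    using card_image[OF inj_on_subset[OF inj_var], of "{..n}"] independent_vars[of "{..n}"]
    by (auto simp: X_def)
  obtain B' where B': "B \<subseteq> B'" "B' \<subseteq> B \<union> X" "mpoly.independent B'" "B \<union> X \<subseteq> mpoly.span B'"
    using mpoly.maximal_independent_subset_extend[OF _ ind(1), of "B \<union> X"] by blast
  have finB': "finite B'" using B'(2) X(1) ind(2) finite_subset by blast
  have "B' \<subseteq> mpoly.span X" 
    using B'(2) subset_trans[OF B(1) linear_forms_span] mpoly.span_superset[of X] by (fastforce simp: X_def)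
  then have "card B' \<le> n + 1" using mpoly.independent_span_bound[OF X(1) B'(3)] X(2) by simp
  moreover have "n + 1 \<le> card B'" using mpoly.independent_span_bound[OF finB' X(3)] X(2) B'(4) by simp
  ultimately have "card (B' - B) = 2"
    using B(3) card_Diff_subset[OF ind(2) B'(1)] by simp
  then obtain p q where pq: "B' - B = {p, q}" "p \<noteq> q" by (auto simp: card_2_iff)
  then have "p \<in> X" "q \<in> X" using B'(2) by auto
  then obtain a b where ab: "a \<le> n" "b \<le> n" "p = var a" "q = var b" by (auto simp: X_def)
  have neq: "a \<noteq> b" using pq ab by auto
  have B'eq: "B' = insert (var a) (insert (var b) B)" using pq(1) ab B'(1) by auto
  have var_neq: "var a \<noteq> (var b :: 'a mpoly)" using neq injD[OF inj_var] by blast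
  have notB: "var a \<notin> B" "var b \<notin> B" using pq ab by auto
  have "\<exists>l m. var i - const l * var a - const m * var b \<in> mpoly.span B" if "i \<le> n" for i
  proof -
    have "var i \<in> mpoly.span B'" using B'(4) that by (auto simp: X_def)
    then obtain l where "var i - mpoly_scale l (var a) \<in> mpoly.span (insert (var b) B)"
      unfolding B'eq mpoly.span_breakdown_eq by blast
    then obtain m where "var i - mpoly_scale l (var a) - mpoly_scale m (var b) \<in> mpoly.span B"
      unfolding mpoly.span_breakdown_eq by blast
    then show ?thesis by (auto simp: mpoly_scale_def)
  qed
  then obtain l0 m0 where lm0: "\<And>i. i \<le> n \<Longrightarrow> var i - const (l0 i) * var a - const (m0 i) * var b \<in> mpoly.span B"
    by metis
  \<comment> \<open>The two coordinates themselves get the obvious representation.\<close>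
  define lam where "lam i = (if i = a then 1 else if i = b then 0 else l0 i)" for i
  define mu where "mu i = (if i = a then 0 else if i = b then 1 else m0 i)" for i
  define \<sigma> where "\<sigma> i = const (lam i) * var a + const (mu i) * var b" for i
  have lm: "var i - \<sigma> i \<in> mpoly.span B" if "i \<le> n" for i
    using lm0[OF that] by (auto simp: \<sigma>_def lam_def mu_def mpoly.span_zero diff_diff_eq)
  have L_ideal: "ideal L (poly_ring n)"
    unfolding L using B(1) forms_in_poly_ring by (intro S.genideal_ideal) blast
  have BL: "B \<subseteq> L" unfolding L using B(1) forms_in_poly_ring by (intro S.genideal_self) blast
  have spanL: "mpoly.span B \<subseteq> L" by (rule mpoly.span_minimal[OF BL subspace_ideal[OF L_ideal]])
  have \<sigma>_in: "\<sigma> i \<in> carrier (poly_ring n)" for i using ab by (auto simp: \<sigma>_def)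
  have \<sigma>_forms: "\<sigma> i \<in> forms n 1" for i
    using ab by (auto simp: \<sigma>_def intro: forms_const_mult forms_var)
  let ?K = "{f \<in> carrier (poly_ring n). subst \<sigma> f = 0}"
  have "?K \<subseteq> L"
  proof
    fix f assume f: "f \<in> ?K"
    have "f - subst \<sigma> f \<in> L"
      by (rule diff_subst_in_ideal[OF L_ideal]) (use \<sigma>_in lm spanL f in auto)
    then show "f \<in> L" using f by simp
  qed
  moreover have "L \<subseteq> ?K"
  proof -
    have diff: "f - subst \<sigma> f \<in> mpoly.span B \<and> (\<exists>x y. subst \<sigma> f = const x * var a + const y * var b)"
      if "f \<in> mpoly.span X" for f
      using that
    proof (induction rule: mpoly.span_induct_alt)
      case base
      then show ?case by (auto simp: mpoly.span_zero intro: exI[of _ 0])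
    next
      case (step c x y)
      then obtain i where i: "x = var i" "i \<le> n" by (auto simp: X_def)
      have eq: "mpoly_scale c x + y - subst \<sigma> (mpoly_scale c x + y)
          = mpoly_scale c (var i - \<sigma> i) + (y - subst \<sigma> y)"
        by (simp add: mpoly_scale_def subst_add subst_mult i algebra_simps)
      obtain u v where uv: "subst \<sigma> y = const u * var a + const v * var b" using step by blast
      have "subst \<sigma> (mpoly_scale c x + y) = const (c * lam i + u) * var a + const (c * mu i + v) * var b"
        by (simp add: mpoly_scale_def subst_add subst_mult i uv \<sigma>_def const_add const_mult algebra_simps)
      moreover have "mpoly_scale c (var i - \<sigma> i) + (y - subst \<sigma> y) \<in> mpoly.span B"
        using step lm[OF i(2)] by (intro mpoly.span_add mpoly.span_scale) auto
      ultimately show ?case using eq by metis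
    qed
    have "B \<subseteq> ?K"
    proof
      fix f assume f: "f \<in> B"
      then have fX: "f \<in> mpoly.span X" using B(1) linear_forms_span[of n] by (auto simp: X_def)
      obtain x y where xy: "subst \<sigma> f = const x * var a + const y * var b" using diff[OF fX] by blast
      have "f - (f - subst \<sigma> f) \<in> mpoly.span B"
        by (rule mpoly.span_diff[OF mpoly.span_base[OF f] conjunct1[OF diff[OF fX]]])
      then have xyB: "const x * var a + const y * var b \<in> mpoly.span B" using xy by simp
      have x0: "x = 0"
      proof (rule ccontr)
        assume "x \<noteq> 0"
        have "const x * var a - const (- y) * var b \<in> mpoly.span B" using xyB by (simp add: const_uminus)
        then have "mpoly_scale x (var a) \<in> mpoly.span (insert (var b) B)"
          unfolding mpoly.span_breakdown_eq by (auto simp: mpoly_scale_def)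
        then have "mpoly_scale (1 / x) (mpoly_scale x (var a)) \<in> mpoly.span (insert (var b) B)"
          by (rule mpoly.span_scale)
        then have "var a \<in> mpoly.span (B' - {var a})"
          using \<open>x \<noteq> 0\<close> notB var_neq var_neq[symmetric] by (simp add: B'eq insert_Diff_if)
        then show False using B'(3) unfolding mpoly.dependent_def B'eq by blast
      qed
      have y0: "y = 0"
      proof (rule ccontr)
        assume "y \<noteq> 0"
        have "mpoly_scale y (var b) \<in> mpoly.span (insert (var a) B)"
          using xyB x0 mpoly.span_mono[of B "insert (var a) B"] by (auto simp: mpoly_scale_def)
        then have "mpoly_scale (1 / y) (mpoly_scale y (var b)) \<in> mpoly.span (insert (var a) B)"
          by (rule mpoly.span_scale)
        then have "var b \<in> mpoly.span (B' - {var b})"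
          using \<open>y \<noteq> 0\<close> notB var_neq var_neq[symmetric] by (simp add: B'eq insert_Diff_if)
        then show False using B'(3) unfolding mpoly.dependent_def B'eq by blast
      qed
      show "f \<in> ?K" using xy x0 y0 f B(1) forms_in_poly_ring by auto
    qed
    moreover have "ideal ?K (poly_ring n)" using ideal_kernel_subst primeideal.axioms(1) by blast
    ultimately show ?thesis unfolding L by (intro S.genideal_minimal)
  qed
  ultimately have "L = ?K" by blast
  then have "line_coordinates n a b lam mu L"
    using ab neq by unfold_locales (auto simp: lam_def mu_def \<sigma>_def[abs_def])
  then show ?thesis by blast
qed

context line_coordinates
begin

text \<open>Restriction to the line, with the line's coordinate ring realized as the polynomials in \<open>s\<close> and \<open>t\<close>.\<close>

definition restr :: "'a mpoly \<Rightarrow> 'a mpoly" where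
  "restr = subst (\<lambda>i. const (lam i) * var a + const (mu i) * var b)"

text \<open>The ideal of the point of the line at which \<open>s\<close> vanishes.\<close>

definition P :: "'a mpoly set" where
  "P = {f \<in> carrier (poly_ring n). subst (\<lambda>i. const (mu i) * var b) f = 0}"

abbreviation s where "s \<equiv> var a :: 'a mpoly"
abbreviation t where "t \<equiv> var b :: 'a mpoly"

text \<open>The linear forms \<open>ell i\<close> generate the ideal of the line.\<close>

definition ell :: "nat \<Rightarrow> 'a mpoly" where
  "ell i = var i - (const (lam i) * s + const (mu i) * t)"

lemma var_eq: "var i = ell i + const (lam i) * s + const (mu i) * t"
  by (simp add: ell_def)

lemma mem_L_iff: "f \<in> L \<longleftrightarrow> f \<in> carrier (poly_ring n) \<and> restr f = 0"
  by (auto simp: L_kernel restr_def)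

lemma L_prime: "primeideal L (poly_ring n)"
  unfolding L_kernel by (rule ideal_kernel_subst)

lemma P_prime: "primeideal P (poly_ring n)"
  unfolding P_def by (rule ideal_kernel_subst)

lemma L_ideal: "ideal L (poly_ring n)" and P_ideal: "ideal P (poly_ring n)"
  using L_prime P_prime primeideal.axioms(1) by blast+

lemma st_forms [simp, intro]: "s \<in> forms n (Suc 0)" "t \<in> forms n (Suc 0)"
  using ab by (auto intro: forms_var)

lemma st_power_forms [simp, intro]: "s ^ k \<in> forms n k" "t ^ k \<in> forms n k"
  using ab by (auto intro: forms_var_power)

lemma st_carrier [simp, intro]: "s \<in> carrier (poly_ring n)" "t \<in> carrier (poly_ring n)"
  using ab by auto

lemma forms_mult_st: "f \<in> forms n d \<Longrightarrow> s * f \<in> forms n (Suc d)" "f \<in> forms n d \<Longrightarrow> t * f \<in> forms n (Suc d)"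
  using ab by (auto intro: forms_mult_var)

lemma restr_rules:
  "restr (f + g) = restr f + restr g" "restr (f - g) = restr f - restr g"
  "restr (f * g) = restr f * restr g" "restr (f ^ k) = restr f ^ k" "restr (const c) = const c"
  "restr 0 = 0" "restr s = s" "restr t = t" "restr (var i) = const (lam i) * s + const (mu i) * t"
  by (simp_all add: restr_def subst_add subst_diff subst_mult subst_power lam_mu)

lemmas restr_simps = restr_rules lam_mu

lemma restr_forms: "f \<in> forms n d \<Longrightarrow> restr f \<in> forms n d"
  unfolding restr_def by (erule subst_forms) (auto intro: forms_const_mult)

lemma restr_idem: "f \<in> carrier (poly_ring n) \<Longrightarrow> restr (restr f) = restr f"
  unfolding restr_def by (rule subst_idem) (auto simp: subst_add subst_mult lam_mu)

lemma diff_restr_in_L: "f \<in> carrier (poly_ring n) \<Longrightarrow> restr f \<in> carrier (poly_ring n) \<Longrightarrow> f - restr f \<in> L"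
  by (auto simp: mem_L_iff restr_simps restr_idem)

lemma ell_forms: "i \<le> n \<Longrightarrow> ell i \<in> forms n 1"
  unfolding ell_def by (auto intro: forms_const_mult forms_var)

lemma ell_in_L: "i \<le> n \<Longrightarrow> ell i \<in> L"
  by (simp add: mem_L_iff forms_in_poly_ring[OF ell_forms]) (simp add: ell_def restr_simps)

lemma L_subset_P: "L \<subseteq> P"
proof
  fix f assume f: "f \<in> L"
  have "subst (\<lambda>i. const (mu i) * t) (restr f) = subst (\<lambda>i. const (mu i) * t) f"
    unfolding restr_def using f
    by (intro subst_idem[of _ n]) (auto simp: L_kernel subst_add subst_mult lam_mu)
  then show "f \<in> P" using f by (auto simp: mem_L_iff P_def)
qed

lemma s_in_P: "s \<in> P" and s_notin_L: "s \<notin> L" and t_notin_P: "t ^ k \<notin> P"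
  by (auto simp: P_def mem_L_iff restr_simps lam_mu subst_power)

lemma L_cancel: "s ^ k * f \<in> L \<Longrightarrow> f \<in> carrier (poly_ring n) \<Longrightarrow> f \<in> L"
  by (auto simp: mem_L_iff restr_simps)

text \<open>Since \<open>S/P = K[t]\<close>, a form is determined by one scalar modulo \<open>P = L + (s)\<close>. The last conjunct says
that the coefficient of \<open>s\<close> vanishes in degree 0, where the truncated degree \<open>d - 1\<close> is meaningless.\<close>

lemma form_mod_L:
  assumes "f \<in> forms n d"
  shows "\<exists>c l w. f = const c * t ^ d + l + s * w \<and> l \<in> L \<and> l \<in> forms n d \<and>
     w \<in> forms n (d - 1) \<and> (d = 0 \<longrightarrow> w = 0)"
  using assms
proof (induction rule: forms_induct)
  case (zero d)
  then show ?case using poly_idealD(2)[OF L_ideal]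
    by (intro exI[of _ 0]) auto
next
  case (add d f g)
  then obtain c l w c' l' w' where
    "f = const c * t ^ d + l + s * w" "l \<in> L" "l \<in> forms n d" "w \<in> forms n (d - 1)" "d = 0 \<longrightarrow> w = 0"
    "g = const c' * t ^ d + l' + s * w'" "l' \<in> L" "l' \<in> forms n d" "w' \<in> forms n (d - 1)" "d = 0 \<longrightarrow> w' = 0"
    by blast
  then show ?case
    by (intro exI[of _ "c + c'"] exI[of _ "l + l'"] exI[of _ "w + w'"])
      (auto simp: const_add algebra_simps intro: poly_idealD[OF L_ideal])
next
  case (const c)
  then show ?case using poly_idealD(2)[OF L_ideal]
    by (intro exI[of _ c] exI[of _ 0]) auto
next
  case (var i d f)
  then obtain c l w where f: "f = const c * t ^ d + l + s * w" and l: "l \<in> L" "l \<in> forms n d"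
    and w: "w \<in> forms n (d - 1)" "d = 0 \<longrightarrow> w = 0" by auto
  let ?x = "const (lam i) * s + const (mu i) * t"
  have x: "?x \<in> forms n 1" by (auto intro: forms_const_mult)
  have "var i * f = ell i * f + ?x * f" by (simp add: var_eq[of i] algebra_simps)
  also have "?x * f = ?x * (const c * t ^ d + l + s * w)" by (simp only: f)
  also have "ell i * f + \<dots> = const (mu i * c) * t ^ Suc d + (ell i * f + ?x * l) + s * (const (lam i * c) * t ^ d + ?x * w)"
    by (simp add: const_mult algebra_simps)
  finally have eq: "var i * f = \<dots>" .
  have "ell i * f + ?x * l \<in> L"
    using forms_in_poly_ring[OF var(2)] forms_in_poly_ring[OF x] l(1) ell_in_L[OF var(1)]
    by (intro poly_idealD(3)[OF L_ideal] poly_idealD(7)[OF L_ideal, of f] poly_idealD(6)[OF L_ideal, of ?x])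
  moreover have "ell i * f + ?x * l \<in> forms n (Suc d)"
    using forms_mult[OF ell_forms[OF var(1)] var(2)] forms_mult[OF x l(2)] by auto
  moreover have "const (lam i * c) * t ^ d + ?x * w \<in> forms n d"
    using forms_mult[OF x w(1)] w(2) forms_const_mult[OF st_power_forms(2)[of d], of "lam i * c"]
    by (cases d) (auto intro!: forms_add)
  ultimately show ?case using eq by (intro exI) auto
qed

lemma form_mod_L_linear:
  assumes "f \<in> forms n (Suc d)"
  shows "\<exists>p q l. f = s * p + t * q + l \<and> p \<in> forms n d \<and> q \<in> forms n d \<and> l \<in> L"
proof -
  obtain c l w where "f = const c * t ^ Suc d + l + s * w" "l \<in> L" "w \<in> forms n d"
    using form_mod_L[OF assms] by auto
  then show ?thesis
    by (intro exI[of _ w] exI[of _ "const c * t ^ d"] exI[of _ l]) (auto simp: algebra_simps)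
qed

text \<open>In \<open>K[s,t]\<close> the ideal \<open>(s\<^sup>j, t\<^sup>k)\<close> contains every form of degree \<open>j + k\<close>. It follows that an element
which becomes divisible by \<open>s\<^sup>m\<close> after multiplication by \<open>t\<^sup>m\<close> also does so after multiplication by the
power \<open>2m\<close> of any linear form on the line.\<close>

lemma form_mod_L_powers:
  assumes "f \<in> forms n d" "d = j + k"
  shows "\<exists>p q l. f = s ^ j * p + t ^ k * q + l \<and> p \<in> forms n k \<and> q \<in> forms n j \<and> l \<in> L"
  using assms
proof (induction arbitrary: j k rule: forms_induct)
  case (zero d)
  then show ?case using poly_idealD(2)[OF L_ideal] by (intro exI[of _ 0]) auto
next
  case (add d f g)
  from add.IH(1)[OF add.prems] add.IH(2)[OF add.prems] obtain p q l p' q' l' where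
    "f = s ^ j * p + t ^ k * q + l" "p \<in> forms n k" "q \<in> forms n j" "l \<in> L"
    "g = s ^ j * p' + t ^ k * q' + l'" "p' \<in> forms n k" "q' \<in> forms n j" "l' \<in> L" by blast
  then show ?case
    by (intro exI[of _ "p + p'"] exI[of _ "q + q'"] exI[of _ "l + l'"])
      (auto simp: algebra_simps intro: poly_idealD[OF L_ideal])
next
  case (const c)
  then show ?case using poly_idealD(2)[OF L_ideal]
    by (intro exI[of _ "const c"] exI[of _ 0]) auto
next
  case (var i d f)
  have vf: "var i * f \<in> forms n (Suc d)" using var by (intro forms_mult_var)
  show ?case
  proof (cases "j = 0 \<or> k = 0")
    case True
    then show ?thesis
    proof
      assume "j = 0"
      then show ?thesis using vf var.prems poly_idealD(2)[OF L_ideal]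
        by (intro exI[of _ "var i * f"] exI[of _ 0]) auto
    next
      assume "k = 0"
      then show ?thesis using vf var.prems poly_idealD(2)[OF L_ideal]
        by (intro exI[of _ 0] exI[of _ "var i * f"]) auto
    qed
  next
    case False
    then obtain j' k' where jk: "j = Suc j'" "k = Suc k'" by (meson not0_implies_Suc)
    obtain p q l where 1: "f = s ^ j' * p + t ^ k * q + l" "p \<in> forms n k" "q \<in> forms n j'" "l \<in> L"
      using var.IH[of j' k] var.prems jk by auto
    obtain p' q' l' where 2: "f = s ^ j * p' + t ^ k' * q' + l'" "p' \<in> forms n k'" "q' \<in> forms n j" "l' \<in> L"
      using var.IH[of j k'] var.prems jk by auto
    have "var i * f = ell i * f + const (lam i) * (s * f) + const (mu i) * (t * f)"
      by (simp add: var_eq[of i] algebra_simps)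
    also have "s * f = s ^ j * p + t ^ k * (s * q) + s * l" by (simp add: 1(1) jk algebra_simps)
    also have "t * f = s ^ j * (t * p') + t ^ k * q' + t * l'" by (simp add: 2(1) jk algebra_simps)
    finally have "var i * f = s ^ j * (const (lam i) * p + const (mu i) * (t * p'))
        + t ^ k * (const (lam i) * (s * q) + const (mu i) * q')
        + (ell i * f + const (lam i) * (s * l) + const (mu i) * (t * l'))"
      by (simp add: algebra_simps)
    moreover have "ell i * f + const (lam i) * (s * l) + const (mu i) * (t * l') \<in> L"
      using ell_in_L[OF var(1)] 1(4) 2(4) forms_in_poly_ring[OF var(2)]
      by (auto intro!: poly_idealD(3,6)[OF L_ideal] poly_idealD(7)[OF L_ideal, of f])
    ultimately show ?thesis
      using 1 2 jk forms_mult_st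
      by (intro exI conjI) (assumption | auto intro!: forms_add forms_const_mult)+
  qed
qed

lemma L_linear_span: "L \<inter> forms n 1 \<subseteq> mpoly.span (ell ` ({..n} - {a, b}))"
proof
  fix f assume f: "f \<in> L \<inter> forms n 1"
  have "f - restr f \<in> mpoly.span (ell ` {..n})" if "f \<in> mpoly.span (var ` {..n})" for f
    using that
  proof (induction rule: mpoly.span_induct_alt)
    case base
    then show ?case by (simp add: restr_simps mpoly.span_zero)
  next
    case (step c x y)
    then obtain i where i: "x = var i" "i \<le> n" by auto
    have "mpoly_scale c x + y - restr (mpoly_scale c x + y) = mpoly_scale c (ell i) + (y - restr y)"
      by (simp add: mpoly_scale_def i restr_simps ell_def algebra_simps)
    have "mpoly_scale c (ell i) + (y - restr y) \<in> mpoly.span (ell ` {..n})"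
      using i by (intro mpoly.span_add mpoly.span_scale step) (auto intro: mpoly.span_base)
    with \<open>mpoly_scale c x + y - restr (mpoly_scale c x + y) = mpoly_scale c (ell i) + (y - restr y)\<close>
    show ?case by (simp only:)
  qed
  moreover have "f \<in> mpoly.span (var ` {..n})" using f linear_forms_span by blast
  moreover have "restr f = 0" using f by (auto simp: mem_L_iff)
  ultimately have "f \<in> mpoly.span (ell ` {..n})" by force
  moreover have "ell ` {..n} \<subseteq> mpoly.span (ell ` ({..n} - {a, b}))"
  proof
    fix x assume "x \<in> ell ` {..n}"
    then obtain i where "i \<le> n" "x = ell i" by auto
    moreover have "ell a = 0" "ell b = 0" by (auto simp: ell_def lam_mu)
    ultimately show "x \<in> mpoly.span (ell ` ({..n} - {a, b}))"
      by (cases "i = a \<or> i = b") (auto intro: mpoly.span_zero mpoly.span_base)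
  qed
  ultimately show "f \<in> mpoly.span (ell ` ({..n} - {a, b}))"
    using mpoly.span_minimal[of "ell ` {..n}"] by blast
qed

text \<open>The ideal \<open>L\<close> is generated by linear forms, and polynomials act on \<open>L/L\<^sup>2\<close> through \<open>K[s,t]\<close>; hence \<open>L\<close>
is generated in degree 1 over \<open>K[s,t]\<close>, modulo any ideal that contains \<open>L\<^sup>2\<close>. For the proof, the decomposition of a form into multiples of variables is compared with its restriction, which
gives products \<open>ell i * f\<close>; in these, \<open>f\<close> matters only modulo \<open>L\<close> and so may be written in terms of \<open>s\<close>
and \<open>t\<close>.\<close>

lemma L_generation:
  assumes I: "ideal I (poly_ring n)" "\<And>x y. x \<in> L \<Longrightarrow> y \<in> L \<Longrightarrow> x * y \<in> I"
    and f: "f \<in> L" "f \<in> forms n (Suc d)" "d \<ge> 1"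
  shows "\<exists>p\<in>L \<inter> forms n d. \<exists>q\<in>L \<inter> forms n d. f - s * p - t * q \<in> I"
proof -
  have "d \<ge> 2 \<longrightarrow> (\<exists>p\<in>L \<inter> forms n (d - 1). \<exists>q\<in>L \<inter> forms n (d - 1). f - restr f - s * p - t * q \<in> I)"
    if "f \<in> forms n d" for f d
    using that
  proof (induction rule: forms_induct)
    case (zero d)
    then show ?case
      using poly_idealD(2)[OF I(1)] poly_idealD(2)[OF L_ideal]
      by (intro impI bexI[of _ 0]) (auto simp: restr_simps)
  next
    case (add d f g)
    show ?case
    proof
      assume "d \<ge> 2"
      with add obtain p q p' q' where pq: "p \<in> L \<inter> forms n (d - 1)" "q \<in> L \<inter> forms n (d - 1)"
          "p' \<in> L \<inter> forms n (d - 1)" "q' \<in> L \<inter> forms n (d - 1)"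
          "f - restr f - s * p - t * q \<in> I" "g - restr g - s * p' - t * q' \<in> I" by blast
      have "f + g - restr (f + g) - s * (p + p') - t * (q + q')
          = (f - restr f - s * p - t * q) + (g - restr g - s * p' - t * q')"
        by (simp add: restr_simps algebra_simps)
      also have "\<dots> \<in> I" using pq by (intro poly_idealD(3)[OF I(1)])
      finally show "\<exists>p\<in>L \<inter> forms n (d - 1). \<exists>q\<in>L \<inter> forms n (d - 1).
          f + g - restr (f + g) - s * p - t * q \<in> I"
        using pq poly_idealD(3)[OF L_ideal] by blast
    qed
  next
    case (const c)
    then show ?case by simp
  next
    case (var i d f)
    show ?case
    proof
      assume "2 \<le> Suc d"
      then obtain e where d: "d = Suc e" by (cases d) auto
      obtain p q l where f: "f = s * p + t * q + l" "p \<in> forms n e" "q \<in> forms n e" "l \<in> L"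
        using form_mod_L_linear[of f e] var(2) d by blast
      let ?r = "f - restr f"
      have r: "?r \<in> L" "?r \<in> forms n d"
        using var(2) restr_forms[OF var(2)] by (auto intro: diff_restr_in_L forms_in_poly_ring)
      let ?p = "ell i * p + const (lam i) * ?r" and ?q = "ell i * q + const (mu i) * ?r"
      have "var i * f - restr (var i * f) = ell i * f + (const (lam i) * s + const (mu i) * t) * ?r"
        by (simp add: var_eq[of i] restr_simps algebra_simps) (simp add: ell_def restr_simps algebra_simps)
      then have "var i * f - restr (var i * f) - s * ?p - t * ?q = ell i * l"
        by (simp add: f(1) algebra_simps)
      also have "\<dots> \<in> I" using var f by (intro I(2) ell_in_L)
      finally have 1: "var i * f - restr (var i * f) - s * ?p - t * ?q \<in> I" .
      have pqL: "?p \<in> L" "?q \<in> L"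
        using r(1) f(2,3) ell_in_L[OF var(1)]
        by (auto intro!: poly_idealD(3)[OF L_ideal]
            intro: poly_idealD(6)[OF L_ideal _ r(1)] poly_idealD(7)[OF L_ideal _ ell_in_L[OF var(1)]] forms_in_poly_ring)
      have "?p \<in> forms n d" "?q \<in> forms n d"
        using r(2) forms_mult[OF ell_forms[OF var(1)] f(2)] forms_mult[OF ell_forms[OF var(1)] f(3)] d
        by (auto intro!: forms_add forms_const_mult)
      then show "\<exists>p\<in>L \<inter> forms n (Suc d - 1). \<exists>q\<in>L \<inter> forms n (Suc d - 1).
          var i * f - restr (var i * f) - s * p - t * q \<in> I"
        using 1 pqL by (intro bexI[of _ ?p] bexI[of _ ?q]) auto
    qed
  qed
  from this[OF f(2)] f(1,3) show ?thesis by (auto simp: mem_L_iff)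
qed

end

section \<open>Local rings and embedded points\<close>

lemma carrier_FactRing: "carrier (R Quot I) = (\<lambda>x. I +>\<^bsub>R\<^esub> x) ` carrier R"
  by (auto simp: FactRing_simps)

lemma (in cring) quotient_primeideal:
  assumes I: "ideal I R" and K: "primeideal K R" and IK: "I \<subseteq> K"
  shows quotient_ideal_mem_iff: "x \<in> carrier R \<Longrightarrow> I +> x \<in> (+>) I ` K \<longleftrightarrow> x \<in> K"
    and primeideal_quotient: "primeideal ((+>) I ` K) (R Quot I)"
proof -
  interpret I: ideal I R by (rule I)
  interpret K: primeideal K R by (rule K)
  have idl: "ideal ((+>) I ` K) (R Quot I)"
    using ring_ideal_imp_quot_ideal[OF I K.is_ideal] .
  have "\<Union> ((+>) I ` K) = K" using ideal_incl_iff[OF I K.is_ideal] IK by blast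
  moreover have "(+>) I ` K \<subseteq> carrier (R Quot I)"
    using ideal.Icarr[OF idl] by blast
  ultimately show mem: "I +> x \<in> (+>) I ` K \<longleftrightarrow> x \<in> K" if "x \<in> carrier R" for x
    using canonical_proj_vimage_mem_iff[OF I _ that] by metis
  note car = carrier_FactRing[of R I]
  show "primeideal ((+>) I ` K) (R Quot I)"
  proof (rule primeidealI[OF idl I.quotient_is_cring[OF is_cring]])
    obtain x where "x \<in> carrier R" "x \<notin> K" using K.I_notcarr K.a_subset by blast
    then show "carrier (R Quot I) \<noteq> (+>) I ` K" using mem[of x] car by blast
  next
    fix X Y assume "X \<in> carrier (R Quot I)" "Y \<in> carrier (R Quot I)"
      and XY: "X \<otimes>\<^bsub>R Quot I\<^esub> Y \<in> (+>) I ` K"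
    then obtain x y where xy: "x \<in> carrier R" "y \<in> carrier R" "X = I +> x" "Y = I +> y"
      unfolding car by blast
    have "X \<otimes>\<^bsub>R Quot I\<^esub> Y = I +> (x \<otimes> y)"
      using xy by (simp add: FactRing_def I.rcoset_mult_add)
    then have "x \<otimes> y \<in> K" using XY mem[of "x \<otimes> y"] xy by simp
    then show "X \<in> (+>) I ` K \<or> Y \<in> (+>) I ` K"
      using K.I_prime xy mem by blast
  qed
qed

lemma (in cring) genideal_empty: "Idl {} = {\<zero>}"
  using genideal_minimal[OF zeroideal, of "{}"] additive_subgroup.zero_closed[OF ideal.axioms(1)[OF genideal_ideal[of "{}"]]]
  by auto

text \<open>A chain of two primes makes the dimension, hence the depth, positive, and then the first element of a
regular sequence is as required.\<close>

lemma cohen_macaulay_local_regular_nonunit: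
  fixes R (structure)
  assumes CM: "cohen_macaulay_local R"
    and primes: "primeideal P R" "primeideal Q R" "P \<subset> Q"
  shows "\<exists>x\<in>carrier R. (\<forall>y\<in>carrier R. x \<otimes> y \<noteq> \<one>) \<and> (\<forall>r\<in>carrier R. x \<otimes> r = \<zero> \<longrightarrow> r = \<zero>)"
proof -
  interpret cring R using CM by (simp add: cohen_macaulay_local_def local_ring_def)
  have "enat (card {P, Q} - 1) \<le> krull_dim R"
    unfolding krull_dim_def chain_dim_def
    by (rule SUP_upper) (use primes in auto)
  then have "enat 1 \<le> local_depth R"
    using CM primes(3) by (simp add: cohen_macaulay_local_def psubset_eq)
  then have "0 < local_depth R" by (rule less_le_trans[rotated]) (simp add: zero_enat_def)
  then obtain xs where xs: "regular_sequence R xs" "xs \<noteq> []"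
    unfolding local_depth_def less_SUP_iff by (auto simp: zero_enat_def)
  define x where "x = xs ! 0"
  have x: "x \<in> set xs" using xs(2) by (simp add: x_def)
  have sub: "set xs \<subseteq> carrier R" and ne: "Idl (set xs) \<noteq> carrier R"
    using xs(1) by (auto simp: regular_sequence_def)
  interpret I: ideal "Idl (set xs)" R by (rule genideal_ideal[OF sub])
  have xI: "x \<in> Idl (set xs)" using x genideal_self[OF sub] by blast
  have "x \<otimes> y \<noteq> \<one>" if "y \<in> carrier R" for y
    using I.I_r_closed[OF xI that] I.one_imp_carrier ne by auto
  moreover have "r = \<zero>" if "r \<in> carrier R" "x \<otimes> r = \<zero>" for r
    using xs that unfolding regular_sequence_def x_def
    by (auto dest!: spec[of _ 0] simp: genideal_empty)
  ultimately show ?thesis using x sub by blast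
qed

lemma Fract_in_hom_localization:
  "f \<in> forms n d \<Longrightarrow> g \<in> forms n d \<Longrightarrow> g \<notin> P \<Longrightarrow> Fract f g \<in> carrier (hom_localization n P)"
  by (auto simp: hom_localization_def)

lemma hom_localization_simps [simp]:
  "mult (hom_localization n P) = (*)" "one (hom_localization n P) = 1"
  "zero (hom_localization n P) = 0" "add (hom_localization n P) = (+)"
  by (simp_all add: hom_localization_def)

lemma prime_poly_idealD:
  assumes "primeideal P (poly_ring n :: 'a::field mpoly ring)"
  shows "x \<in> carrier (poly_ring n) \<Longrightarrow> y \<in> carrier (poly_ring n) \<Longrightarrow> x * y \<in> P \<Longrightarrow> x \<in> P \<or> y \<in> P"
    and "1 \<notin> P" and "x \<notin> P \<Longrightarrow> x \<noteq> 0" and "ideal P (poly_ring n)"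
proof -
  interpret primeideal P "poly_ring n :: 'a mpoly ring" by fact
  show "x \<in> carrier (poly_ring n) \<Longrightarrow> y \<in> carrier (poly_ring n) \<Longrightarrow> x * y \<in> P \<Longrightarrow> x \<in> P \<or> y \<in> P"
    using I_prime by simp
  show "1 \<notin> P" using one_imp_carrier I_notcarr by auto
  show "ideal P (poly_ring n)" by (rule is_ideal)
  then show "x \<notin> P \<Longrightarrow> x \<noteq> 0" using poly_idealD(2) by blast
qed

lemma hom_localizationE:
  assumes "x \<in> carrier (hom_localization n P)"
  obtains f g d where "x = Fract f g" "f \<in> forms n d" "g \<in> forms n d" "g \<notin> P"
  using assms by (auto simp: hom_localization_def)

lemma hom_localization_idealE:
  assumes "x \<in> hom_localization_ideal n P I"
  obtains f g d where "x = Fract f g" "f \<in> I" "f \<in> forms n d" "g \<in> forms n d" "g \<notin> P"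
  using assms by (auto simp: hom_localization_ideal_def)

lemma Fract_in_hom_localization_ideal:
  "f \<in> I \<Longrightarrow> f \<in> forms n d \<Longrightarrow> g \<in> forms n d \<Longrightarrow> g \<notin> P \<Longrightarrow> Fract f g \<in> hom_localization_ideal n P I"
  by (auto simp: hom_localization_ideal_def)

context
  fixes n :: nat and P :: "'a::field mpoly set"
  assumes P: "primeideal P (poly_ring n)"
begin

lemma forms_mult_notin_prime:
  "g \<in> forms n d \<Longrightarrow> h \<in> forms n e \<Longrightarrow> g \<notin> P \<Longrightarrow> h \<notin> P \<Longrightarrow> g * h \<notin> P"
  using prime_poly_idealD(1)[OF P, of g h] forms_in_poly_ring by blast

lemma hom_localization_ideal_closed:
  assumes "ideal I (poly_ring n)"
  shows "0 \<in> hom_localization_ideal n P I"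
    "x \<in> hom_localization_ideal n P I \<Longrightarrow> y \<in> hom_localization_ideal n P I \<Longrightarrow> x + y \<in> hom_localization_ideal n P I"
    "x \<in> hom_localization_ideal n P I \<Longrightarrow> - x \<in> hom_localization_ideal n P I"
    "x \<in> hom_localization_ideal n P I \<Longrightarrow> y \<in> carrier (hom_localization n P) \<Longrightarrow> x * y \<in> hom_localization_ideal n P I"
proof -
  note nz = prime_poly_idealD(3)[OF P]
  note cl = poly_idealD[OF assms]
  show "0 \<in> hom_localization_ideal n P I"
    unfolding Zero_fract_def
    by (rule Fract_in_hom_localization_ideal[of _ _ _ 0]) (use cl(2) prime_poly_idealD(2)[OF P] in auto)
  show "x + y \<in> hom_localization_ideal n P I"
    if xI: "x \<in> hom_localization_ideal n P I" and yI: "y \<in> hom_localization_ideal n P I"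
  proof -
    obtain f g d where x: "x = Fract f g" "f \<in> I" "f \<in> forms n d" "g \<in> forms n d" "g \<notin> P"
      using xI by (rule hom_localization_idealE)
    obtain f' g' d' where y: "y = Fract f' g'" "f' \<in> I" "f' \<in> forms n d'" "g' \<in> forms n d'" "g' \<notin> P"
      using yI by (rule hom_localization_idealE)
    have "x + y = Fract (f * g' + f' * g) (g * g')" using x y nz by simp
    also have "\<dots> \<in> hom_localization_ideal n P I"
    proof (rule Fract_in_hom_localization_ideal)
      show "f * g' + f' * g \<in> I"
        using x y forms_in_poly_ring by (intro cl(3,7)) auto
      show "f * g' + f' * g \<in> forms n (d + d')"
        using forms_mult[OF x(3) y(4)] forms_mult[OF y(3) x(4)] by (auto simp: add.commute)
      show "g * g' \<in> forms n (d + d')" using forms_mult[OF x(4) y(4)] .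
      show "g * g' \<notin> P" using forms_mult_notin_prime x y by blast
    qed
    finally show ?thesis .
  qed
  show "- x \<in> hom_localization_ideal n P I" if xI: "x \<in> hom_localization_ideal n P I"
  proof -
    obtain f g d where x: "x = Fract f g" "f \<in> I" "f \<in> forms n d" "g \<in> forms n d" "g \<notin> P"
      using xI by (rule hom_localization_idealE)
    then show ?thesis using cl(5) by (auto intro: Fract_in_hom_localization_ideal)
  qed
  show "x * y \<in> hom_localization_ideal n P I"
    if xI: "x \<in> hom_localization_ideal n P I" and yI: "y \<in> carrier (hom_localization n P)"
  proof -
    obtain f g d where x: "x = Fract f g" "f \<in> I" "f \<in> forms n d" "g \<in> forms n d" "g \<notin> P"
      using xI by (rule hom_localization_idealE)
    obtain f' g' d' where y: "y = Fract f' g'" "f' \<in> forms n d'" "g' \<in> forms n d'" "g' \<notin> P"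
      using yI by (rule hom_localizationE)
    have "x * y = Fract (f * f') (g * g')" using x y by simp
    also have "\<dots> \<in> hom_localization_ideal n P I"
    proof (rule Fract_in_hom_localization_ideal)
      show "f * f' \<in> I" using x y forms_in_poly_ring by (intro cl(7)) auto
      show "f * f' \<in> forms n (d + d')" "g * g' \<in> forms n (d + d')" "g * g' \<notin> P"
        using forms_mult forms_mult_notin_prime x y by blast+
    qed
    finally show ?thesis .
  qed
qed

text \<open>The closure properties of the ring are those of the ideal belonging to the unit ideal.\<close>

lemma hom_localization_eq_ideal:
  "carrier (hom_localization n P) = hom_localization_ideal n P (carrier (poly_ring n))"
  by (auto simp: hom_localization_def hom_localization_ideal_def dest: forms_in_poly_ring)

lemma cring_hom_localization: "cring (hom_localization n P)"
proof -
  interpret S: cring "poly_ring n :: 'a mpoly ring" by (rule cring_poly_ring)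
  note cl = hom_localization_ideal_closed[OF S.oneideal]
  have one: "1 \<in> carrier (hom_localization n P)"
    unfolding One_fract_def
    by (rule Fract_in_hom_localization[of _ _ 0]) (use prime_poly_idealD(2)[OF P] in auto)
  note C = cl[folded hom_localization_eq_ideal]
  show ?thesis
  proof (rule cringI)
    show "abelian_group (hom_localization n P)"
      by (rule abelian_groupI) (auto simp: algebra_simps C intro!: bexI[of _ "- _"])
    show "comm_monoid (hom_localization n P)"
      by unfold_locales (auto simp: algebra_simps C one)
  qed (auto simp: algebra_simps)
qed

lemma ideal_hom_localization_ideal:
  assumes I: "ideal I (poly_ring n)"
  shows "ideal (hom_localization_ideal n P I) (hom_localization n P)"
proof -
  interpret cring "hom_localization n P" by (rule cring_hom_localization)
  interpret S: cring "poly_ring n :: 'a mpoly ring" by (rule cring_poly_ring)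
  note cl = hom_localization_ideal_closed[OF I]
  note C = hom_localization_ideal_closed[OF S.oneideal, folded hom_localization_eq_ideal]
  have sub: "hom_localization_ideal n P I \<subseteq> carrier (hom_localization n P)"
    by (auto simp: hom_localization_def hom_localization_ideal_def)
  have neg: "\<ominus>\<^bsub>hom_localization n P\<^esub> x = - x" if "x \<in> carrier (hom_localization n P)" for x
    using minus_equality[of "- x" x] that C(3) by simp
  show ?thesis
  proof (rule idealI)
    show "subgroup (hom_localization_ideal n P I) (add_monoid (hom_localization n P))"
      by (rule group.subgroupI[OF a_group], unfold a_inv_def[symmetric])
        (use cl sub neg in auto)
  next
    fix x y assume "x \<in> hom_localization_ideal n P I" "y \<in> carrier (hom_localization n P)"
    then show "y \<otimes>\<^bsub>hom_localization n P\<^esub> x \<in> hom_localization_ideal n P I"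
      "x \<otimes>\<^bsub>hom_localization n P\<^esub> y \<in> hom_localization_ideal n P I"
      using cl(4) by (simp_all add: mult.commute)
  qed (rule ring_axioms)
qed

lemma Fract_in_prime_hom_localization_ideal_iff:
  assumes I: "primeideal I (poly_ring n)" "I \<subseteq> P" and fg: "f \<in> forms n d" "g \<in> forms n d" "g \<notin> P"
  shows "Fract f g \<in> hom_localization_ideal n P I \<longleftrightarrow> f \<in> I"
proof
  assume "Fract f g \<in> hom_localization_ideal n P I"
  then obtain f' g' d' where h: "Fract f g = Fract f' g'" "f' \<in> I" "f' \<in> forms n d'" "g' \<in> forms n d'" "g' \<notin> P"
    by (rule hom_localization_idealE)
  then have "f * g' = f' * g"
    using prime_poly_idealD(3)[OF P] fg(3) by (simp add: eq_fract)
  also have "\<dots> \<in> I"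
    using h(2) fg(2) poly_idealD(7)[OF prime_poly_idealD(4)[OF I(1)]] forms_in_poly_ring by blast
  finally show "f \<in> I"
    using prime_poly_idealD(1)[OF I(1), of f g'] fg h I(2) forms_in_poly_ring by blast
qed (use assms in \<open>auto intro: Fract_in_hom_localization_ideal\<close>)

lemma primeideal_hom_localization_ideal:
  assumes I: "primeideal I (poly_ring n)" "I \<subseteq> P"
  shows "primeideal (hom_localization_ideal n P I) (hom_localization n P)"
proof (rule primeidealI)
  note iff = Fract_in_prime_hom_localization_ideal_iff[OF I]
  show "ideal (hom_localization_ideal n P I) (hom_localization n P)"
    by (rule ideal_hom_localization_ideal[OF prime_poly_idealD(4)[OF I(1)]])
  show "cring (hom_localization n P)" by (rule cring_hom_localization)
  have "Fract 1 1 \<in> carrier (hom_localization n P) - hom_localization_ideal n P I"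
    using iff[of 1 0 1] prime_poly_idealD(2)[OF P] prime_poly_idealD(2)[OF I(1)]
    by (auto intro: Fract_in_hom_localization[of _ _ 0])
  then show "carrier (hom_localization n P) \<noteq> hom_localization_ideal n P I" by blast
next
  note iff = Fract_in_prime_hom_localization_ideal_iff[OF I]
  fix x y assume xI: "x \<in> carrier (hom_localization n P)" and yI: "y \<in> carrier (hom_localization n P)"
    and xy: "x \<otimes>\<^bsub>hom_localization n P\<^esub> y \<in> hom_localization_ideal n P I"
  obtain f g d where x: "x = Fract f g" "f \<in> forms n d" "g \<in> forms n d" "g \<notin> P"
    using xI by (rule hom_localizationE)
  obtain f' g' d' where y: "y = Fract f' g'" "f' \<in> forms n d'" "g' \<in> forms n d'" "g' \<notin> P"
    using yI by (rule hom_localizationE)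
  have "f * f' \<in> I"
    using xy x y iff[OF forms_mult[OF x(2) y(2)] forms_mult[OF x(3) y(3)]]
      forms_mult_notin_prime[OF x(3) y(3)] by simp
  then have "f \<in> I \<or> f' \<in> I"
    using prime_poly_idealD(1)[OF I(1)] x y forms_in_poly_ring by blast
  then show "x \<in> hom_localization_ideal n P I \<or> y \<in> hom_localization_ideal n P I"
    using iff x y by auto
qed

end

text \<open>The kernel of an idempotent substitution is generated by the forms \<open>var i - \<sigma> i\<close>.\<close>

lemma homogeneous_kernel_subst:
  fixes \<sigma> :: "nat \<Rightarrow> 'a::field mpoly"
  assumes \<sigma>: "\<And>i. i \<le> n \<Longrightarrow> \<sigma> i \<in> forms n 1" "\<And>i. i \<le> n \<Longrightarrow> subst \<sigma> (\<sigma> i) = \<sigma> i"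
  shows "homogeneous_ideal n {f \<in> carrier (poly_ring n). subst \<sigma> f = 0}"
proof -
  interpret S: cring "poly_ring n :: 'a mpoly ring" by (rule cring_poly_ring)
  let ?K = "{f \<in> carrier (poly_ring n). subst \<sigma> f = 0}"
  let ?H = "?K \<inter> (\<Union>d. forms n d)"
  have K: "ideal ?K (poly_ring n)" using ideal_kernel_subst primeideal.axioms(1) by blast
  have H: "ideal (Idl\<^bsub>poly_ring n\<^esub> ?H) (poly_ring n)" by (rule S.genideal_ideal) auto
  have "var i - \<sigma> i \<in> Idl\<^bsub>poly_ring n\<^esub> ?H" if "i \<le> n" for i
  proof -
    have "var i - \<sigma> i \<in> forms n 1" using \<sigma>(1)[OF that] forms_var[OF that] by auto
    then have "var i - \<sigma> i \<in> ?H"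
      using \<sigma>(2)[OF that] by (auto simp: subst_diff forms_in_poly_ring)
    then show ?thesis using S.genideal_self[of ?H] by auto
  qed
  then have "f - subst \<sigma> f \<in> Idl\<^bsub>poly_ring n\<^esub> ?H" if "f \<in> carrier (poly_ring n)" for f
    using that \<sigma>(1) forms_in_poly_ring by (intro diff_subst_in_ideal[OF H]) blast+
  then have "?K \<subseteq> Idl\<^bsub>poly_ring n\<^esub> ?H" by fastforce
  moreover have "Idl\<^bsub>poly_ring n\<^esub> ?H \<subseteq> ?K" by (rule S.genideal_minimal[OF K]) blast
  ultimately show ?thesis unfolding homogeneous_ideal_def using K by blast
qed

locale rope_coordinates = line_coordinates +
  fixes C :: "'a mpoly set"
  assumes C_ideal: "ideal C (poly_ring n)" and C_saturated: "saturated n C"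
    and C_locally_cohen_macaulay: "locally_cohen_macaulay n C"
    and points_C: "points n C = points n L"
    and L_square: "\<And>x y. x \<in> L \<Longrightarrow> y \<in> L \<Longrightarrow> x * y \<in> C"
begin

text \<open>The generic point of the line is a point of the curve.\<close>

lemma C_subset_L: "C \<subseteq> L"
proof -
  have "homogeneous_ideal n L"
    unfolding L_kernel
    by (rule homogeneous_kernel_subst) (auto simp: subst_add subst_mult lam_mu intro: forms_const_mult)
  then have "L \<in> points n L"
    using L_prime s_notin_L ab by (auto simp: points_def)
  then show ?thesis using points_C by (auto simp: points_def)
qed

lemma P_point: "P \<in> points n C"
proof -
  have "homogeneous_ideal n P"
    unfolding P_def
    by (rule homogeneous_kernel_subst) (auto simp: subst_mult lam_mu intro: forms_const_mult)
  then show ?thesis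
    using P_prime t_notin_P[of 1] ab C_subset_L L_subset_P by (auto simp: points_def)
qed

text \<open>Multiplication by \<open>s\<close> is injective modulo \<open>C\<close>. Suppose that \<open>s f \<in> C\<close> but \<open>f \<notin> C\<close>. Every form in \<open>P\<close>
kills \<open>f\<close> modulo \<open>C\<close>, because \<open>L f\<close> and \<open>s f\<close> lie in \<open>C\<close>. No form outside \<open>P\<close> does: it would be congruent
to a nonzero multiple of some \<open>t\<^sup>e\<close>, and saturation of \<open>C\<close> would allow \<open>t\<^sup>e\<close> to be cancelled. So the
germ of \<open>f\<close> at the point \<open>P\<close> is nonzero and is killed by the whole maximal ideal, whereas positive depth
provides a nonzerodivisor there.\<close>

lemma s_regular:
  assumes f: "f \<in> forms n d" and sf: "s * f \<in> C"
  shows "f \<in> C"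
proof (rule ccontr)
  assume fC: "f \<notin> C"
  note cl = poly_idealD[OF C_ideal]
  have fcar: "f \<in> carrier (poly_ring n)" using f by (rule forms_in_poly_ring)
  have fL: "f \<in> L" using C_subset_L sf L_cancel[of 1 f] fcar by auto
  have kill: "h * f \<in> C" if hF: "h \<in> forms n e" and hP: "h \<in> P" for h e
  proof -
    obtain c l w where h: "h = const c * t ^ e + l + s * w" and l: "l \<in> L" and w: "w \<in> forms n (e - 1)"
      using form_mod_L[OF hF] by blast
    have wcar: "w \<in> carrier (poly_ring n)" using w by (rule forms_in_poly_ring)
    have "l + s * w \<in> P"
      using l L_subset_P s_in_P wcar by (intro poly_idealD(3,7)[OF P_ideal]) auto
    then have "h - (l + s * w) \<in> P" using hP by (intro poly_idealD(4)[OF P_ideal])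
    then have "const c * t ^ e \<in> P" by (simp add: h)
    then have "c = 0" by (auto simp: P_def subst_mult subst_power lam_mu)
    then have "h * f = l * f + w * (s * f)" by (simp add: h algebra_simps)
    then show ?thesis using L_square[OF l fL] cl(6)[OF wcar sf] cl(3) by simp
  qed
  \<comment> \<open>Modulo the annihilator of \<open>f\<close> every variable is a multiple of \<open>t\<close>, so saturation removes the powers of \<open>t\<close> one by one.\<close>
  have t_kill: "f \<in> C" if "t ^ e * f \<in> C" for e
    using that
  proof (induction e)
    case (Suc e)
    have "t ^ e * f \<in> C"
      using C_saturated unfolding saturated_def
    proof (elim ballE impE, intro allI impI)
      fix i assume i: "i \<le> n"
      have "var i * (t ^ e * f) = t ^ e * (ell i * f) + const (lam i) * t ^ e * (s * f) + const (mu i) * (t ^ Suc e * f)"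
        by (simp add: var_eq[of i] algebra_simps)
      also have "\<dots> \<in> C"
        by (intro cl(3) cl(6)[OF _ L_square[OF ell_in_L[OF i] fL]] cl(6)[OF _ sf] cl(6)[OF _ Suc.prems]) auto
      finally show "var i * (t ^ e * f) \<in> C" .
    qed (use fcar in auto)
    then show ?case by (rule Suc.IH)
  qed simp
  have not_kill: "g * f \<notin> C" if gF: "g \<in> forms n e" and gP: "g \<notin> P" for g e
  proof
    assume gf: "g * f \<in> C"
    obtain c l w where g: "g = const c * t ^ e + l + s * w" and l: "l \<in> L" and w: "w \<in> forms n (e - 1)"
      using form_mod_L[OF gF] by blast
    have wcar: "w \<in> carrier (poly_ring n)" using w by (rule forms_in_poly_ring)
    have "l + s * w \<in> P"
      using l L_subset_P s_in_P wcar by (intro poly_idealD(3,7)[OF P_ideal]) auto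
    then have "c \<noteq> 0" using gP by (auto simp: g)
    have "const (1 / c) * (g * f - l * f - w * (s * f)) \<in> C"
      by (intro cl(6)[of "const _"] cl(4) gf L_square[OF l fL] cl(6)[OF wcar sf]) auto
    also have "const (1 / c) * (g * f - l * f - w * (s * f)) = const (1 / c * c) * (t ^ e * f)"
      unfolding const_mult by (simp add: g algebra_simps)
    finally have "t ^ e * f \<in> C" using \<open>c \<noteq> 0\<close> by simp
    then show False using t_kill fC by blast
  qed
  let ?R = "hom_localization n P" and ?J = "hom_localization_ideal n P"
  interpret R: cring ?R by (rule cring_hom_localization[OF P_prime])
  interpret J: ideal "?J C" ?R by (rule ideal_hom_localization_ideal[OF P_prime C_ideal])
  have mono: "?J I \<subseteq> ?J I'" if "I \<subseteq> I'" for I I'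
    using that by (auto simp: hom_localization_ideal_def)
  have CP: "C \<subseteq> P" using C_subset_L L_subset_P by blast
  note primeJ = primeideal_hom_localization_ideal[OF P_prime]
  note QL = R.quotient_primeideal[OF J.is_ideal primeJ[OF L_prime L_subset_P] mono[OF C_subset_L]]
  note QP = R.quotient_primeideal[OF J.is_ideal primeJ[OF P_prime subset_refl] mono[OF CP]]
  have st: "Fract s t \<in> carrier ?R"
    using t_notin_P[of 1] by (intro Fract_in_hom_localization) auto
  \<comment> \<open>The germ \<open>s/t\<close> separates the primes of the generic point and of the closed point.\<close>
  have chain: "(+>\<^bsub>?R\<^esub>) (?J C) ` ?J L \<subset> (+>\<^bsub>?R\<^esub>) (?J C) ` ?J P"
  proof -
    have tP: "t \<notin> P" using t_notin_P[of 1] by simp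
    have "Fract s t \<in> ?J P"
      by (rule Fract_in_hom_localization_ideal[OF s_in_P st_forms tP])
    moreover have "Fract s t \<notin> ?J L"
      using Fract_in_prime_hom_localization_ideal_iff[OF P_prime L_prime L_subset_P st_forms tP] s_notin_L
      by simp
    ultimately have "?J C +>\<^bsub>?R\<^esub> Fract s t \<in> (+>\<^bsub>?R\<^esub>) (?J C) ` ?J P - (+>\<^bsub>?R\<^esub>) (?J C) ` ?J L"
      using QL(1)[OF st] by blast
    then show ?thesis using mono[OF L_subset_P] by blast
  qed
  have CM: "cohen_macaulay_local (?R Quot ?J C)"
    using C_locally_cohen_macaulay P_point by (simp add: locally_cohen_macaulay_def stalk_def)
  obtain X where X: "X \<in> carrier (?R Quot ?J C)"
      "\<And>Y. Y \<in> carrier (?R Quot ?J C) \<Longrightarrow> X \<otimes>\<^bsub>?R Quot ?J C\<^esub> Y \<noteq> \<one>\<^bsub>?R Quot ?J C\<^esub>"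
      "\<And>Y. Y \<in> carrier (?R Quot ?J C) \<Longrightarrow> X \<otimes>\<^bsub>?R Quot ?J C\<^esub> Y = \<zero>\<^bsub>?R Quot ?J C\<^esub> \<Longrightarrow> Y = \<zero>\<^bsub>?R Quot ?J C\<^esub>"
    using cohen_macaulay_local_regular_nonunit[OF CM QL(2) QP(2) chain]
    by (elim bexE conjE) (rule that, assumption, drule (1) bspec, assumption, drule (1) bspec, erule (1) mp)
  note car = carrier_FactRing[of ?R "?J C"]
  obtain F G e where FG: "F \<in> forms n e" "G \<in> forms n e" "G \<notin> P" "X = ?J C +>\<^bsub>?R\<^esub> Fract F G"
    using X(1) unfolding car by (elim imageE) (rule hom_localizationE, assumption, blast)
  have FGc: "Fract F G \<in> carrier ?R" using FG by (intro Fract_in_hom_localization)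
  \<comment> \<open>A nonunit of the local ring lies in its maximal ideal.\<close>
  have FP: "F \<in> P"
  proof (rule ccontr)
    assume "F \<notin> P"
    then have GF: "Fract G F \<in> carrier ?R" using FG by (intro Fract_in_hom_localization)
    have "X \<otimes>\<^bsub>?R Quot ?J C\<^esub> (?J C +>\<^bsub>?R\<^esub> Fract G F) = ?J C +>\<^bsub>?R\<^esub> (Fract F G * Fract G F)"
      using J.rcoset_mult_add[OF FGc GF] by (simp add: FactRing_def FG(4))
    also have "Fract F G * Fract G F = 1"
    proof -
      have "F \<noteq> 0" "G \<noteq> 0" using prime_poly_idealD(3)[OF P_prime] FG(3) \<open>F \<notin> P\<close> by blast+
      then show ?thesis by (simp add: One_fract_def eq_fract)
    qed
    finally have "X \<otimes>\<^bsub>?R Quot ?J C\<^esub> (?J C +>\<^bsub>?R\<^esub> Fract G F) = \<one>\<^bsub>?R Quot ?J C\<^esub>"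
      by (simp add: FactRing_def)
    then show False using X(2) GF unfolding car by blast
  qed
  have ft: "Fract f (t ^ d) \<in> carrier ?R"
    using f t_notin_P by (intro Fract_in_hom_localization) auto
  have "X \<otimes>\<^bsub>?R Quot ?J C\<^esub> (?J C +>\<^bsub>?R\<^esub> Fract f (t ^ d)) = ?J C +>\<^bsub>?R\<^esub> (Fract (F * f) (G * t ^ d))"
    using J.rcoset_mult_add[OF FGc ft] by (simp add: FactRing_def FG(4))
  also have "\<dots> = ?J C"
  proof (rule J.a_rcos_const)
    show "Fract (F * f) (G * t ^ d) \<in> ?J C"
      using kill[OF FG(1) FP] forms_mult[OF FG(1) f] forms_mult[OF FG(2) st_power_forms(2)]
        forms_mult_notin_prime[OF P_prime FG(2) st_power_forms(2) FG(3) t_notin_P]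
      by (intro Fract_in_hom_localization_ideal)
  qed
  finally have "?J C +>\<^bsub>?R\<^esub> Fract f (t ^ d) = ?J C"
    using X(3)[of "?J C +>\<^bsub>?R\<^esub> Fract f (t ^ d)"] ft unfolding car by (simp add: FactRing_def)
  then have "Fract f (t ^ d) \<in> ?J C"
    using J.rcos_const_imp_mem[OF ft] by simp
  then obtain c g e where c: "Fract f (t ^ d) = Fract c g" "c \<in> C" "g \<in> forms n e" "g \<notin> P"
    by (rule hom_localization_idealE)
  then have "f * g = c * t ^ d"
    using prime_poly_idealD(3)[OF P_prime] t_notin_P by (simp add: eq_fract)
  then have "g * f \<in> C" using cl(7)[OF _ c(2), of "t ^ d"] by (simp add: mult.commute)
  then show False using not_kill c by blast
qed

end

section \<open>The Hilbert function of the conormal module\<close>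

lemma forms_0_const: "f \<in> forms n 0 \<Longrightarrow> \<exists>c. f = const c"
proof -
  have "d = 0 \<longrightarrow> (\<exists>c. f = const c)" if "f \<in> forms n d" for d and f :: "'a mpoly"
    using that by (induction rule: forms_induct) (auto simp flip: const_add intro: exI[of _ 0])
  then show "f \<in> forms n 0 \<Longrightarrow> \<exists>c. f = const c" by blast
qed

lemma antitone_nat_eventually_constant:
  fixes c :: "nat \<Rightarrow> nat"
  assumes "\<And>d. c (Suc d) \<le> c d"
  shows "\<exists>D. \<forall>d\<ge>D. c d = c D"
proof -
  have mono: "c d \<le> c e" if "e \<le> d" for d e
    using lift_Suc_antimono_le[of c, OF assms that] .
  obtain D where D: "c D = Inf (range c)" using Inf_nat_def1[of "range c"] by auto
  have "c d = c D" if "d \<ge> D" for d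
    using mono[OF that] D cInf_lower[of "c d" "range c"] by auto
  then show ?thesis by blast
qed

text \<open>The increments of \<open>q\<close> stabilize from above, so \<open>q d\<close> minus the limiting linear function is
nondecreasing and eventually zero.\<close>

lemma antitone_increments_eventually_linear:
  fixes q c :: "nat \<Rightarrow> nat"
  assumes q: "q 0 = 0" "\<And>d. q (Suc d) = c d + q d" and c: "\<And>d. c (Suc d) \<le> c d"
  shows "\<exists>N c0. (\<exists>D. \<forall>d\<ge>D. int (q d) = int N * int d + c0) \<and> (\<forall>d. int (q d) \<le> int N * int d + c0)"
    and "q d \<le> c 0 * d"
proof -
  have mono: "c d \<le> c e" if "e \<le> d" for d e
    using lift_Suc_antimono_le[of c, OF c that] .
  show "q d \<le> c 0 * d"
  proof (induction d)
    case (Suc d)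
    then show ?case using mono[of 0 d] by (simp add: q)
  qed (simp add: q)
  obtain D where D: "\<And>d. d \<ge> D \<Longrightarrow> c d = c D"
    using antitone_nat_eventually_constant[of c] c by blast
  define N c0 where "N = c D" and "c0 = int (q D) - int N * int D"
  have eq: "int (q d) = int N * int d + c0" if "d \<ge> D" for d
    using that
  proof (induction rule: dec_induct)
    case (step d)
    then show ?case using D[of d] by (simp add: N_def q algebra_simps)
  qed (simp add: c0_def)
  have ge: "N \<le> c d" for d
    using mono[of d D] D[of d] by (cases "d \<le> D") (auto simp: N_def)
  have step: "int (q d) - int N * int d \<le> int (q (Suc d)) - int N * int (Suc d)" for d
    using ge[of d] by (simp add: q algebra_simps)
  have "int (q d) - int N * int d \<le> int (q e) - int N * int e" if "d \<le> e" for d e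
    using lift_Suc_mono_le[of "\<lambda>d. int (q d) - int N * int d", OF step that] .
  then have "int (q d) \<le> int N * int d + c0" for d
    using eq[of "max d D"] by (metis (no_types, lifting) add_diff_cancel_left' diff_le_eq add.commute max.cobounded1 max.cobounded2)
  with eq show "\<exists>N c0. (\<exists>D. \<forall>d\<ge>D. int (q d) = int N * int d + c0) \<and> (\<forall>d. int (q d) \<le> int N * int d + c0)"
    by blast
qed

lemma hilbert_polynomial_eqI:
  assumes "\<And>t. t \<ge> D \<Longrightarrow> ereal_of_enat (hilbert_function n I t) = ereal (poly p (real t))"
  shows "hilbert_polynomial n I = p"
  unfolding hilbert_polynomial_def
proof (rule the_equality)
  show ev: "\<forall>\<^sub>F t in sequentially. ereal_of_enat (hilbert_function n I t) = ereal (poly p (real t))"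
    using assms by (auto simp: eventually_sequentially)
  fix p' assume "\<forall>\<^sub>F t in sequentially. ereal_of_enat (hilbert_function n I t) = ereal (poly p' (real t))"
  with ev have "\<forall>\<^sub>F t in sequentially. poly (p' - p) (real t) = 0"
    by eventually_elim simp
  then obtain M where M: "\<And>t. t \<ge> M \<Longrightarrow> poly (p' - p) (real t) = 0"
    by (auto simp: eventually_sequentially)
  have "infinite (real ` {M..})"
    using infinite_Ici[of M] by (simp add: finite_image_iff)
  moreover have "real ` {M..} \<subseteq> {x. poly (p' - p) x = 0}" using M by auto
  ultimately have "infinite {x. poly (p' - p) x = 0}" using finite_subset by blast
  then show "p' = p" using poly_roots_finite[of "p' - p"] by auto
qed

context rope_coordinates
begin

abbreviation "qdim \<equiv> quot_dim (mpoly_scale :: 'a \<Rightarrow> _)"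

lemma quot_dim_rel_mpoly:
  fixes r :: "'a mpoly \<Rightarrow> 'a mpoly \<Rightarrow> bool"
  assumes "r 0 0" "\<And>x y x' y'. r x y \<Longrightarrow> r x' y' \<Longrightarrow> r (x + x') (y + y')"
    "\<And>c x y. r x y \<Longrightarrow> r (const c * x) (const c * y)"
    "\<And>x. x \<in> V \<Longrightarrow> \<exists>y\<in>V'. r x y" "\<And>x y. r x y \<Longrightarrow> y \<in> W' \<Longrightarrow> x \<in> W" "0 \<in> W'"
  shows "qdim V W \<le> qdim V' W'"
  by (rule quot_dim_relation_le[OF vector_space_mpoly_scale vector_space_mpoly_scale, of r])
    (unfold mpoly_scale_def, (rule assms; assumption)+)

lemma s_power_regular:
  assumes "f \<in> forms n d" "s ^ k * f \<in> C"
  shows "f \<in> C"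
  using assms(2)
proof (induction k)
  case (Suc k)
  have "s ^ k * f \<in> forms n (k + d)" using assms(1) by (intro forms_mult) auto
  moreover have "s * (s ^ k * f) \<in> C" using Suc.prems by (simp add: mult.assoc)
  ultimately show ?case using s_regular Suc.IH by blast
qed simp

text \<open>The preimage of \<open>s\<^sup>k Q\<close> in degree \<open>d + k\<close>, for the conormal module \<open>Q = L/C\<close>.\<close>

definition s_multiples :: "nat \<Rightarrow> nat \<Rightarrow> 'a mpoly set" where
  "s_multiples k d = {s ^ k * x + y | x y. x \<in> L \<inter> forms n d \<and> y \<in> C \<inter> forms n (d + k)}"

lemma subspaces:
  "mpoly.subspace (L \<inter> forms n d)" "mpoly.subspace (C \<inter> forms n d)" "mpoly.subspace (P \<inter> forms n d)"
  by (intro subspace_ideal_forms L_ideal C_ideal P_ideal)+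

lemma L_closed:
  "0 \<in> L" "x \<in> L \<Longrightarrow> y \<in> L \<Longrightarrow> x + y \<in> L" "x \<in> L \<Longrightarrow> const c * x \<in> L"
  "x \<in> L \<Longrightarrow> s * x \<in> L" "x \<in> L \<Longrightarrow> t * x \<in> L" "x \<in> L \<Longrightarrow> s ^ k * x \<in> L" "x \<in> L \<Longrightarrow> t ^ k * x \<in> L"
  by (rule poly_idealD(2,3,6)[OF L_ideal]; simp)+

lemma C_closed:
  "0 \<in> C" "x \<in> C \<Longrightarrow> y \<in> C \<Longrightarrow> x + y \<in> C" "x \<in> C \<Longrightarrow> const c * x \<in> C"
  "x \<in> C \<Longrightarrow> s * x \<in> C" "x \<in> C \<Longrightarrow> t * x \<in> C" "x \<in> C \<Longrightarrow> s ^ k * x \<in> C" "x \<in> C \<Longrightarrow> t ^ k * x \<in> C"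
  by (rule poly_idealD(2,3,6)[OF C_ideal]; simp)+

lemma forms_mult_st_power:
  "f \<in> forms n d \<Longrightarrow> s ^ k * f \<in> forms n (d + k)" "f \<in> forms n d \<Longrightarrow> t ^ k * f \<in> forms n (d + k)"
  using forms_mult[OF st_power_forms(1), of f d k] forms_mult[OF st_power_forms(2), of f d k]
  by (auto simp: add.commute)

lemma subspace_s_multiples: "mpoly.subspace (s_multiples k d)"
  unfolding mpoly_subspace_iff
proof (intro conjI ballI allI)
  show "0 \<in> s_multiples k d"
    unfolding s_multiples_def by (intro CollectI exI[of _ 0]) (auto intro: L_closed C_closed)
next
  fix u v assume "u \<in> s_multiples k d" "v \<in> s_multiples k d"
  then obtain x y x' y' where "u = s ^ k * x + y" "x \<in> L \<inter> forms n d" "y \<in> C \<inter> forms n (d + k)"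
    "v = s ^ k * x' + y'" "x' \<in> L \<inter> forms n d" "y' \<in> C \<inter> forms n (d + k)"
    unfolding s_multiples_def by blast
  then show "u + v \<in> s_multiples k d"
    unfolding s_multiples_def
    by (intro CollectI exI[of _ "x + x'"] exI[of _ "y + y'"]) (auto simp: algebra_simps intro: L_closed C_closed)
next
  fix c u assume "u \<in> s_multiples k d"
  then obtain x y where "u = s ^ k * x + y" "x \<in> L \<inter> forms n d" "y \<in> C \<inter> forms n (d + k)"
    unfolding s_multiples_def by blast
  then show "const c * u \<in> s_multiples k d"
    unfolding s_multiples_def
    by (intro CollectI exI[of _ "const c * x"] exI[of _ "const c * y"])
      (auto simp: ring_distribs mult.left_commute intro: L_closed C_closed)
qed

lemma s_multiples_bounds: "C \<inter> forms n (d + k) \<subseteq> s_multiples k d" "s_multiples k d \<subseteq> L \<inter> forms n (d + k)"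
proof
  fix y assume "y \<in> C \<inter> forms n (d + k)"
  then show "y \<in> s_multiples k d"
    unfolding s_multiples_def using L_closed(1) by (intro CollectI exI[of _ 0] exI[of _ y]) auto
next
  show "s_multiples k d \<subseteq> L \<inter> forms n (d + k)"
    unfolding s_multiples_def using C_subset_L by (auto intro!: L_closed(2,6) forms_mult_st_power)
qed

lemma s_multiples_dim:
  "qdim (s_multiples k d) (C \<inter> forms n (d + k)) = qdim (L \<inter> forms n d) (C \<inter> forms n d)"
proof (rule antisym)
  show "qdim (s_multiples k d) (C \<inter> forms n (d + k)) \<le> qdim (L \<inter> forms n d) (C \<inter> forms n d)"
  proof (rule quot_dim_rel_mpoly[of "\<lambda>u x. u - s ^ k * x \<in> C \<inter> forms n (d + k) \<and> x \<in> forms n d"])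
    fix u x u' x'
    assume "u - s ^ k * x \<in> C \<inter> forms n (d + k) \<and> x \<in> forms n d"
      "u' - s ^ k * x' \<in> C \<inter> forms n (d + k) \<and> x' \<in> forms n d"
    moreover have "u + u' - s ^ k * (x + x') = (u - s ^ k * x) + (u' - s ^ k * x')"
      by (simp add: algebra_simps)
    ultimately show "u + u' - s ^ k * (x + x') \<in> C \<inter> forms n (d + k) \<and> x + x' \<in> forms n d"
      by (simp only:) (blast intro: C_closed(2) forms_add)
  next
    fix c u x assume "u - s ^ k * x \<in> C \<inter> forms n (d + k) \<and> x \<in> forms n d"
    moreover have "const c * u - s ^ k * (const c * x) = const c * (u - s ^ k * x)"
      by (simp add: algebra_simps)
    ultimately show "const c * u - s ^ k * (const c * x) \<in> C \<inter> forms n (d + k) \<and> const c * x \<in> forms n d"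
      by (simp only:) (blast intro: C_closed(3) forms_const_mult)
  next
    fix u assume "u \<in> s_multiples k d"
    then show "\<exists>x\<in>L \<inter> forms n d. u - s ^ k * x \<in> C \<inter> forms n (d + k) \<and> x \<in> forms n d"
      unfolding s_multiples_def
    proof (elim CollectE exE conjE)
      fix x y assume "u = s ^ k * x + y" "x \<in> L \<inter> forms n d" "y \<in> C \<inter> forms n (d + k)"
      then show ?thesis by (intro bexI[of _ x]) auto
    qed
  next
    fix u x assume h: "u - s ^ k * x \<in> C \<inter> forms n (d + k) \<and> x \<in> forms n d" "x \<in> C \<inter> forms n d"
    then have "(u - s ^ k * x) + s ^ k * x \<in> C \<inter> forms n (d + k)"
      using C_closed(6)[of x k] forms_mult_st_power(1)[of x d k]
      by (intro IntI C_closed(2) forms_add) auto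
    then show "u \<in> C \<inter> forms n (d + k)" by simp
  qed (auto intro: L_closed C_closed)
  show "qdim (L \<inter> forms n d) (C \<inter> forms n d) \<le> qdim (s_multiples k d) (C \<inter> forms n (d + k))"
  proof (rule quot_dim_rel_mpoly[of "\<lambda>x u. u = s ^ k * x \<and> x \<in> forms n d"])
    fix x assume "x \<in> L \<inter> forms n d"
    then show "\<exists>u\<in>s_multiples k d. u = s ^ k * x \<and> x \<in> forms n d"
      unfolding s_multiples_def
      by (intro bexI[of _ "s ^ k * x"] CollectI exI[of _ x] exI[of _ 0]) (auto intro: L_closed C_closed)
  next
    fix x u assume "u = s ^ k * x \<and> x \<in> forms n d" "u \<in> C \<inter> forms n (d + k)"
    then show "x \<in> C \<inter> forms n d" using s_power_regular by blast
  qed (auto simp: ring_distribs mult.left_commute intro: L_closed C_closed)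
qed

lemma conormal_dim_add:
  "qdim (L \<inter> forms n (d + k)) (C \<inter> forms n (d + k)) =
   qdim (L \<inter> forms n (d + k)) (s_multiples k d) + qdim (L \<inter> forms n d) (C \<inter> forms n d)"
  using mpoly.quot_dim_add[OF subspaces(2)[of "d + k"] subspace_s_multiples[of k d] s_multiples_bounds(1) s_multiples_bounds(2)]
  by (simp add: s_multiples_dim)

text \<open>Multiplication by \<open>t\<close> is surjective on \<open>Q/sQ\<close> from degree 1 on, by generation in degree 1.\<close>

lemma conormal_increment_antitone:
  "qdim (L \<inter> forms n (Suc d + 1)) (s_multiples 1 (Suc d)) \<le> qdim (L \<inter> forms n (d + 1)) (s_multiples 1 d)"
proof (rule quot_dim_rel_mpoly[of "\<lambda>f q. f - t * q \<in> s_multiples 1 (Suc d)"])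
  note cl = mpoly.subspace_add[OF subspace_s_multiples] mpoly.subspace_scale[OF subspace_s_multiples, unfolded mpoly_scale_def]
  show "0 - t * 0 \<in> s_multiples 1 (Suc d)" using mpoly.subspace_0[OF subspace_s_multiples] by simp
  fix u x u' x'
  assume "u - t * x \<in> s_multiples 1 (Suc d)" "u' - t * x' \<in> s_multiples 1 (Suc d)"
  from cl(1)[OF this] show "u + u' - t * (x + x') \<in> s_multiples 1 (Suc d)" by (simp add: algebra_simps)
next
  note cl = mpoly.subspace_scale[OF subspace_s_multiples, unfolded mpoly_scale_def]
  fix c u x
  assume "u - t * x \<in> s_multiples 1 (Suc d)"
  from cl[OF this, of c] show "const c * u - t * (const c * x) \<in> s_multiples 1 (Suc d)" by (simp add: algebra_simps)
next
  fix f assume f: "f \<in> L \<inter> forms n (Suc d + 1)"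
  then obtain p q where pq: "p \<in> L \<inter> forms n (Suc d)" "q \<in> L \<inter> forms n (Suc d)" "f - s * p - t * q \<in> C"
    using L_generation[OF C_ideal L_square, of f "Suc d"] by auto
  have "f - s * p - t * q \<in> forms n (Suc d + 1)"
    using f pq forms_mult_st by auto
  then have "f - t * q \<in> s_multiples 1 (Suc d)"
    unfolding s_multiples_def using pq by (intro CollectI exI[of _ p] exI[of _ "f - s * p - t * q"]) auto
  then show "\<exists>q\<in>L \<inter> forms n (d + 1). f - t * q \<in> s_multiples 1 (Suc d)" using pq by auto
next
  fix f q assume f: "f - t * q \<in> s_multiples 1 (Suc d)" and "q \<in> s_multiples 1 d"
  then obtain x y where q: "q = s * x + y" "x \<in> L \<inter> forms n d" "y \<in> C \<inter> forms n (Suc d)"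
    unfolding s_multiples_def by auto
  have "t * q = s ^ 1 * (t * x) + t * y" by (simp add: q algebra_simps)
  then have "t * q \<in> s_multiples 1 (Suc d)"
    unfolding s_multiples_def using q forms_mult_st
    by (intro CollectI exI[of _ "t * x"] exI[of _ "t * y"]) (auto intro: L_closed C_closed)
  from mpoly.subspace_add[OF subspace_s_multiples f this] show "f \<in> s_multiples 1 (Suc d)" by simp
qed (rule mpoly.subspace_0[OF subspace_s_multiples])

lemma conormal_dim_0: "qdim (L \<inter> forms n 0) (C \<inter> forms n 0) = 0"
proof -
  have "f = 0" if "f \<in> L \<inter> forms n 0" for f
    using forms_0_const[of f n] that by (auto simp: mem_L_iff restr_simps)
  then have zero: "L \<inter> forms n 0 \<subseteq> {0}" by blast
  have "qdim (L \<inter> forms n 0) (C \<inter> forms n 0) \<le> enat (card ({} :: 'a mpoly set))"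
    by (intro mpoly.quot_dim_le_card[OF _ subspaces(2)]) (use zero C_closed(1) in auto)
  then show ?thesis by (simp add: zero_enat_def[symmetric])
qed

lemma conormal_dim_1: "qdim (L \<inter> forms n 1) (C \<inter> forms n 1) \<le> enat (n - 1)"
proof -
  have "qdim (L \<inter> forms n 1) (C \<inter> forms n 1) \<le> enat (card (ell ` ({..n} - {a, b})))"
    by (rule mpoly.quot_dim_le_card_span[OF _ L_linear_span subspaces(2)]) simp
  also have "card (ell ` ({..n} - {a, b})) \<le> card ({..n} - {a, b})" by (rule card_image_le) simp
  also have "card ({..n} - {a, b}) = n - 1" using ab by (subst card_Diff_subset) auto
  finally show ?thesis by simp
qed

lemma conormal_dims:
  obtains q :: "nat \<Rightarrow> nat" and N :: nat and c0 :: int and D :: nat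
  where "\<And>d. qdim (L \<inter> forms n d) (C \<inter> forms n d) = enat (q d)"
    "q 0 = 0" "\<And>d. q d \<le> (n - 1) * d"
    "\<And>d. int (q d) \<le> int N * int d + c0" "\<And>d. d \<ge> D \<Longrightarrow> int (q d) = int N * int d + c0"
proof -
  let ?q = "\<lambda>d. qdim (L \<inter> forms n d) (C \<inter> forms n d)"
  let ?c = "\<lambda>d. qdim (L \<inter> forms n (d + 1)) (s_multiples 1 d)"
  have step: "?q (Suc d) = ?c d + ?q d" for d
    using conormal_dim_add[of d 1] by simp
  have c0: "?c 0 \<le> enat (n - 1)" using step[of 0] conormal_dim_0 conormal_dim_1 by simp
  have cle: "?c d \<le> enat (n - 1)" for d
  proof (induction d)
    case (Suc d)
    then show ?case using conormal_increment_antitone[of d] order_trans by blast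
  qed (rule c0)
  then have "\<exists>x. ?c d = enat x" for d by (metis enat_ile)
  then obtain c where c: "\<And>d. ?c d = enat (c d)" by metis
  have "\<exists>x. ?q d = enat x" for d
  proof (induction d)
    case 0
    then show ?case using conormal_dim_0 by (auto simp: zero_enat_def)
  next
    case (Suc d)
    then show ?case using step[of d] c[of d] by auto
  qed
  then obtain q where q: "\<And>d. ?q d = enat (q d)" by metis
  have q0: "q 0 = 0" using conormal_dim_0 q[of 0] by (simp add: zero_enat_def)
  have qS: "q (Suc d) = c d + q d" for d using step[of d] by (simp only: q c plus_enat_simps enat.inject)
  have cS: "c (Suc d) \<le> c d" for d using conormal_increment_antitone[of d] by (simp only: c enat_ord_simps)
  note lin = antitone_increments_eventually_linear[of q c, OF q0 qS cS]
  have "c 0 \<le> n - 1" using c0 by (simp only: c enat_ord_simps)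
  then have "q d \<le> (n - 1) * d" for d using lin(2)[of d] by (meson le_trans mult_le_mono1)
  with lin(1) q q0 that show thesis by blast
qed

text \<open>The point \<open>P\<close> contributes 1 in every degree, and \<open>P/L\<close> is the coordinate ring of the line shifted by
multiplication by \<open>s\<close>.\<close>

lemma line_hilbert_function: "qdim (forms n d) (L \<inter> forms n d) = enat (Suc d)"
proof (induction d)
  have top: "qdim (forms n d) (P \<inter> forms n d) = enat 1" for d
  proof (rule antisym)
    have "qdim (forms n d) (P \<inter> forms n d) \<le> enat (card {t ^ d})"
    proof (rule mpoly.quot_dim_le_card[OF _ subspaces(3)])
      fix f :: "'a mpoly" assume f: "f \<in> forms n d"
      then obtain c l w where clw: "f = const c * t ^ d + l + s * w" "l \<in> L" "w \<in> forms n (d - 1)"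
        using form_mod_L by blast
      have "l + s * w \<in> P"
        using clw L_subset_P s_in_P forms_in_poly_ring by (intro poly_idealD(3,7)[OF P_ideal]) auto
      moreover have "f - const c * t ^ d \<in> forms n d"
        using f forms_const_mult[OF st_power_forms(2)] by auto
      ultimately show "\<exists>c. f - (\<Sum>x\<in>{t ^ d}. mpoly_scale (c x) x) \<in> P \<inter> forms n d"
        using clw(1) by (intro exI[of _ "\<lambda>_. c"]) (auto simp: mpoly_scale_def)
    qed simp
    then show "qdim (forms n d) (P \<inter> forms n d) \<le> enat 1" by simp
    have "enat (card {t ^ d}) \<le> qdim (forms n d) (P \<inter> forms n d)"
      by (rule mpoly.card_le_quot_dim)
        (auto simp: independent_mod_def mpoly_scale_def P_def subst_mult subst_power lam_mu)
    then show "enat 1 \<le> qdim (forms n d) (P \<inter> forms n d)" by simp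
  qed
  have add: "qdim (forms n d) (L \<inter> forms n d) = enat 1 + qdim (P \<inter> forms n d) (L \<inter> forms n d)" for d
    using mpoly.quot_dim_add[OF subspaces(1)[of d] subspaces(3)[of d], of "forms n d"] L_subset_P
    by (simp add: top Int_mono le_infI1)
  {
    case 0
    have "f = 0" if "f \<in> P \<inter> forms n 0" for f
      using forms_0_const[of f n] that by (auto simp: P_def)
    then have zero: "P \<inter> forms n 0 \<subseteq> {0}" by blast
    have "qdim (P \<inter> forms n 0) (L \<inter> forms n 0) \<le> enat (card ({} :: 'a mpoly set))"
      by (intro mpoly.quot_dim_le_card[OF _ subspaces(1)]) (use zero L_closed(1) in auto)
    then show ?case using add[of 0] by (simp add: zero_enat_def[symmetric])
  next
    case (Suc d)
    have "qdim (P \<inter> forms n (Suc d)) (L \<inter> forms n (Suc d)) = qdim (forms n d) (L \<inter> forms n d)"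
    proof (rule antisym)
      show "qdim (P \<inter> forms n (Suc d)) (L \<inter> forms n (Suc d)) \<le> qdim (forms n d) (L \<inter> forms n d)"
      proof (rule quot_dim_rel_mpoly[of "\<lambda>u x. u - s * x \<in> L \<inter> forms n (Suc d) \<and> x \<in> forms n d"])
        fix u x u' x'
        assume "u - s * x \<in> L \<inter> forms n (Suc d) \<and> x \<in> forms n d"
          "u' - s * x' \<in> L \<inter> forms n (Suc d) \<and> x' \<in> forms n d"
        moreover have "u + u' - s * (x + x') = (u - s * x) + (u' - s * x')"
          by (simp add: algebra_simps)
        ultimately show "u + u' - s * (x + x') \<in> L \<inter> forms n (Suc d) \<and> x + x' \<in> forms n d"
          by (simp only:) (blast intro: L_closed(2) forms_add)
      next
        fix c u x assume "u - s * x \<in> L \<inter> forms n (Suc d) \<and> x \<in> forms n d"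
        moreover have "const c * u - s * (const c * x) = const c * (u - s * x)"
          by (simp add: algebra_simps)
        ultimately show "const c * u - s * (const c * x) \<in> L \<inter> forms n (Suc d) \<and> const c * x \<in> forms n d"
          by (simp only:) (blast intro: L_closed(3) forms_const_mult)
      next
        fix u assume u: "u \<in> P \<inter> forms n (Suc d)"
        then obtain c l w where clw: "u = const c * t ^ Suc d + l + s * w" "l \<in> L" "l \<in> forms n (Suc d)" "w \<in> forms n d"
          using form_mod_L[of u "Suc d"] by auto
        have "l + s * w \<in> P"
          using clw L_subset_P s_in_P forms_in_poly_ring by (intro poly_idealD(3,7)[OF P_ideal]) auto
        then have "u - (l + s * w) \<in> P" using u by (intro poly_idealD(4)[OF P_ideal]) auto
        then have "c = 0" by (auto simp: clw(1) P_def subst_mult subst_power lam_mu)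
        then show "\<exists>x\<in>forms n d. u - s * x \<in> L \<inter> forms n (Suc d) \<and> x \<in> forms n d"
          using clw by (intro bexI[of _ w]) auto
      next
        fix u x assume h: "u - s * x \<in> L \<inter> forms n (Suc d) \<and> x \<in> forms n d" "x \<in> L \<inter> forms n d"
        then have "(u - s * x) + s * x \<in> L \<inter> forms n (Suc d)"
          using L_closed(4)[of x] forms_mult_st(1)[of x d] by (intro IntI L_closed(2) forms_add) auto
        then show "u \<in> L \<inter> forms n (Suc d)" by simp
      qed (auto intro: L_closed C_closed)
      show "qdim (forms n d) (L \<inter> forms n d) \<le> qdim (P \<inter> forms n (Suc d)) (L \<inter> forms n (Suc d))"
      proof (rule quot_dim_rel_mpoly[of "\<lambda>x u. u = s * x \<and> x \<in> forms n d"])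
        fix x :: "'a mpoly" assume "x \<in> forms n d"
        then show "\<exists>u\<in>P \<inter> forms n (Suc d). u = s * x \<and> x \<in> forms n d"
          using poly_idealD(7)[OF P_ideal forms_in_poly_ring s_in_P, of x d] forms_mult_st(1)[of x d]
          by (intro bexI[of _ "s * x"]) auto
      next
        fix x u assume "u = s * x \<and> x \<in> forms n d" "u \<in> L \<inter> forms n (Suc d)"
        then show "x \<in> L \<inter> forms n d" using L_cancel[of 1 x] forms_in_poly_ring by auto
      qed (auto simp: ring_distribs mult.left_commute intro: L_closed C_closed)
    qed
    then show ?case using add[of "Suc d"] Suc.IH by simp
  }
qed

lemma degree_genus:
  assumes q: "\<And>d. qdim (L \<inter> forms n d) (C \<inter> forms n d) = enat (q d)"
    and lin: "\<And>d. d \<ge> D \<Longrightarrow> int (q d) = int N * int d + c0"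
  shows "scheme_degree n C = real N + 1" "arithmetic_genus n C = - real_of_int c0"
proof -
  have "hilbert_function n C d = enat (Suc d + q d)" for d
    unfolding hilbert_function_def
    using mpoly.quot_dim_add[OF subspaces(2)[of d] subspaces(1)[of d], of "forms n d"] C_subset_L
    by (simp add: line_hilbert_function q Int_mono le_infI1 del: add_Suc)
  moreover have "real (q d) = real N * real d + real_of_int c0" if "d \<ge> D" for d
    using arg_cong[OF lin[OF that], of real_of_int] by simp
  ultimately have H: "hilbert_polynomial n C = [:1 + real_of_int c0, real N + 1:]"
    by (intro hilbert_polynomial_eqI[of D]) (simp add: algebra_simps)
  show "scheme_degree n C = real N + 1" "arithmetic_genus n C = - real_of_int c0"
    by (simp_all add: scheme_degree_def arithmetic_genus_def H)
qed

end

section \<open>Sections of the conormal sheaf and the Rao function\<close>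

lemma vector_space_cochain_scale: "vector_space cochain_scale"
proof
  fix c d :: 'a and x y :: "nat \<Rightarrow> nat \<Rightarrow> 'a mpoly fract"
  show "cochain_scale c (x + y) = cochain_scale c x + cochain_scale c y"
    by (simp add: cochain_scale_def fun_eq_iff algebra_simps)
  have "Fract (const (c + d)) 1 = Fract (const c) 1 + Fract (const d) 1"
    by (simp add: const_add)
  then show "cochain_scale (c + d) x = cochain_scale c x + cochain_scale d x"
    by (simp add: cochain_scale_def fun_eq_iff distrib_right del: add_fract)
  have "Fract (const c) 1 * Fract (const d) 1 = Fract (const (c * d)) 1"
    by (simp add: const_mult)
  then show "cochain_scale c (cochain_scale d x) = cochain_scale (c * d) x"
    by (simp add: cochain_scale_def fun_eq_iff mult.assoc[symmetric] del: mult_fract)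
  show "cochain_scale 1 x = x"
    by (simp add: cochain_scale_def fun_eq_iff One_fract_def[symmetric])
qed

lemma Fract_add_same_denominator: "v \<noteq> 0 \<Longrightarrow> Fract x v + Fract y v = Fract (x + y) v"
  by (simp add: eq_fract algebra_simps)

context rope_coordinates
begin

text \<open>Representatives \<open>f\<close>, of degree \<open>e = z + m\<close>, of the sections \<open>f/s\<^sup>m = f'/t\<^sup>m\<close> of degree \<open>z\<close> of the sheaf
associated with \<open>L/C\<close>.\<close>

definition sheaf_sections :: "nat \<Rightarrow> nat \<Rightarrow> 'a mpoly set" where
  "sheaf_sections m e = {f \<in> L \<inter> forms n e. \<exists>f'\<in>L \<inter> forms n e. t ^ m * f - s ^ m * f' \<in> C}"

text \<open>The representatives of those sections that are induced by forms of degree \<open>z\<close> in \<open>L\<close>; there are only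
the trivial ones if \<open>z\<close> is negative.\<close>

definition poly_sections :: "int \<Rightarrow> nat \<Rightarrow> nat \<Rightarrow> 'a mpoly set" where
  "poly_sections z m e = (if z \<ge> 0 then s_multiples m (nat z) else C \<inter> forms n e)"

text \<open>On the chart where \<open>var i\<close> does not vanish, the section \<open>f/s\<^sup>m\<close> of the sheaf of \<open>L/C\<close> is lifted to the
section \<open>h i / var i ^ (2 * m)\<close> of the ideal sheaf of the line. The exponent \<open>2 m\<close> works for all charts
simultaneously by \<open>form_mod_L_powers\<close>.\<close>

definition lifts :: "nat \<Rightarrow> nat \<Rightarrow> 'a mpoly \<Rightarrow> (nat \<Rightarrow> 'a mpoly) \<Rightarrow> bool" where
  "lifts m e f h \<longleftrightarrow> f \<in> L \<inter> forms n e \<and>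
     (\<forall>i\<le>n. h i \<in> L \<inter> forms n (e + m) \<and> s ^ m * h i - var i ^ (2 * m) * f \<in> C)"

text \<open>The image of a section under the connecting homomorphism, in terms of local lifts.\<close>

definition connecting_cochain :: "nat \<Rightarrow> (nat \<Rightarrow> 'a mpoly) \<Rightarrow> nat \<Rightarrow> nat \<Rightarrow> 'a mpoly fract" where
  "connecting_cochain m h = (\<lambda>i j. if i < j \<and> j \<le> n
     then Fract (h j) (var j ^ (2 * m)) - Fract (h i) (var i ^ (2 * m)) else 0)"

lemma subspace_sheaf_sections: "mpoly.subspace (sheaf_sections m e)"
  unfolding mpoly_subspace_iff
proof (intro conjI ballI allI)
  show "0 \<in> sheaf_sections m e"
    unfolding sheaf_sections_def using L_closed(1) C_closed(1) by (intro CollectI conjI bexI[of _ 0]) auto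
next
  fix f g assume "f \<in> sheaf_sections m e" "g \<in> sheaf_sections m e"
  then obtain f' g' where h: "f \<in> L \<inter> forms n e" "f' \<in> L \<inter> forms n e" "t ^ m * f - s ^ m * f' \<in> C"
    "g \<in> L \<inter> forms n e" "g' \<in> L \<inter> forms n e" "t ^ m * g - s ^ m * g' \<in> C"
    unfolding sheaf_sections_def by blast
  have "t ^ m * (f + g) - s ^ m * (f' + g') = (t ^ m * f - s ^ m * f') + (t ^ m * g - s ^ m * g')"
    by (simp add: algebra_simps)
  also have "\<dots> \<in> C" using h by (intro C_closed(2))
  finally show "f + g \<in> sheaf_sections m e"
    unfolding sheaf_sections_def using h
    by (intro CollectI conjI bexI[of _ "f' + g'"]) (auto intro: L_closed(2))
next
  fix c f assume "f \<in> sheaf_sections m e"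
  then obtain f' where h: "f \<in> L \<inter> forms n e" "f' \<in> L \<inter> forms n e" "t ^ m * f - s ^ m * f' \<in> C"
    unfolding sheaf_sections_def by blast
  have "t ^ m * (const c * f) - s ^ m * (const c * f') = const c * (t ^ m * f - s ^ m * f')"
    by (simp add: algebra_simps)
  also have "\<dots> \<in> C" using h by (intro C_closed(3))
  finally show "const c * f \<in> sheaf_sections m e"
    unfolding sheaf_sections_def using h
    by (intro CollectI conjI bexI[of _ "const c * f'"]) (auto intro: L_closed(3))
qed

lemma C_subset_poly_sections: "int e = z + int m \<Longrightarrow> C \<inter> forms n e \<subseteq> poly_sections z m e"
proof -
  assume e: "int e = z + int m"
  show ?thesis
  proof (cases "z \<ge> 0")
    case True
    then have "e = nat z + m" using e by simp
    then show ?thesis using True s_multiples_bounds(1)[of "nat z" m] by (simp add: poly_sections_def)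
  qed (simp add: poly_sections_def)
qed

lemma subspace_poly_sections: "mpoly.subspace (poly_sections z m e)"
  using subspace_s_multiples subspaces(2) by (simp add: poly_sections_def)

lemma C_subset_sheaf_sections: "C \<inter> forms n e \<subseteq> sheaf_sections m e"
proof
  fix f assume f: "f \<in> C \<inter> forms n e"
  then show "f \<in> sheaf_sections m e"
    unfolding sheaf_sections_def using C_subset_L L_closed(1) C_closed(7)[of f m]
    by (intro CollectI conjI bexI[of _ 0]) auto
qed

lemma poly_sections_subset: "int e = z + int m \<Longrightarrow> poly_sections z m e \<subseteq> sheaf_sections m e"
proof -
  assume e: "int e = z + int m"
  show ?thesis
  proof (cases "z \<ge> 0")
    case True
    then have e': "e = nat z + m" using e by simp
    have "s_multiples m (nat z) \<subseteq> sheaf_sections m e"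
    proof
      fix u assume "u \<in> s_multiples m (nat z)"
      then obtain x y where u: "u = s ^ m * x + y" and x: "x \<in> L \<inter> forms n (nat z)"
        and y: "y \<in> C \<inter> forms n (nat z + m)" unfolding s_multiples_def by blast
      have "s ^ m * x \<in> sheaf_sections m e"
        unfolding sheaf_sections_def using x forms_mult_st_power[of x "nat z" m] L_closed(6,7)[of x m] C_closed(1)
        by (intro CollectI conjI bexI[of _ "t ^ m * x"]) (auto simp: e' mult.left_commute)
      then show "u \<in> sheaf_sections m e"
        unfolding u using y C_subset_sheaf_sections e' by (intro mpoly.subspace_add[OF subspace_sheaf_sections]) auto
    qed
    then show ?thesis using True by (simp add: poly_sections_def)
  qed (simp add: poly_sections_def C_subset_sheaf_sections)
qed

lemma poly_sections_dim:
  assumes "int e = z + int m"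
  shows "qdim (poly_sections z m e) (C \<inter> forms n e)
    = (if z \<ge> 0 then qdim (L \<inter> forms n (nat z)) (C \<inter> forms n (nat z)) else 0)"
proof (cases "z \<ge> 0")
  case True
  then have e': "e = nat z + m" using assms by simp
  then show ?thesis using True s_multiples_dim[of m "nat z"] by (simp add: poly_sections_def)
next
  case False
  have "qdim (C \<inter> forms n e) (C \<inter> forms n e) \<le> enat (card ({} :: 'a mpoly set))"
    by (rule mpoly.quot_dim_le_card[OF _ subspaces(2)]) auto
  then show ?thesis using False by (simp add: poly_sections_def zero_enat_def[symmetric])
qed

text \<open>The sections are the kernel of multiplication by \<open>t\<^sup>m\<close> from degree \<open>e\<close> of \<open>Q\<close> to degree \<open>e + m\<close> of
\<open>Q/s\<^sup>m Q\<close>.\<close>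

lemma sheaf_sections_dim:
  "qdim (L \<inter> forms n e) (C \<inter> forms n e)
   \<le> qdim (L \<inter> forms n (e + m)) (s_multiples m e) + qdim (sheaf_sections m e) (C \<inter> forms n e)"
proof -
  have "qdim (L \<inter> forms n e) (sheaf_sections m e) \<le> qdim (L \<inter> forms n (e + m)) (s_multiples m e)"
  proof (rule quot_dim_rel_mpoly[of "\<lambda>f y. y = t ^ m * f \<and> f \<in> L \<inter> forms n e"])
    fix f assume "f \<in> L \<inter> forms n e"
    then show "\<exists>y\<in>L \<inter> forms n (e + m). y = t ^ m * f \<and> f \<in> L \<inter> forms n e"
      using forms_mult_st_power(2)[of f e m] L_closed(7)[of f m] by (intro bexI[of _ "t ^ m * f"]) auto
  next
    fix f y assume h: "y = t ^ m * f \<and> f \<in> L \<inter> forms n e" "y \<in> s_multiples m e"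
    then obtain x c where "t ^ m * f = s ^ m * x + c" "x \<in> L \<inter> forms n e" "c \<in> C"
      unfolding s_multiples_def by blast
    then show "f \<in> sheaf_sections m e"
      unfolding sheaf_sections_def using h by (intro CollectI conjI bexI[of _ x]) auto
  next
    show "0 \<in> s_multiples m e" by (rule mpoly.subspace_0[OF subspace_s_multiples])
  qed (auto simp: ring_distribs mult.left_commute intro: L_closed C_closed)
  moreover have sections_sub: "sheaf_sections m e \<subseteq> L \<inter> forms n e" by (auto simp: sheaf_sections_def)
  ultimately show ?thesis
    using mpoly.quot_dim_add[OF subspaces(2)[of e] subspace_sheaf_sections[of m e] C_subset_sheaf_sections, of "L \<inter> forms n e"]
    sections_sub by (simp add: add_right_mono)
qed

lemma lifts_exist:
  assumes "f \<in> sheaf_sections m e"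
  shows "\<exists>h. lifts m e f h"
proof -
  obtain f' where f: "f \<in> L \<inter> forms n e" "f' \<in> L \<inter> forms n e" "t ^ m * f - s ^ m * f' \<in> C"
    using assms unfolding sheaf_sections_def by blast
  have "\<exists>h. h \<in> L \<inter> forms n (e + m) \<and> s ^ m * h - var i ^ (2 * m) * f \<in> C" if i: "i \<le> n" for i
  proof -
    have "var i ^ (2 * m) \<in> forms n (2 * m)" using i by auto
    then obtain p q l where pq: "var i ^ (2 * m) = s ^ m * p + t ^ m * q + l"
      "p \<in> forms n m" "q \<in> forms n m" "l \<in> L"
      using form_mod_L_powers[of "var i ^ (2 * m)" "2 * m" m m] by (auto simp: mult_2)
    let ?h = "p * f + q * f'"
    have pc: "p \<in> carrier (poly_ring n)" "q \<in> carrier (poly_ring n)"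
      using pq forms_in_poly_ring by blast+
    have "s ^ m * ?h - var i ^ (2 * m) * f = - (q * (t ^ m * f - s ^ m * f') + l * f)"
      unfolding pq(1) by (simp add: algebra_simps)
    also have "\<dots> \<in> C"
      using f pq pc by (intro poly_idealD(5)[OF C_ideal] C_closed(2) poly_idealD(6)[OF C_ideal] L_square) auto
    finally have "s ^ m * ?h - var i ^ (2 * m) * f \<in> C" .
    moreover have "?h \<in> L" using f pc by (intro L_closed(2) poly_idealD(6)[OF L_ideal]) auto
    moreover have "?h \<in> forms n (e + m)"
      using forms_mult[OF pq(2), of f e] forms_mult[OF pq(3), of f' e] f by (auto simp: add.commute)
    ultimately show ?thesis by blast
  qed
  then obtain h where "\<And>i. i \<le> n \<Longrightarrow> h i \<in> L \<inter> forms n (e + m) \<and> s ^ m * h i - var i ^ (2 * m) * f \<in> C"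
    by metis
  then show ?thesis using f unfolding lifts_def by blast
qed

lemma connecting_cochain_cocycle:
  assumes h: "lifts m e f h" and e: "int e = z + int m"
  shows "connecting_cochain m h \<in> cech_cocycles1 n C z"
  unfolding cech_cocycles1_def
proof (intro CollectI conjI allI impI)
  fix i j
  show "if i < j \<and> j \<le> n then connecting_cochain m h i j \<in> sections n C z 2 (var i * var j)
        else connecting_cochain m h i j = 0"
  proof (cases "i < j \<and> j \<le> n")
    case True
    then have ij: "i \<le> n" "j \<le> n" by auto
    let ?N = "h j * var i ^ (2 * m) - h i * var j ^ (2 * m)"
    have hi: "h i \<in> forms n (e + m)" "s ^ m * h i - var i ^ (2 * m) * f \<in> C"
      and hj: "h j \<in> forms n (e + m)" "s ^ m * h j - var j ^ (2 * m) * f \<in> C"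
      using h ij by (auto simp: lifts_def)
    have "s ^ m * ?N = var i ^ (2 * m) * (s ^ m * h j - var j ^ (2 * m) * f)
        - var j ^ (2 * m) * (s ^ m * h i - var i ^ (2 * m) * f)"
      by (simp add: algebra_simps)
    also have "\<dots> \<in> C"
      using ij by (intro poly_idealD(4)[OF C_ideal] poly_idealD(6)[OF C_ideal _ hi(2)]
          poly_idealD(6)[OF C_ideal _ hj(2)]) auto
    finally have "s ^ m * ?N \<in> C" .
    moreover have NF: "?N \<in> forms n (e + m + 2 * m)"
      using forms_mult[OF hi(1) forms_var_power[OF ij(2), of "2 * m"]]
        forms_mult[OF hj(1) forms_var_power[OF ij(1), of "2 * m"]] by auto
    ultimately have NC: "?N \<in> C" using s_power_regular by blast
    have "connecting_cochain m h i j = Fract ?N ((var i * var j) ^ (2 * m))"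
      using True by (simp add: connecting_cochain_def power_mult_distrib mult.commute)
    moreover have "int (e + m + 2 * m) = z + int (2 * m * 2)" using e by simp
    ultimately have "connecting_cochain m h i j \<in> sections n C z 2 (var i * var j)"
      unfolding sections_def using NC NF by blast
    then show ?thesis using True by simp
  qed (auto simp: connecting_cochain_def)
next
  fix i j l assume ijl: "i < j \<and> j < l \<and> l \<le> n"
  define E where "E = (\<lambda>i. Fract (h i) (var i ^ (2 * m)))"
  have "connecting_cochain m h = (\<lambda>i j. if i < j \<and> j \<le> n then E j - E i else 0)"
    unfolding connecting_cochain_def E_def ..
  with ijl show "connecting_cochain m h j l - connecting_cochain m h i l + connecting_cochain m h i j = 0"
    by simp
qed

text \<open>If the cochain is a coboundary, the local lifts can be corrected by sections of the ideal sheaf of the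
curve so as to agree on all charts. On the charts of \<open>s\<close> and \<open>t\<close> the common value is a fraction with a
power of \<open>s\<close> and with a power of \<open>t\<close> as denominator, hence a form \<open>w\<close> of degree \<open>z\<close>, and \<open>f\<close> is congruent
to \<open>s\<^sup>m w\<close>.\<close>

lemma connecting_cochain_coboundary:
  assumes h: "lifts m e f h" and e: "int e = z + int m"
    and cob: "connecting_cochain m h \<in> cech_coboundaries1 n C z"
  shows "f \<in> poly_sections z m e"
proof -
  obtain g where g: "\<And>i. i \<le> n \<Longrightarrow> g i \<in> sections n C z 1 (var i)"
    and eq: "connecting_cochain m h = (\<lambda>i j. if i < j \<and> j \<le> n then g j - g i else 0)"
    using cob unfolding cech_coboundaries1_def by blast
  have f: "f \<in> L" "f \<in> forms n e" using h by (auto simp: lifts_def)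
  have ha: "h a \<in> forms n (e + m)" "s ^ m * h a - s ^ (2 * m) * f \<in> C"
    and hb: "h b \<in> forms n (e + m)"
    using h ab by (auto simp: lifts_def)
  obtain ca p da where ga: "g a = Fract ca (s ^ p)" "ca \<in> C" "ca \<in> forms n da" "int da = z + int p"
    using g[OF ab(1)] unfolding sections_def by auto
  obtain cb q db where gb: "g b = Fract cb (t ^ q)" "cb \<in> forms n db" "int db = z + int q"
    using g[OF ab(2)] unfolding sections_def by auto
  \<comment> \<open>Numerators of the corrected lifts on the two charts.\<close>
  define A where "A = h a * s ^ p - ca * s ^ (2 * m)"
  define B where "B = h b * t ^ q - cb * t ^ (2 * m)"
  have "Fract (h b) (t ^ (2 * m)) - Fract (h a) (s ^ (2 * m)) = g b - g a"
  proof (cases "a < b")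
    case True
    then show ?thesis
      using fun_cong[OF fun_cong[OF eq, of a], of b] ab
      by (simp add: connecting_cochain_def del: diff_fract)
  next
    case False
    then have "Fract (h a) (s ^ (2 * m)) - Fract (h b) (t ^ (2 * m)) = g a - g b"
      using fun_cong[OF fun_cong[OF eq, of b], of a] ab
      by (simp add: connecting_cochain_def del: diff_fract)
    then show ?thesis by (metis minus_diff_eq)
  qed
  then have "Fract (h a) (s ^ (2 * m)) - g a = Fract (h b) (t ^ (2 * m)) - g b"
    by (simp add: algebra_simps del: diff_fract add_fract)
  then have "Fract A (s ^ (2 * m) * s ^ p) = Fract B (t ^ (2 * m) * t ^ q)"
    by (simp add: ga gb A_def B_def)
  then have AB: "t ^ (2 * m + q) * A = s ^ (2 * m + p) * B"
    by (simp add: eq_fract power_add mult.commute mult.left_commute)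
  have "int da + int (2 * m) = int (e + m + p)" using ga(4) e by simp
  then have da: "da + 2 * m = e + m + p" by linarith
  have AF: "A \<in> forms n (e + m + p)"
    using forms_mult[OF ha(1) st_power_forms(1), of p] forms_mult[OF ga(3) st_power_forms(1), of "2 * m"] da
    by (simp add: A_def)
  have "\<exists>w. A = s ^ (2 * m + p) * w \<and> (w = 0 \<or> (z \<ge> 0 \<and> w \<in> forms n (nat z)))"
  proof (cases "A = 0")
    case True
    then show ?thesis by (intro exI[of _ 0]) simp
  next
    case False
    obtain w where w: "2 * m + p \<le> e + m + p" "w \<in> forms n (e + m + p - (2 * m + p))" "A = s ^ (2 * m + p) * w"
      using form_power_dvd_form[OF ab(1,3) AF AB False] by blast
    have "z \<ge> 0" "e + m + p - (2 * m + p) = nat z" using w(1) e by linarith+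
    then show ?thesis using w by auto
  qed
  then obtain w where w: "A = s ^ (2 * m + p) * w" "w = 0 \<or> (z \<ge> 0 \<and> w \<in> forms n (nat z))" by blast
  have wF: "s ^ m * w \<in> forms n e"
  proof (cases "w = 0")
    case False
    then have "z \<ge> 0" "w \<in> forms n (nat z)" "e = nat z + m" using w(2) e by auto
    then show ?thesis using forms_mult_st_power(1) by simp
  qed simp
  have "s ^ (2 * m + p) * (f - s ^ m * w) = s ^ p * (s ^ (2 * m) * f) - s ^ m * (s ^ (2 * m + p) * w)"
    by (simp add: power_add algebra_simps)
  also have "s ^ (2 * m + p) * w = h a * s ^ p - ca * s ^ (2 * m)" using w(1) by (simp add: A_def)
  also have "s ^ p * (s ^ (2 * m) * f) - s ^ m * (h a * s ^ p - ca * s ^ (2 * m))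
      = s ^ m * (s ^ (2 * m) * ca) - s ^ p * (s ^ m * h a - s ^ (2 * m) * f)"
    by (simp add: algebra_simps)
  also have "\<dots> \<in> C"
    by (intro poly_idealD(4)[OF C_ideal] C_closed(6)[OF ha(2)] C_closed(6) ga(2))
  finally have "s ^ (2 * m + p) * (f - s ^ m * w) \<in> C" .
  then have fw: "f - s ^ m * w \<in> C"
    using s_power_regular[of "f - s ^ m * w" e] f(2) wF by auto
  show ?thesis
  proof (cases "w = 0")
    case True
    then show ?thesis using fw f(2) C_subset_poly_sections[OF e] by auto
  next
    case False
    then have z: "z \<ge> 0" "w \<in> forms n (nat z)" "e = nat z + m" using w(2) e by auto
    have "f - (f - s ^ m * w) \<in> L" by (rule poly_idealD(4)[OF L_ideal f(1) subsetD[OF C_subset_L fw]])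
    then have "w \<in> L" using L_cancel[of m w] z(2) forms_in_poly_ring by auto
    moreover have "f - s ^ m * w \<in> forms n (nat z + m)" using f(2) wF z(3) by auto
    ultimately have "f \<in> s_multiples m (nat z)"
      unfolding s_multiples_def using z fw by (intro CollectI exI[of _ w] exI[of _ "f - s ^ m * w"]) auto
    then show ?thesis using z(1) by (simp add: poly_sections_def)
  qed
qed

lemma sheaf_sections_le_rao:
  assumes e: "int e = z + int m"
  shows "qdim (sheaf_sections m e) (poly_sections z m e) \<le> rao_function n C z"
  unfolding rao_function_def
proof (rule quot_dim_relation_le[OF vector_space_mpoly_scale vector_space_cochain_scale,
    of "\<lambda>f \<sigma>. \<exists>h. lifts m e f h \<and> \<sigma> = connecting_cochain m h"])
  show "\<exists>h. lifts m e 0 h \<and> 0 = connecting_cochain m h"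
    using L_closed(1) C_closed(1)
    by (intro exI[of _ "\<lambda>_. 0"]) (auto simp: lifts_def connecting_cochain_def fun_eq_iff fract_collapse)
next
  fix f \<sigma> f' \<sigma>'
  assume "\<exists>h. lifts m e f h \<and> \<sigma> = connecting_cochain m h" "\<exists>h. lifts m e f' h \<and> \<sigma>' = connecting_cochain m h"
  then obtain h h' where h: "lifts m e f h" "\<sigma> = connecting_cochain m h"
      "lifts m e f' h'" "\<sigma>' = connecting_cochain m h'" by blast
  have "s ^ m * (h i + h' i) - var i ^ (2 * m) * (f + f') \<in> C" if "i \<le> n" for i
  proof -
    have "s ^ m * (h i + h' i) - var i ^ (2 * m) * (f + f')
        = (s ^ m * h i - var i ^ (2 * m) * f) + (s ^ m * h' i - var i ^ (2 * m) * f')"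
      by (simp add: algebra_simps)
    also have "\<dots> \<in> C" using h that by (intro C_closed(2)) (auto simp: lifts_def)
    finally show ?thesis .
  qed
  then have "lifts m e (f + f') (\<lambda>i. h i + h' i)"
    using h by (auto simp: lifts_def intro: L_closed(2))
  moreover have "\<sigma> + \<sigma>' = connecting_cochain m (\<lambda>i. h i + h' i)"
    by (simp add: h connecting_cochain_def fun_eq_iff Fract_add_same_denominator[symmetric] del: add_fract diff_fract)
  ultimately show "\<exists>h. lifts m e (f + f') h \<and> \<sigma> + \<sigma>' = connecting_cochain m h" by blast
next
  fix c f \<sigma>
  assume "\<exists>h. lifts m e f h \<and> \<sigma> = connecting_cochain m h"
  then obtain h where h: "lifts m e f h" "\<sigma> = connecting_cochain m h" by blast
  have "s ^ m * (const c * h i) - var i ^ (2 * m) * (const c * f) \<in> C" if "i \<le> n" for i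
  proof -
    have "s ^ m * (const c * h i) - var i ^ (2 * m) * (const c * f)
        = const c * (s ^ m * h i - var i ^ (2 * m) * f)"
      by (simp add: algebra_simps)
    also have "\<dots> \<in> C" using h that by (intro C_closed(3)) (auto simp: lifts_def)
    finally show ?thesis .
  qed
  then have "lifts m e (mpoly_scale c f) (\<lambda>i. const c * h i)"
    using h by (auto simp: lifts_def mpoly_scale_def intro: L_closed(3) forms_const_mult)
  moreover have "cochain_scale c \<sigma> = connecting_cochain m (\<lambda>i. const c * h i)"
    by (simp add: h connecting_cochain_def cochain_scale_def fun_eq_iff right_diff_distrib del: diff_fract)
  ultimately show "\<exists>h. lifts m e (mpoly_scale c f) h \<and> cochain_scale c \<sigma> = connecting_cochain m h" by blast
next
  fix f assume "f \<in> sheaf_sections m e"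
  then obtain h where h: "lifts m e f h" using lifts_exist by blast
  then show "\<exists>\<sigma>\<in>cech_cocycles1 n C z. \<exists>h. lifts m e f h \<and> \<sigma> = connecting_cochain m h"
    using connecting_cochain_cocycle[OF h e] by blast
next
  fix f \<sigma> assume "\<exists>h. lifts m e f h \<and> \<sigma> = connecting_cochain m h" "\<sigma> \<in> cech_coboundaries1 n C z"
  then show "f \<in> poly_sections z m e" using connecting_cochain_coboundary[OF _ e] by blast
next
  \<comment> \<open>For negative \<open>z\<close> even the zero section is written with a denominator, so that the numerator has nonnegative degree.\<close>
  have "0 \<in> sections n C z 1 (var i)" if "i \<le> n" for i
  proof -
    have "(0 :: 'a mpoly fract) = Fract 0 (var i ^ nat (- z))" by (simp add: fract_collapse)
    moreover have "int (nat z) = z + int (nat (- z) * 1)" by simp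
    ultimately show ?thesis unfolding sections_def using C_closed(1) by blast
  qed
  then show "0 \<in> cech_coboundaries1 n C z"
    unfolding cech_coboundaries1_def by (intro CollectI exI[of _ "\<lambda>_. 0"]) (auto simp: fun_eq_iff)
qed

text \<open>The number \<open>m\<close> is chosen so large that \<open>q\<close> is already linear in the degrees \<open>z + m\<close> and \<open>z + 2m\<close>; then
\<open>2 q (z + m) - q (z + 2m)\<close> is the value at \<open>z\<close> of the linear function.\<close>

lemma rao_lower_bound:
  assumes q: "\<And>d. qdim (L \<inter> forms n d) (C \<inter> forms n d) = enat (q d)"
    and lin: "\<And>d. d \<ge> D \<Longrightarrow> int (q d) = int N * int d + c0"
  shows "enat (nat (int N * z + c0 - (if z \<ge> 0 then int (q (nat z)) else 0))) \<le> rao_function n C z"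
proof -
  define m where "m = D + nat (- z)"
  define e where "e = nat (z + int m)"
  have e: "int e = z + int m" "e \<ge> D" by (auto simp: e_def m_def)
  let ?X = "qdim (sheaf_sections m e) (C \<inter> forms n e)" and ?R = "qdim (sheaf_sections m e) (poly_sections z m e)"
  define r where "r = (if z \<ge> 0 then q (nat z) else 0)"
  have X: "?X = ?R + enat r"
    using mpoly.quot_dim_add[OF subspaces(2)[of e] subspace_poly_sections
        C_subset_poly_sections[OF e(1)] poly_sections_subset[OF e(1)]] poly_sections_dim[OF e(1)]
    by (simp add: r_def q zero_enat_def)
  obtain y where y: "qdim (L \<inter> forms n (e + m)) (s_multiples m e) = enat y" "q (e + m) = y + q e"
    using conormal_dim_add[of e m] unfolding q
    by (cases "qdim (L \<inter> forms n (e + m)) (s_multiples m e)") auto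
  have le: "enat (q e) \<le> enat y + ?X" using sheaf_sections_dim[of e m] by (simp only: q y)
  have "int (q e) = int N * int e + c0" "int (q (e + m)) = int N * int (e + m) + c0"
    using lin e(2) by auto
  then have "int (q e) - int y = int N * (int e - int m) + c0"
    using y(2) by (simp add: algebra_simps)
  then have val: "int (q e) - int y = int N * z + c0" using e(1) by simp
  have "enat (nat (int N * z + c0 - int r)) \<le> ?R"
  proof (cases ?R)
    case (enat x)
    then have "q e \<le> y + (x + r)" using le X by simp
    then show ?thesis using val enat by simp
  qed simp
  then show ?thesis
    using sheaf_sections_le_rao[OF e(1)] order_trans by (fastforce simp: r_def)
qed

end

section \<open>Balanced sequences and the bound\<close>

lemma sum_nth_two_values:
  fixes f :: "'b \<Rightarrow> int"
  assumes "u \<le> N"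
  shows "(\<Sum>i<N. f ((replicate (N - u) x @ replicate u y) ! i)) = int (N - u) * f x + int u * f y"
proof -
  have "(\<Sum>i<length xs. f (xs ! i)) = sum_list (map f xs)" for xs
    by (simp add: sum_list_sum_nth atLeast0LessThan)
  from this[of "replicate (N - u) x @ replicate u y"] show ?thesis
    using assms by (simp add: sum_list_replicate)
qed

text \<open>As \<open>x\<close> and \<open>x + 1\<close> are consecutive integers, all summands have the same weak sign.\<close>

lemma sum_positive_parts_balanced:
  fixes x :: int
  assumes "u \<le> N"
  shows "int (N - u) * max x 0 + int u * max (x + 1) 0 = max (int N * x + int u) 0"
proof (cases "x \<ge> 0")
  case True
  then show ?thesis using assms by (simp add: of_nat_diff algebra_simps)
next
  case False
  then have "max x 0 = 0" "max (x + 1) 0 = 0" by auto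
  moreover have "int N * x \<le> int N * (- 1)" using False by (intro mult_left_mono) auto
  ultimately show ?thesis using assms by simp
qed

lemma int_binom_1: "int_binom x 1 = max x 0"
  by (simp add: int_binom_def)

lemma rho_min_eq:
  fixes g :: int
  assumes k: "1 \<le> k" "k \<le> n - 2"
  shows "rho_min n k g z = max (int (n - 1 - k) * z - g) 0 + max (int k * z + g) 0 - int (n - 1) * max z 0"
proof -
  define N where "N = n - 1 - k"
  have N: "n - 2 + 1 - k = N" "N > 0" "{0..n - 2 - k} = {..<N}" "int (n - 2 + 1) = int (n - 1)"
    using k by (auto simp: N_def)
  define p u where "p = (- g) div int N" and "u = nat ((- g) mod int N)"
  have u: "u \<le> N" "int N * p + int u = - g"
    using N(2) less_imp_le[OF pos_mod_bound[of "int N" "- g"]] by (simp_all add: p_def u_def nat_le_iff)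
  have alpha: "(\<Sum>i = 0..n - 2 - k. int_binom (z + alpha_min n k g ! i) 1) = max (int N * z - g) 0"
  proof -
    have "(\<Sum>i = 0..n - 2 - k. int_binom (z + alpha_min n k g ! i) 1)
        = int (N - u) * max (z + p) 0 + int u * max (z + p + 1) 0"
    proof -
      have "alpha_min n k g = replicate (N - u) p @ replicate u (p + 1)"
        by (simp only: alpha_min_def N(1) Let_def p_def u_def)
      then show ?thesis
        unfolding int_binom_1 N(3) using sum_nth_two_values[OF u(1), of "\<lambda>x. max (z + x) 0" p "p + 1"]
        by (simp only: add.assoc)
    qed
    also have "\<dots> = max (int N * z - g) 0"
      unfolding sum_positive_parts_balanced[OF u(1)] using u(2) by (simp add: distrib_left add.assoc)
    finally show ?thesis .
  qed
  define p' v where "p' = (- g) div int k" and "v = nat ((- g) mod int k)"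
  have v: "v \<le> k" "int k * p' + int v = - g"
    using k less_imp_le[OF pos_mod_bound[of "int k" "- g"]] by (simp_all add: p'_def v_def nat_le_iff)
  have "(\<Sum>j = 1..k. int_binom (z - beta_min k g ! (j - 1)) 1) = max (int k * z + g) 0"
  proof -
    have "(\<Sum>j = 1..k. int_binom (z - beta_min k g ! (j - 1)) 1) = (\<Sum>j<k. max (z - beta_min k g ! j) 0)"
      unfolding int_binom_1 by (rule sum.reindex_bij_witness[of _ Suc "\<lambda>j. j - 1"]) auto
    also have "\<dots> = int (k - v) * max (z - p') 0 + int v * max (z - p' - 1) 0"
    proof -
      have "beta_min k g = replicate (k - v) p' @ replicate v (p' + 1)"
        by (simp only: beta_min_def Let_def p'_def v_def)
      then show ?thesis
        using sum_nth_two_values[OF v(1), of "\<lambda>x. max (z - x) 0" p' "p' + 1"]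
        by (simp only: diff_diff_eq)
    qed
    \<comment> \<open>Of the two consecutive values the smaller one is \<open>z - p' - 1\<close>.\<close>
    also have "\<dots> = int v * max (z - p' - 1) 0 + int (k - v) * max (z - p' - 1 + 1) 0" by simp
    also have "\<dots> = max (int k * (z - p' - 1) + int (k - v)) 0"
      using sum_positive_parts_balanced[of "k - v" k "z - p' - 1"] v(1) by simp
    also have "int k * (z - p' - 1) + int (k - v) = int k * z + g"
      using v by (simp add: of_nat_diff algebra_simps)
    finally show ?thesis .
  qed
  with alpha show ?thesis
    unfolding rho_min_def Let_def int_binom_1[of z] N(4) N_def[symmetric] by simp
qed

text \<open>As \<open>g \<le> 0\<close> and \<open>N z - g\<close> and \<open>k z + g\<close> add up to \<open>(n - 1) z\<close>, the minimal function equals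
\<open>N z - g - min (N z - g) ((n - 1) z)\<close> for \<open>z \<ge> 0\<close> and the positive part of \<open>N z - g\<close> for \<open>z < 0\<close>, which
is matched by the two upper bounds for \<open>q z\<close>.\<close>

theorem proposition6p9:
  fixes C :: "'a::field mpoly set" and n k :: nat and g :: int
  assumes "1 \<le> k" and "k \<le> n - 2"
    and "rope n C"
    and "scheme_degree n C = real (n - k)"
    and "arithmetic_genus n C = real_of_int g"
  shows "\<forall>z::int. ereal_of_enat (rao_function n C z) \<ge> ereal (real_of_int (rho_min n k g z))"
proof
  fix z :: int
  obtain L where L: "line n L" "points n C = points n L" "ideal_prod (poly_ring n) L L \<subseteq> C" and C: "curve n C"
    using assms(3) unfolding rope_def by blast
  obtain a b lam mu where "line_coordinates n a b lam mu L"
    using line_coordinates_exist[OF L(1)] by blast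
  then interpret rope_coordinates n a b lam mu L C
  proof (intro rope_coordinates.intro rope_coordinates_axioms.intro)
    show "ideal C (poly_ring n)" "saturated n C" "locally_cohen_macaulay n C"
      using C by (auto simp: curve_def closed_subscheme_def homogeneous_ideal_def)
    show "points n C = points n L" by (rule L(2))
    show "x * y \<in> C" if "x \<in> L" "y \<in> L" for x y
      using ideal_prod.prod[of x L y L "poly_ring n"] that L(3) by auto
  qed
  obtain q :: "nat \<Rightarrow> nat" and N :: nat and c0 :: int and D :: nat where
    q: "\<And>d. qdim (L \<inter> forms n d) (C \<inter> forms n d) = enat (q d)" and q0: "q 0 = 0"
    and qn: "\<And>d. q d \<le> (n - 1) * d"
    and qle: "\<And>d. int (q d) \<le> int N * int d + c0" and qeq: "\<And>d. d \<ge> D \<Longrightarrow> int (q d) = int N * int d + c0"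
    using conormal_dims by blast
  have N: "N = n - 1 - k" and c0: "c0 = - g"
  proof -
    have "scheme_degree n C = real N + 1" "arithmetic_genus n C = - real_of_int c0"
      using degree_genus[of q D N c0] q qeq by blast+
    with assms(1,2,4,5) show "N = n - 1 - k" "c0 = - g" by linarith+
  qed
  define r where "r = int N * z + c0 - (if z \<ge> 0 then int (q (nat z)) else 0)"
  have "rho_min n k g z \<le> int (nat r)"
  proof (cases "z \<ge> 0")
    case True
    have mz: "max z 0 = z" using True by simp
    have kz: "int N * z + int k * z = int (n - 1) * z"
      using assms(1,2) by (simp add: N of_nat_diff algebra_simps)
    have "int (q (nat z)) \<le> int (n - 1) * z"
      using qn[of "nat z"] True by (metis int_nat_eq of_nat_le_iff of_nat_mult)
    moreover have "int (q (nat z)) \<le> int N * z - g" using qle[of "nat z"] True c0 by simp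
    ultimately have "rho_min n k g z \<le> r"
      using True kz unfolding rho_min_eq[OF assms(1,2)] mz N[symmetric] r_def c0
      unfolding max_def
      by (simp only: if_True split: if_splits) linarith
    then show ?thesis by simp
  next
    case False
    have "g \<le> 0" using qle[of 0] q0 c0 by simp
    moreover have "int k * z \<le> 0" using False by (simp add: mult_nonneg_nonpos)
    ultimately show ?thesis
      using False unfolding rho_min_eq[OF assms(1,2)] N[symmetric] r_def c0 by simp
  qed
  moreover have "enat (nat r) \<le> rao_function n C z"
    unfolding r_def by (rule rao_lower_bound[of q D]) (use q qeq in auto)
  then have "ereal_of_enat (enat (nat r)) \<le> ereal_of_enat (rao_function n C z)"
    by (simp only: ereal_of_enat_le_iff)
  ultimately show "ereal (real_of_int (rho_min n k g z)) \<le> ereal_of_enat (rao_function n C z)"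
    by (smt (verit) ereal_less_eq(3) ereal_of_enat_simps(1) of_int_le_iff of_int_of_nat_eq order_trans)
qed

end
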